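(* Let $w\in\mathrm{BV}_W(\Omega)$ and let $(h,\tau_h)$ with $h>0$ be an admissible mesh pair. Then $$\operatorname{TV}^h\big(R^W_{P0^{\tau_h}}(w)\big)\le\operatorname{TV}^h(w)+\varepsilon(\tau_h,h,w)\le\operatorname{TV}(w)+\varepsilon(\tau_h,h,w)$$ with $\varepsilon(\tau_h,h,w):=\sqrt d\,\operatorname{TV}(w)\,\frac{2d\,\tau_h}{h}$.
   Context: Setting. $\Omega\subset\mathbb{R}^d$, $d\in\{1,2,3\}$, is a bounded Lipschitz domain that is a finite union of bounded intervals ($d=1$), axis-aligned squares ($d=2$) or axis-aligned cubes ($d=3$). $W\subset\mathbb{Z}$ is a finite nonempty set. $\|\cdot\|$ is the Euclidean norm and $\|\phi\|_{L^\infty(\Omega;\mathbb{R}^d)}=\operatorname{ess\,sup}_{x\in\Omega}\|\phi(x)\|$. For $w\in L^1(\Omega)$, $\operatorname{TV}(w)=\sup\{\int_\Omega w\,\operatorname{div}\phi\,dx : \phi\in C^1_c(\Omega;\mathbb{R}^d),\ \sup_{x}\|\phi(x)\|\le 1\}\in[0,\infty]$; $\mathrm{BV}_W(\Omega)=\{w\in L^1(\Omega): w(x)\in W \text{ for a.a. } x\in\Omega,\ \operatorname{TV}(w)<\infty\}$. Meshes. A mesh of $\Omega$ of size $\tau>0$ is a conforming finite element mesh $\mathcal{Q}_\tau$: a finite collection of intervals / axis-aligned squares / axis-aligned cubes of side length $\tau$ with pairwise disjoint interiors, whose union is $\Omega$ up to a Lebesgue null set, and such that two distinct closed cells intersect in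 the empty set or a common face. A pair $(h,\tau_h)$ with $h>0$ and $\tau_h\in(0,h]$ is an admissible mesh pair if there are given a mesh $\mathcal{Q}_h$ of size $h$ (the TV mesh) and a mesh $\mathcal{Q}_{\tau_h}$ of size $\tau_h$ (the input mesh) such that every cell of $\mathcal{Q}_h$ is a union of cells of $\mathcal{Q}_{\tau_h}$. Discretized total variation. For a cell $Q$, $RT0^h(Q)$ is the space of maps $Q\to\mathbb{R}^d$, $x\mapsto (a_i+c_ix_i)_{i=1}^d$ with $a,c\in\mathbb{R}^d$. $RT0^h=\{\phi\in H(\operatorname{div};\Omega):\phi|_Q\in RT0^h(Q)\ \forall Q\in\mathcal{Q}_h\}$, and $RT0^h_0=\{\phi\in RT0^h:(\phi\cdot n)|_{\partial\Omega}\equiv0\}$ with $n$ the outer unit normal of $\Omega$. For $w\in L^1(\Omega)$, $\operatorname{TV}^h(w)=\sup\{\int_\Omega w\operatorname{div}\phi\,dx:\phi\in RT0^h_0,\ \|\phi\|_{L^\infty(\Omega;\mathbb{R}^d)}\le1\}$. Rounding operator. For $w\in \mathrm{BV}_W(\Omega)$ and a mesh $\mathcal{Q}_\tau$, $R^W_{P0^\tau}(w)$ is the function that is constant on each cell $Q\in\mathcal{Q}_\tau$ with value the minimizer of $\big|\frac1{|Q|}\int_Q w\,dx-\omega\big|$ over all $\omega\in W$ with $|\{x\in Q:w(x)=\omega\}|>0$ (the smallest minimizer if it is not unique). *)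

theory Defs
  imports "HOL-Analysis.Analysis" "HOL-Probability.Essential_Supremum"
begin

section \<open>Domains and meshes\<close>

text \<open>Locally, \<open>\<Omega>\<close> is the strict epigraph of a Lipschitz function over the hyperplane orthogonal
  to a unit vector \<open>e\<close>. Connectedness is not required.\<close>

definition lipschitz_domain :: "(real^'d) set \<Rightarrow> bool" where
  "lipschitz_domain \<Omega> \<longleftrightarrow> open \<Omega> \<and> \<Omega> \<noteq> {} \<and>
     (\<forall>x\<in>frontier \<Omega>. \<exists>e r L \<gamma>. norm e = 1 \<and> 0 < r \<and> L-lipschitz_on {v. v \<bullet> e = 0} \<gamma> \<and>
        (\<forall>y\<in>ball x r. y \<in> \<Omega> \<longleftrightarrow> \<gamma> (y - (y \<bullet> e) *\<^sub>R e) < y \<bullet> e))"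

definition axis_cube :: "real \<Rightarrow> (real^'d) set \<Rightarrow> bool" where
  "axis_cube l Q \<longleftrightarrow> 0 < l \<and> (\<exists>a. Q = cbox a (\<chi> i. a $ i + l))"

text \<open>As \<open>\<Omega>\<close> is open and the cubes are closed, the union is compared with the closure of \<open>\<Omega>\<close>.
  The cubes may overlap and have different side lengths.\<close>

definition finite_cube_union :: "(real^'d) set \<Rightarrow> bool" where
  "finite_cube_union \<Omega> \<longleftrightarrow>
     (\<exists>C. finite C \<and> (\<forall>Q\<in>C. \<exists>l. axis_cube l Q) \<and> closure \<Omega> = \<Union>C)"

definition is_mesh :: "(real^'d) set \<Rightarrow> real \<Rightarrow> (real^'d) set set \<Rightarrow> bool" where
  "is_mesh \<Omega> l M \<longleftrightarrow> 0 < l \<and> finite M \<and> (\<forall>Q\<in>M. axis_cube l Q) \<and>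
     pairwise (\<lambda>Q Q'. interior Q \<inter> interior Q' = {}) M \<and>
     negligible ((\<Union>M - \<Omega>) \<union> (\<Omega> - \<Union>M)) \<and>
     pairwise (\<lambda>Q Q'. Q \<inter> Q' = {} \<or> (Q \<inter> Q' face_of Q \<and> Q \<inter> Q' face_of Q')) M"

definition admissible_mesh_pair ::
    "(real^'d) set \<Rightarrow> real \<Rightarrow> real \<Rightarrow> (real^'d) set set \<Rightarrow> (real^'d) set set \<Rightarrow> bool" where
  "admissible_mesh_pair \<Omega> h \<tau> Mh M\<tau> \<longleftrightarrow> 0 < h \<and> 0 < \<tau> \<and> \<tau> \<le> h \<and>
     is_mesh \<Omega> h Mh \<and> is_mesh \<Omega> \<tau> M\<tau> \<and> (\<forall>Q\<in>Mh. \<exists>N\<subseteq>M\<tau>. Q = \<Union>N)"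

section \<open>Total variation\<close>

text \<open>Elements of \<open>C\<^sup>1\<^sub>c(\<Omega>)\<close> are represented by their extension by zero to the whole space.\<close>

definition C1c :: "(real^'d) set \<Rightarrow> (real^'d \<Rightarrow> 'b::real_normed_vector) set" where
  "C1c \<Omega> = {f. (\<exists>D. (\<forall>x. (f has_derivative blinfun_apply (D x)) (at x)) \<and> continuous_on UNIV D) \<and>
     compact (closure {x. f x \<noteq> 0}) \<and> closure {x. f x \<noteq> 0} \<subseteq> \<Omega>}"

definition divergence :: "(real^'d \<Rightarrow> real^'d) \<Rightarrow> real^'d \<Rightarrow> real" where
  "divergence \<phi> x = trace (jacobian \<phi> (at x))"

definition TV :: "(real^'d) set \<Rightarrow> (real^'d \<Rightarrow> real) \<Rightarrow> ereal" where
  "TV \<Omega> w = (SUP \<phi>\<in>{\<phi>\<in>C1c \<Omega>. \<forall>x. norm (\<phi> x) \<le> 1}.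
      ereal (LINT x|lebesgue_on \<Omega>. w x * divergence \<phi> x))"

definition BV_W :: "int set \<Rightarrow> (real^'d) set \<Rightarrow> (real^'d \<Rightarrow> real) set" where
  "BV_W W \<Omega> = {w. integrable (lebesgue_on \<Omega>) w \<and>
     (AE x in lebesgue_on \<Omega>. w x \<in> real_of_int ` W) \<and> TV \<Omega> w < \<infinity>}"

section \<open>Discretized total variation\<close>

definition L2 :: "(real^'d) set \<Rightarrow> (real^'d \<Rightarrow> 'b::euclidean_space) set" where
  "L2 \<Omega> = {f \<in> borel_measurable (lebesgue_on \<Omega>). integrable (lebesgue_on \<Omega>) (\<lambda>x. (norm (f x))\<^sup>2)}"

text \<open>\<open>g\<close> is the distributional divergence of \<open>\<phi>\<close> on \<open>\<Omega>\<close>. The term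
  \<open>frechet_derivative \<psi> (at x) (\<phi> x)\<close> is the inner product of the gradient of \<open>\<psi>\<close> with \<open>\<phi>\<close> at \<open>x\<close>.\<close>

definition weak_divergence ::
    "(real^'d) set \<Rightarrow> (real^'d \<Rightarrow> real^'d) \<Rightarrow> (real^'d \<Rightarrow> real) \<Rightarrow> bool" where
  "weak_divergence \<Omega> \<phi> g \<longleftrightarrow> g \<in> L2 \<Omega> \<and>
     (\<forall>\<psi>\<in>C1c \<Omega>. (LINT x|lebesgue_on \<Omega>. frechet_derivative \<psi> (at x) (\<phi> x)) =
                 - (LINT x|lebesgue_on \<Omega>. g x * \<psi> x))"

definition Hdiv :: "(real^'d) set \<Rightarrow> (real^'d \<Rightarrow> real^'d) set" where
  "Hdiv \<Omega> = {\<phi> \<in> L2 \<Omega>. \<exists>g. weak_divergence \<Omega> \<phi> g}"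

definition rt0 :: "real^'d \<Rightarrow> real^'d \<Rightarrow> real^'d \<Rightarrow> real^'d" where
  "rt0 a c x = (\<chi> i. a $ i + c $ i * x $ i)"

text \<open>Fields are understood up to null sets, so the restriction to a closed cell is prescribed
  almost everywhere.\<close>

definition RT0 :: "(real^'d) set \<Rightarrow> (real^'d) set set \<Rightarrow> (real^'d \<Rightarrow> real^'d) set" where
  "RT0 \<Omega> M = {\<phi> \<in> Hdiv \<Omega>. \<forall>Q\<in>M. \<exists>a c. AE x in lebesgue_on Q. \<phi> x = rt0 a c x}"

text \<open>\<open>n\<close> is the outer unit normal at the boundary point \<open>x\<close>: the complement of any cone around the
  hyperplane orthogonal to \<open>n\<close> is, near \<open>x\<close>, inside \<open>\<Omega>\<close> on the side of \<open>-n\<close> and outside \<open>\<Omega>\<close> on the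
  side of \<open>n\<close>. At corners and edges no such \<open>n\<close> exists.\<close>

definition outer_unit_normal :: "(real^'d) set \<Rightarrow> real^'d \<Rightarrow> real^'d \<Rightarrow> bool" where
  "outer_unit_normal \<Omega> x n \<longleftrightarrow> x \<in> frontier \<Omega> \<and> norm n = 1 \<and>
     (\<forall>\<epsilon>>0. \<exists>r>0. \<forall>y\<in>ball x r.
        ((y - x) \<bullet> n < - \<epsilon> * norm (y - x) \<longrightarrow> y \<in> \<Omega>) \<and>
        ((y - x) \<bullet> n > \<epsilon> * norm (y - x) \<longrightarrow> y \<notin> \<Omega>))"

text \<open>The trace of \<open>\<phi>\<close> on the boundary is that of the affine map \<open>rt0 a c\<close> representing \<open>\<phi>\<close> on the
  adjacent cell; the coefficients \<open>a\<close>, \<open>c\<close> are determined uniquely by \<open>\<phi>\<close> and \<open>Q\<close>.\<close>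

definition RT0_0 :: "(real^'d) set \<Rightarrow> (real^'d) set set \<Rightarrow> (real^'d \<Rightarrow> real^'d) set" where
  "RT0_0 \<Omega> M = {\<phi> \<in> RT0 \<Omega> M. \<forall>Q\<in>M. \<forall>a c. (AE x in lebesgue_on Q. \<phi> x = rt0 a c x) \<longrightarrow>
     (\<forall>x \<in> Q \<inter> frontier \<Omega>. \<forall>n. outer_unit_normal \<Omega> x n \<longrightarrow> rt0 a c x \<bullet> n = 0)}"

definition Linf_norm :: "(real^'d) set \<Rightarrow> (real^'d \<Rightarrow> real^'d) \<Rightarrow> ereal" where
  "Linf_norm \<Omega> \<phi> = esssup (lebesgue_on \<Omega>) (\<lambda>x. ereal (norm (\<phi> x)))"

text \<open>The weak divergence \<open>g\<close> is unique up to null sets.\<close>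

definition TVh :: "(real^'d) set \<Rightarrow> (real^'d) set set \<Rightarrow> (real^'d \<Rightarrow> real) \<Rightarrow> ereal" where
  "TVh \<Omega> M w = (SUP (\<phi>, g)\<in>{(\<phi>, g). \<phi> \<in> RT0_0 \<Omega> M \<and> Linf_norm \<Omega> \<phi> \<le> 1 \<and> weak_divergence \<Omega> \<phi> g}.
      ereal (LINT x|lebesgue_on \<Omega>. w x * g x))"

section \<open>Rounding\<close>

definition cell_mean :: "(real^'d \<Rightarrow> real) \<Rightarrow> (real^'d) set \<Rightarrow> real" where
  "cell_mean w Q = 1 / measure lebesgue Q * (LINT x|lebesgue_on Q. w x)"

definition rounded_value :: "int set \<Rightarrow> (real^'d \<Rightarrow> real) \<Rightarrow> (real^'d) set \<Rightarrow> int" where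
  "rounded_value W w Q = Min {\<omega>. is_arg_min (\<lambda>\<omega>. \<bar>cell_mean w Q - real_of_int \<omega>\<bar>)
      (\<lambda>\<omega>. \<omega> \<in> W \<and> 0 < emeasure lebesgue {x\<in>Q. w x = real_of_int \<omega>}) \<omega>}"

text \<open>Closed cells share faces; the representative chosen here is zero off the cell interiors, which
  is a null subset of \<open>\<Omega>\<close>.\<close>

definition rounding :: "int set \<Rightarrow> (real^'d) set set \<Rightarrow> (real^'d \<Rightarrow> real) \<Rightarrow> real^'d \<Rightarrow> real" where
  "rounding W M w x = (\<Sum>Q\<in>M. indicator (interior Q) x * real_of_int (rounded_value W w Q))"

definition rounding_error :: "(real^'d) set \<Rightarrow> real \<Rightarrow> real \<Rightarrow> (real^'d \<Rightarrow> real) \<Rightarrow> ereal" where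
  "rounding_error \<Omega> \<tau> h w =
     ereal (sqrt (real CARD('d))) * TV \<Omega> w * ereal (2 * real CARD('d) * \<tau> / h)"

end

theory Submission
  imports Defs
begin

text \<open>A Lipschitz domain absorbs every open set that it covers up to a null set, so \<open>\<Omega>\<close> is the interior of
  the union of the cells of each mesh. Both inequalities rest on one way to approximate a field whose
  \<open>i\<close>-th component is regular in direction \<open>i\<close> inside each cell and has matching traces on the shared
  \<open>i\<close>-facets and zero traces on the others: flatten it near the facets by a reparametrization of each
  coordinate that fixes the facets, and cut the \<open>i\<close>-th component off near the \<open>j\<close>-facets for \<open>j \<noteq> i\<close>
  only. The result is admissible for \<open>TV\<close>, has no larger norm, and its divergence converges boundedly
  almost everywhere. For \<open>RT0\<close> fields this gives \<open>TVh w \<le> TV w\<close>.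

  For the rounding, \<open>\<bar>R w - w\<bar> \<le> 2 \<bar>w - mean\<bar>\<close> almost everywhere in each cell, because \<open>R w\<close> is closest to the
  mean among the attained values. The integral of \<open>\<bar>w - mean\<bar>\<close> is at most \<open>sqrt d * \<tau> / 2 * TV w\<close>: test
  with polynomials \<open>s\<close> approximating the sign of \<open>w - mean\<close>, and write \<open>s\<close> minus a constant as the
  divergence of the field whose components are the antiderivatives of \<open>s_(i-1) - s_i\<close>, where \<open>s_i\<close>
  averages \<open>s\<close> over the first \<open>i\<close> coordinates; each component is bounded by \<open>\<tau> / 2\<close>. An \<open>RT0\<close> field of
  norm at most 1 has divergence at most \<open>2 * d / h\<close>, which gives the factor in the error.\<close>

section \<open>Continuously differentiable maps\<close>

text \<open>The obstacle: \<open>TV\<close> tests with continuously differentiable, compactly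
  supported fields, while an \<open>RT0\<close> field may jump in its tangential components, and the
  norm bound 1 must survive the approximation exactly. A cut-off of component i in the variable x_i
  would add derivatives of order 1/eps to the divergence, which do not fade out where the trace is
  nonzero. A cut-off in x_j with j \<noteq> i is harmless, since the divergence differentiates
  component i along axis i only. Normal traces are instead carried across shared facets by a field
  that is constant in x_i near them. All components are read off at one and the same point of the
  cell, so the norm cannot grow.

  For the mean deviation, w - mean integrates to zero over each cell, so a constant may be
  subtracted from the test function at no cost. The factor sqrt d is the price of bounding the d
  components separately. The error constant is the product of 2 (rounding), sqrt d * \<tau> / 2
  (mean deviation) and 2 * d / h, where 2 / h bounds the slope of a component with values in [-1, 1]
  along an edge of length h.\<close>

definition C1 :: "('a::real_normed_vector \<Rightarrow> 'b::real_normed_vector) \<Rightarrow> bool" where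
  "C1 f \<longleftrightarrow> (\<exists>D. (\<forall>x. (f has_derivative blinfun_apply (D x)) (at x)) \<and> continuous_on UNIV D)"

lemma C1I:
  assumes "\<And>x. (f has_derivative blinfun_apply (D x)) (at x)" "continuous_on UNIV D"
  shows "C1 f"
  using assms unfolding C1_def by blast

lemma C1E:
  assumes "C1 f"
  obtains D where "\<And>x. (f has_derivative blinfun_apply (D x)) (at x)" "continuous_on UNIV D"
  using assms unfolding C1_def by blast

lemma C1_imp_continuous: "C1 f \<Longrightarrow> continuous_on S f"
  by (meson C1E continuous_at_imp_continuous_on has_derivative_continuous)

lemma C1_const [simp]: "C1 (\<lambda>x. c)"
  by (rule C1I[where D = "\<lambda>x. 0"]) (auto simp: zero_blinfun.rep_eq)

lemma C1_bounded_linear: "bounded_linear f \<Longrightarrow> C1 f"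
  by (rule C1I[where D = "\<lambda>x. Blinfun f"])
    (auto simp: bounded_linear_Blinfun_apply bounded_linear_imp_has_derivative)

lemma C1_add:
  assumes "C1 f" "C1 g" shows "C1 (\<lambda>x. f x + g x)"
proof -
  obtain Df where f: "\<And>x. (f has_derivative blinfun_apply (Df x)) (at x)" "continuous_on UNIV Df"
    using assms(1) unfolding C1_def by blast
  obtain Dg where g: "\<And>x. (g has_derivative blinfun_apply (Dg x)) (at x)" "continuous_on UNIV Dg"
    using assms(2) unfolding C1_def by blast
  show ?thesis
    by (rule C1I[where D = "\<lambda>x. Df x + Dg x"])
      (auto intro!: derivative_eq_intros f g continuous_intros simp: blinfun.add_left)
qed

lemma C1_scaleR:
  fixes f :: "'a::real_normed_vector \<Rightarrow> real"
  assumes "C1 f" "C1 g" shows "C1 (\<lambda>x. f x *\<^sub>R g x)"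
proof -
  obtain Df where f: "\<And>x. (f has_derivative blinfun_apply (Df x)) (at x)" "continuous_on UNIV Df"
    using assms(1) unfolding C1_def by blast
  obtain Dg where g: "\<And>x. (g has_derivative blinfun_apply (Dg x)) (at x)" "continuous_on UNIV Dg"
    using assms(2) unfolding C1_def by blast
  have c: "continuous_on UNIV f" "continuous_on UNIV g"
    using assms by (auto intro: C1_imp_continuous)
  define E where "E x = f x *\<^sub>R Dg x + (blinfun_scaleR_left (g x) o\<^sub>L Df x)" for x
  have "continuous_on UNIV E"
    unfolding E_def
    by (intro continuous_intros f g c
        bounded_linear.continuous_on[OF bounded_linear_blinfun_scaleR_left])
  moreover have "((\<lambda>x. f x *\<^sub>R g x) has_derivative blinfun_apply (E x)) (at x)" for x
    by (auto intro!: derivative_eq_intros f g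
        simp: E_def blinfun.add_left blinfun.scaleR_left fun_eq_iff)
  ultimately show ?thesis by (rule C1I[rotated])
qed

lemma C1_mult:
  fixes f g :: "'a::real_normed_vector \<Rightarrow> real"
  assumes "C1 f" "C1 g" shows "C1 (\<lambda>x. f x * g x)"
  using C1_scaleR[OF assms] by simp

lemma C1_diff:
  assumes "C1 f" "C1 g" shows "C1 (\<lambda>x. f x - g x)"
  using C1_add[OF assms(1) C1_scaleR[OF C1_const[of "-1"] assms(2)]] by simp

lemma C1_sum:
  assumes "\<And>i. i \<in> I \<Longrightarrow> C1 (f i)" shows "C1 (\<lambda>x. \<Sum>i\<in>I. f i x)"
  using assms by (induction I rule: infinite_finite_induct) (auto intro: C1_add)

lemma C1_prod:
  fixes f :: "'i \<Rightarrow> 'a::real_normed_vector \<Rightarrow> real"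
  assumes "\<And>i. i \<in> I \<Longrightarrow> C1 (f i)" shows "C1 (\<lambda>x. \<Prod>i\<in>I. f i x)"
  using assms by (induction I rule: infinite_finite_induct) (auto intro: C1_mult)

lemma C1_compose:
  assumes "C1 f" "C1 g" shows "C1 (\<lambda>x. f (g x))"
proof -
  obtain Df where f: "\<And>x. (f has_derivative blinfun_apply (Df x)) (at x)" "continuous_on UNIV Df"
    using assms(1) unfolding C1_def by blast
  obtain Dg where g: "\<And>x. (g has_derivative blinfun_apply (Dg x)) (at x)" "continuous_on UNIV Dg"
    using assms(2) unfolding C1_def by blast
  have "continuous_on UNIV (\<lambda>x. Df (g x))"
    by (rule continuous_on_compose2[OF f(2) C1_imp_continuous[OF assms(2)]]) auto
  then have "continuous_on UNIV (\<lambda>x. Df (g x) o\<^sub>L Dg x)"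
    by (intro continuous_intros g)
  moreover have "((\<lambda>x. f (g x)) has_derivative blinfun_apply (Df (g x) o\<^sub>L Dg x)) (at x)" for x
    by (rule has_derivative_eq_rhs[OF has_derivative_compose[OF g(1) f(1)]]) (simp add: fun_eq_iff)
  ultimately show ?thesis by (rule C1I[rotated])
qed

lemma C1_nth: "C1 (\<lambda>x::real^'n. x $ i)"
  by (intro C1_bounded_linear bounded_linear_vec_nth)

lemma C1_vec:
  fixes f :: "'n::finite \<Rightarrow> 'a::real_normed_vector \<Rightarrow> real"
  assumes "\<And>i. C1 (f i)" shows "C1 (\<lambda>x. \<chi> i. f i x)"
proof -
  have "(\<lambda>x. \<chi> i. f i x) = (\<lambda>x. \<Sum>i\<in>UNIV. f i x *\<^sub>R axis i 1)"
    by (auto simp: vec_eq_iff axis_def if_distrib cong: if_cong)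
  then show ?thesis
    using assms by (auto intro!: C1_sum C1_scaleR)
qed

lemma C1_real:
  fixes f :: "real \<Rightarrow> real"
  assumes "\<And>t. (f has_real_derivative f' t) (at t)" "continuous_on UNIV f'"
  shows "C1 f"
  by (rule C1I[where D = "\<lambda>t. blinfun_scaleR_left (f' t)"])
    (use assms in \<open>auto simp: has_field_derivative_def mult_commute_abs
      intro!: bounded_linear.continuous_on[OF bounded_linear_blinfun_scaleR_left]\<close>)

lemma C1_real_polynomial_function:
  assumes "real_polynomial_function f" shows "C1 f"
  using assms by induction (auto intro: C1_bounded_linear C1_add C1_mult)

lemma C1c_eq_C1:
  "C1c \<Omega> = {f. C1 f \<and> compact (closure {x. f x \<noteq> 0}) \<and> closure {x. f x \<noteq> 0} \<subseteq> \<Omega>}"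
  unfolding C1c_def C1_def by simp

lemma C1cI:
  assumes "C1 f" "compact K" "K \<subseteq> \<Omega>" "\<And>x. x \<notin> K \<Longrightarrow> f x = 0"
  shows "f \<in> C1c \<Omega>"
proof -
  have "closure {x. f x \<noteq> 0} \<subseteq> K"
    using assms by (intro closure_minimal compact_imp_closed) auto
  then show ?thesis
    using assms unfolding C1c_eq_C1
    by (auto intro: compact_closure[THEN iffD2] bounded_subset[OF compact_imp_bounded])
qed

lemma C1c_mono: "\<Omega> \<subseteq> \<Omega>' \<Longrightarrow> C1c \<Omega> \<subseteq> C1c \<Omega>'"
  unfolding C1c_def by auto

text \<open>Only the diagonal of the Jacobian enters the trace, so it suffices to differentiate
  component i along axis i. The fields built later are differentiated this way, without computing
  their full differentials.\<close>

lemma divergence_eq: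
  fixes \<phi> :: "real^'d \<Rightarrow> real^'d"
  assumes "C1 \<phi>" "\<And>i. ((\<lambda>t. \<phi> (x + t *\<^sub>R axis i 1) $ i) has_real_derivative d i) (at 0)"
  shows "divergence \<phi> x = (\<Sum>i\<in>UNIV. d i)"
proof -
  obtain D where D: "\<And>x. (\<phi> has_derivative blinfun_apply (D x)) (at x)" "continuous_on UNIV D"
    using assms(1) unfolding C1_def by blast
  have "((\<lambda>t. \<phi> (x + t *\<^sub>R axis i 1) $ i) has_real_derivative (D x (axis i 1) $ i)) (at 0)" for i
  proof -
    have "((\<lambda>t::real. x + t *\<^sub>R axis i 1) has_derivative (\<lambda>t. t *\<^sub>R axis i 1)) (at 0)"
      by (auto intro!: derivative_eq_intros)
    moreover have "(\<phi> has_derivative D x) (at (x + (0::real) *\<^sub>R axis i 1))"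
      using D by simp
    ultimately have "((\<lambda>t::real. \<phi> (x + t *\<^sub>R axis i 1)) has_derivative (\<lambda>t. D x (t *\<^sub>R axis i 1))) (at 0)"
      by (rule has_derivative_compose)
    from bounded_linear.has_derivative[OF bounded_linear_vec_nth[of i] this]
    show ?thesis
      by (simp add: has_field_derivative_def blinfun.scaleR_right mult_commute_abs)
  qed
  then have "D x (axis i 1) $ i = d i" for i
    using assms(2) DERIV_unique by blast
  moreover have "frechet_derivative \<phi> (at x) = D x"
    using D(1) by (metis frechet_derivative_at)
  ultimately show ?thesis
    by (simp add: divergence_def jacobian_def trace_def matrix_def)
qed

lemma continuous_divergence:
  fixes \<phi> :: "real^'d \<Rightarrow> real^'d"
  assumes "C1 \<phi>" shows "continuous_on UNIV (divergence \<phi>)"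
proof -
  obtain D where D: "\<And>x. (\<phi> has_derivative blinfun_apply (D x)) (at x)" "continuous_on UNIV D"
    using assms(1) unfolding C1_def by blast
  have "frechet_derivative \<phi> (at x) = D x" for x
    using D(1) by (metis frechet_derivative_at)
  then have "divergence \<phi> = (\<lambda>x. \<Sum>i\<in>UNIV. D x (axis i 1) $ i)"
    by (simp add: divergence_def jacobian_def trace_def matrix_def fun_eq_iff)
  then show ?thesis
    by (auto intro!: continuous_intros D)
qed

lemma divergence_scaleR:
  fixes \<phi> :: "real^'d \<Rightarrow> real^'d"
  assumes "C1 \<phi>" shows "divergence (\<lambda>x. c *\<^sub>R \<phi> x) x = c * divergence \<phi> x"
proof -
  obtain D where D: "\<And>x. (\<phi> has_derivative blinfun_apply (D x)) (at x)" "continuous_on UNIV D"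
    using assms(1) unfolding C1_def by blast
  have "((\<lambda>x. c *\<^sub>R \<phi> x) has_derivative (\<lambda>h. c *\<^sub>R D x h)) (at x)"
    by (auto intro!: derivative_eq_intros D)
  then have "frechet_derivative (\<lambda>x. c *\<^sub>R \<phi> x) (at x) = (\<lambda>h. c *\<^sub>R D x h)" 
      "frechet_derivative \<phi> (at x) = D x"
    using D(1) by (metis frechet_derivative_at)+
  then show ?thesis
    by (simp add: divergence_def jacobian_def trace_def matrix_def sum_distrib_left)
qed

section \<open>Cut-off functions and approximation\<close>

lemma lborel_integral_translation:
  fixes f :: "'a::euclidean_space \<Rightarrow> real"
  assumes "f \<in> borel_measurable borel"
  shows "(LINT x|lborel. f (x + c)) = (LINT x|lborel. f x)"
proof -
  have "(LINT x|lborel. f x) = (LINT x|distr lborel borel ((+) c). f x)"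
    by (simp add: lborel_distr_plus)
  also have "\<dots> = (LINT x|lborel. f (c + x))"
    using assms by (intro integral_distr) auto
  finally show ?thesis by (simp add: add.commute)
qed

lemma lborel_integrable_translation:
  fixes f :: "'a::euclidean_space \<Rightarrow> real"
  assumes "integrable lborel f"
  shows "integrable lborel (\<lambda>x. f (x + c))"
proof -
  have "integrable (distr lborel borel ((+) c)) f"
    using assms by (simp add: lborel_distr_plus)
  then have "integrable lborel (\<lambda>x. f (c + x))"
    using assms by (subst (asm) integrable_distr_eq) auto
  then show ?thesis by (simp add: add.commute)
qed

text \<open>The difference quotients in direction \<open>e\<close> have integral zero by translation invariance.\<close>

lemma integral_directional_derivative_eq_0:
  fixes f f' :: "'a::euclidean_space \<Rightarrow> real"
  assumes f: "integrable lborel f" and supp: "bounded {x. f x \<noteq> 0}"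
    and lip: "\<And>x t. \<bar>f (x + t *\<^sub>R e) - f x\<bar> \<le> C * \<bar>t\<bar>"
    and f': "f' \<in> borel_measurable borel"
    and deriv: "AE x in lborel. ((\<lambda>t. f (x + t *\<^sub>R e)) has_real_derivative f' x) (at 0)"
  shows "(LINT x|lborel. f' x) = 0"
proof -
  define t where "t n = inverse (real (Suc n))" for n
  have t: "0 < t n" "t n \<le> 1" "t \<longlonglongrightarrow> 0" for n
    unfolding t_def using LIMSEQ_inverse_real_of_nat by (auto simp: field_simps)
  define q where "q n x = (f (x + t n *\<^sub>R e) - f x) / t n" for n x
  have mf: "f \<in> borel_measurable borel" using f by auto
  have mq: "q n \<in> borel_measurable borel" for n
    unfolding q_def
    by (intro borel_measurable_divide borel_measurable_diff measurable_compose[OF _ mf] mf) auto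
  have int0: "(LINT x|lborel. q n x) = 0" for n
    unfolding q_def
    using Bochner_Integration.integral_diff[OF lborel_integrable_translation[OF f, of "t n *\<^sub>R e"] f]
      lborel_integral_translation[OF mf, of "t n *\<^sub>R e"] by simp
  obtain R where R: "\<And>x. f x \<noteq> 0 \<Longrightarrow> norm x \<le> R"
    using supp by (auto simp: bounded_iff)
  \<comment> \<open>The steps \<open>t n\<close> are at most 1, so a difference quotient can be
    nonzero only within distance \<open>norm e\<close> of the support of \<open>f\<close>; this
    gives an integrable bound independent of n.\<close>
  have bnd: "norm (q n x) \<le> C * indicator (cball 0 (R + norm e)) x" for n x
  proof (cases "x \<in> cball 0 (R + norm e)")
    case True
    then show ?thesis
      using lip[of x "t n"] t(1)[of n] by (auto simp: q_def divide_simps)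
  next
    case False
    then have "norm x > R + norm e" by simp
    moreover have "norm (t n *\<^sub>R e) \<le> norm e"
      using t(1,2)[of n] by (simp add: mult_left_le_one_le)
    moreover have "norm x \<le> norm (x + t n *\<^sub>R e) + norm (t n *\<^sub>R e)"
      by (metis add_diff_cancel_right' norm_triangle_ineq4)
    ultimately have "norm x > R" "norm (x + t n *\<^sub>R e) > R"
      using norm_ge_zero[of e] by linarith+
    then have "f x = 0" "f (x + t n *\<^sub>R e) = 0"
      using R by fastforce+
    with False show ?thesis by (simp add: q_def)
  qed
  have "(\<lambda>n. LINT x|lborel. q n x) \<longlonglongrightarrow> (LINT x|lborel. f' x)"
  proof (rule integral_dominated_convergence[where w = "\<lambda>x. C * indicator (cball 0 (R + norm e)) x"])
    show "AE x in lborel. (\<lambda>n. q n x) \<longlonglongrightarrow> f' x"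
      using deriv
    proof eventually_elim
      case (elim x)
      then have "((\<lambda>h. (f (x + h *\<^sub>R e) - f x) / h) \<longlongrightarrow> f' x) (at 0)"
        by (simp add: DERIV_def)
      moreover have "filterlim t (at 0) sequentially"
        using t by (auto simp: filterlim_at intro!: always_eventually less_imp_neq[symmetric])
      ultimately show ?case
        unfolding q_def by (rule filterlim_compose)
    qed
    have "emeasure lborel (cball (0::'a) (R + norm e)) < \<infinity>"
      using emeasure_bounded_finite[OF bounded_cball] by auto
    then show "integrable lborel (\<lambda>x. C * indicator (cball (0::'a) (R + norm e)) x)"
      by auto
  qed (use f' mq bnd in auto)
  then show ?thesis
    by (simp add: int0 LIMSEQ_const_iff)
qed

section \<open>One-dimensional profiles\<close>

definition ramp :: "real \<Rightarrow> real \<Rightarrow> real \<Rightarrow> real" where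
  "ramp l e t = (max 0 (t - e) - max 0 (t - 2 * e) - max 0 (t - (l - 2 * e)) + max 0 (t - (l - e)))
     * (l / (e * (l - 3 * e)))"

text \<open>The antiderivative of \<open>ramp\<close>, which is a trapezoid supported in [e, l - e]
  whose height l / (l - 3 * e) makes its area equal to l. So \<open>stretch\<close> maps [0, l] onto
  itself, fixes both ends, is constant near them, and tends to the identity as e tends to 0. Squares
  of positive parts keep it continuously differentiable.\<close>

definition stretch :: "real \<Rightarrow> real \<Rightarrow> real \<Rightarrow> real" where
  "stretch l e t = ((max 0 (t - e))\<^sup>2 - (max 0 (t - 2 * e))\<^sup>2 - (max 0 (t - (l - 2 * e)))\<^sup>2
     + (max 0 (t - (l - e)))\<^sup>2) * (l / (2 * e * (l - 3 * e)))"

lemma has_real_derivative_max_square: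
  "((\<lambda>t. (max 0 (t - c))\<^sup>2) has_real_derivative 2 * max 0 (t - c)) (at (t::real))"
proof -
  consider "t < c" | "t > c" | "t = c" by linarith
  then show ?thesis
  proof cases
    case 1
    have "((\<lambda>t. 0) has_real_derivative 2 * max 0 (t - c)) (at t)"
      using 1 by (auto intro!: derivative_eq_intros)
    then show ?thesis
      by (rule has_field_derivative_transform_within_open[where S = "{..<c}"]) (use 1 in auto)
  next
    case 2
    have "((\<lambda>t. (t - c)\<^sup>2) has_real_derivative 2 * max 0 (t - c)) (at t)"
      using 2 by (auto intro!: derivative_eq_intros)
    then show ?thesis
      by (rule has_field_derivative_transform_within_open[where S = "{c<..}"]) (use 2 in auto)
  next
    case 3
    have "((\<lambda>h::real. (max 0 h)\<^sup>2 / h) \<longlongrightarrow> 0) (at 0)"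
    proof (rule Lim_null_comparison[OF always_eventually])
      show "\<forall>h::real. norm ((max 0 h)\<^sup>2 / h) \<le> \<bar>h\<bar>"
        by (auto simp: max_def power2_eq_square)
      show "((\<lambda>h::real. \<bar>h\<bar>) \<longlongrightarrow> 0) (at 0)"
        by (auto intro!: tendsto_eq_intros)
    qed
    then show ?thesis
      using 3 by (simp add: DERIV_def)
  qed
qed

lemma
  assumes "0 < e" "4 * e \<le> l"
  shows has_real_derivative_stretch: "(stretch l e has_real_derivative ramp l e t) (at t)"
    and continuous_on_ramp: "continuous_on S (ramp l e)"
    and ramp_nonneg: "0 \<le> ramp l e t"
    and ramp_le: "ramp l e t \<le> 4"
    and ramp_middle: "2 * e \<le> t \<Longrightarrow> t \<le> l - 2 * e \<Longrightarrow> ramp l e t = l / (l - 3 * e)"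
    and stretch_left: "t \<le> e \<Longrightarrow> stretch l e t = 0"
    and stretch_right: "l - e \<le> t \<Longrightarrow> stretch l e t = l"
    and stretch_middle: "2 * e \<le> t \<Longrightarrow> t \<le> l - 2 * e \<Longrightarrow>
      stretch l e t = (t - 3 * e / 2) * (l / (l - 3 * e))"
proof -
  have p: "0 < l - 3 * e" "0 < l" using assms by linarith+
  have eq: "(2 * a - 2 * b - 2 * c + 2 * d) * (l / (2 * e * k)) = (a - b - c + d) * (l / (e * k))"
    for a b c d k :: real
    by (simp add: ring_distribs diff_divide_distrib add_divide_distrib)
  show "(stretch l e has_real_derivative ramp l e t) (at t)"
    unfolding stretch_def ramp_def eq[symmetric]
    by (intro DERIV_cmult_right DERIV_add DERIV_diff has_real_derivative_max_square)
  show "continuous_on S (ramp l e)"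
    unfolding ramp_def by (intro continuous_intros)
  have A: "0 \<le> l / (e * (l - 3 * e))" using assms p by auto
  have "0 \<le> max 0 (t - e) - max 0 (t - 2 * e) - max 0 (t - (l - 2 * e)) + max 0 (t - (l - e))"
    using assms by (auto simp: max_def)
  then show "0 \<le> ramp l e t"
    unfolding ramp_def using A by (intro mult_nonneg_nonneg)
  have "max 0 (t - e) - max 0 (t - 2 * e) - max 0 (t - (l - 2 * e)) + max 0 (t - (l - e)) \<le> e"
    using assms by (auto simp: max_def)
  from mult_right_mono[OF this A] have "ramp l e t \<le> e * (l / (e * (l - 3 * e)))"
    unfolding ramp_def .
  also have "\<dots> = l / (l - 3 * e)" using assms by simp
  also have "\<dots> \<le> 4" using assms p by (simp add: divide_simps)
  finally show "ramp l e t \<le> 4" .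
  show "ramp l e t = l / (l - 3 * e)" if "2 * e \<le> t" "t \<le> l - 2 * e"
    using that assms p by (simp add: ramp_def)
  show "stretch l e t = 0" if "t \<le> e"
    using that assms p by (simp add: stretch_def)
  show "stretch l e t = l" if "l - e \<le> t"
  proof -
    have "(max 0 (t - e))\<^sup>2 - (max 0 (t - 2 * e))\<^sup>2 - (max 0 (t - (l - 2 * e)))\<^sup>2
     + (max 0 (t - (l - e)))\<^sup>2 = 2 * e * (l - 3 * e)"
    proof -
      have "max 0 (t - e) = t - e" "max 0 (t - 2 * e) = t - 2 * e"
        "max 0 (t - (l - 2 * e)) = t - (l - 2 * e)" "max 0 (t - (l - e)) = t - (l - e)"
        using that assms by linarith+
      then show ?thesis by (simp only: power2_eq_square) (simp add: algebra_simps)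
    qed
    then show ?thesis
      using assms p by (simp add: stretch_def)
  qed
  show "stretch l e t = (t - 3 * e / 2) * (l / (l - 3 * e))" if "2 * e \<le> t" "t \<le> l - 2 * e"
  proof -
    have "(max 0 (t - e))\<^sup>2 - (max 0 (t - 2 * e))\<^sup>2 - (max 0 (t - (l - 2 * e)))\<^sup>2
     + (max 0 (t - (l - e)))\<^sup>2 = 2 * e * (t - 3 * e / 2)"
    proof -
      have "max 0 (t - e) = t - e" "max 0 (t - 2 * e) = t - 2 * e"
        "max 0 (t - (l - 2 * e)) = 0" "max 0 (t - (l - e)) = 0"
        using that assms by linarith+
      then show ?thesis by (simp only: power2_eq_square) (simp add: algebra_simps)
    qed
    then show ?thesis
      using assms p by (simp add: stretch_def)
  qed
qed

lemma stretch_bounds: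
  assumes "0 < e" "4 * e \<le> l"
  shows "0 \<le> stretch l e t" "stretch l e t \<le> l"
proof -
  have mono: "stretch l e a \<le> stretch l e b" if "a \<le> b" for a b
    by (rule DERIV_nonneg_imp_nondecreasing[OF that])
      (use has_real_derivative_stretch[OF assms] ramp_nonneg[OF assms] in blast)
  show "0 \<le> stretch l e t"
    using mono[of "min t 0" t] stretch_left[OF assms, of "min t 0"] assms by simp
  show "stretch l e t \<le> l"
    using mono[of t "max t l"] stretch_right[OF assms, of "max t l"] assms by simp
qed

lemma C1_stretch:
  assumes "0 < e" "4 * e \<le> l" shows "C1 (stretch l e)"
  by (rule C1_real[OF has_real_derivative_stretch[OF assms] continuous_on_ramp[OF assms]])

text \<open>\<open>stretch 1 (1/4)\<close> is a smooth step from 0 to 1, its ramp being a triangle.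
  Rescaled to width e, one step rises within [e, 2 * e] and its mirror image falls within
  [l - 2 * e, l - e].\<close>

definition cutoff :: "real \<Rightarrow> real \<Rightarrow> real \<Rightarrow> real" where
  "cutoff l e t = stretch 1 (1/4) ((t - e) / e) * stretch 1 (1/4) ((l - e - t) / e)"

lemma C1_cutoff:
  assumes "0 < e" shows "C1 (cutoff l e)"
proof -
  have 1: "C1 (\<lambda>t. (t - e) / e)"
    by (rule C1_real[where f' = "\<lambda>_. 1 / e"]) (use assms in \<open>auto intro!: derivative_eq_intros\<close>)
  have 2: "C1 (\<lambda>t. (l - e - t) / e)"
    by (rule C1_real[where f' = "\<lambda>_. - 1 / e"]) (use assms in \<open>auto intro!: derivative_eq_intros\<close>)
  have 3: "C1 (stretch 1 (1/4))"
    by (rule C1_stretch) auto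
  show ?thesis
    unfolding cutoff_def by (intro C1_mult C1_compose[OF 3 1] C1_compose[OF 3 2])
qed

lemma
  assumes "0 < e"
  shows cutoff_nonneg: "0 \<le> cutoff l e t"
    and cutoff_le_1: "cutoff l e t \<le> 1"
    and cutoff_left: "t \<le> e \<Longrightarrow> cutoff l e t = 0"
    and cutoff_right: "l - e \<le> t \<Longrightarrow> cutoff l e t = 0"
    and cutoff_middle: "2 * e \<le> t \<Longrightarrow> t \<le> l - 2 * e \<Longrightarrow> cutoff l e t = 1"
proof -
  show "0 \<le> cutoff l e t" "cutoff l e t \<le> 1"
    using stretch_bounds[of "1/4" 1] by (auto simp: cutoff_def intro: mult_le_one)
  show "cutoff l e t = 0" if "t \<le> e"
    using that assms by (simp add: cutoff_def stretch_left divide_le_eq)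
  show "cutoff l e t = 0" if "l - e \<le> t"
    using that assms by (simp add: cutoff_def stretch_left divide_le_eq)
  show "cutoff l e t = 1" if "2 * e \<le> t" "t \<le> l - 2 * e"
    using that assms by (simp add: cutoff_def stretch_right le_divide_eq)
qed

lemma
  assumes "0 < t" "t < l" "\<And>n. 0 < e n" "e \<longlonglongrightarrow> 0"
  shows tendsto_cutoff: "(\<lambda>n. cutoff l (e n) t) \<longlonglongrightarrow> 1"
    and tendsto_ramp: "(\<lambda>n. ramp l (e n) t) \<longlonglongrightarrow> 1"
    and tendsto_stretch: "(\<lambda>n. stretch l (e n) t) \<longlonglongrightarrow> t"
proof -
  have "eventually (\<lambda>n. e n < min (l/4) (min (t/2) ((l-t)/2))) sequentially"
    using assms by (intro order_tendstoD(2)[OF assms(4)]) auto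
  then have ev: "eventually (\<lambda>n. 0 < e n \<and> 4 * e n \<le> l \<and> 2 * e n \<le> t \<and> t \<le> l - 2 * e n) sequentially"
    by eventually_elim (use assms(3) in auto)
  have "(\<lambda>n. 1) \<longlonglongrightarrow> (1::real)" by simp
  then show "(\<lambda>n. cutoff l (e n) t) \<longlonglongrightarrow> 1"
    by (rule Lim_transform_eventually) (use ev in eventually_elim, simp add: cutoff_middle)
  have "(\<lambda>n. l / (l - 3 * e n)) \<longlonglongrightarrow> l / (l - 3 * 0)"
    using assms by (intro tendsto_intros) auto
  then have "(\<lambda>n. l / (l - 3 * e n)) \<longlonglongrightarrow> 1"
    using assms by simp
  then show "(\<lambda>n. ramp l (e n) t) \<longlonglongrightarrow> 1"
    by (rule Lim_transform_eventually) (use ev in eventually_elim, simp add: ramp_middle)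
  have "(\<lambda>n. (t - 3 * e n / 2) * (l / (l - 3 * e n))) \<longlonglongrightarrow> (t - 3 * 0 / 2) * (l / (l - 3 * 0))"
    using assms by (intro tendsto_intros) auto
  then have "(\<lambda>n. (t - 3 * e n / 2) * (l / (l - 3 * e n))) \<longlonglongrightarrow> t"
    using assms by simp
  then show "(\<lambda>n. stretch l (e n) t) \<longlonglongrightarrow> t"
    by (rule Lim_transform_eventually) (use ev in eventually_elim, simp add: stretch_middle)
qed

text \<open>Measurability yields continuous functions converging almost everywhere; they are clipped
  to [-1, 1] and then replaced by polynomials by Stone-Weierstrass. Polynomials are used because the
  test functions have to be continuously differentiable while obeying the bound 1.\<close>

lemma polynomial_AE_approximation:
  fixes s :: "'a::euclidean_space \<Rightarrow> real"
  assumes "compact S" "s \<in> borel_measurable (lebesgue_on S)" "\<And>x. \<bar>s x\<bar> \<le> 1"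
  obtains p where "\<And>n. real_polynomial_function (p n)" "\<And>n x. x \<in> S \<Longrightarrow> \<bar>p n x\<bar> \<le> 1"
    "AE x in lebesgue_on S. (\<lambda>n. p n x) \<longlonglongrightarrow> s x"
proof -
  have S: "S \<in> sets lebesgue" using assms(1) by (simp add: lmeasurable_compact fmeasurableD)
  have "s measurable_on S"
    using assms S by (simp add: measurable_on_iff_borel_measurable)
  then obtain N g where N: "negligible N" and g: "\<And>n. continuous_on UNIV (g n)"
    and lim: "\<And>x. x \<notin> N \<Longrightarrow> (\<lambda>n. g n x) \<longlonglongrightarrow> (if x \<in> S then s x else 0)"
    unfolding measurable_on_def by blast
  define c :: "nat \<Rightarrow> 'a \<Rightarrow> real" where "c n x = max (-1) (min 1 (g n x))" for n x
  have "continuous_on S (c n)" for n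
    unfolding c_def by (intro continuous_intros continuous_on_subset[OF g]) auto
  then have "\<exists>q. real_polynomial_function q \<and> (\<forall>x\<in>S. \<bar>c n x - q x\<bar> < inverse (real (Suc n)))" for n
    using Stone_Weierstrass_real_polynomial_function[OF assms(1), of "c n" "inverse (real (Suc n))"]
    by (metis inverse_positive_iff_positive of_nat_0_less_iff zero_less_Suc)
  then obtain q where q: "\<And>n. real_polynomial_function (q n)"
      "\<And>n x. x \<in> S \<Longrightarrow> \<bar>c n x - q n x\<bar> < inverse (real (Suc n))"
    by metis
  \<comment> \<open>The uniform error can push \<open>q n\<close> up to 1 + 1 / (n + 1) in absolute
    value; dividing by this number restores the bound 1 and does not change the limit.\<close>
  define p where "p n x = inverse (1 + inverse (real (Suc n))) * q n x" for n x
  show ?thesis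
  proof (rule that)
    show "real_polynomial_function (p n)" for n
      unfolding p_def by (intro real_polynomial_function.intros q)
    show "\<bar>p n x\<bar> \<le> 1" if "x \<in> S" for n x
    proof -
      have "\<bar>c n x\<bar> \<le> 1" by (auto simp: c_def)
      then have "\<bar>q n x\<bar> \<le> 1 + inverse (real (Suc n))" using q(2)[OF that, of n] by linarith
      moreover have "0 < 1 + inverse (real (Suc n))" by (simp add: add_pos_pos)
      ultimately show ?thesis
        unfolding p_def by (simp add: abs_mult divide_simps mult.commute)
    qed
    have lim': "(\<lambda>n. p n x) \<longlonglongrightarrow> s x" if "x \<in> S - N" for x
    proof -
      have "(\<lambda>n. c n x) \<longlonglongrightarrow> max (-1) (min 1 (s x))"
        unfolding c_def using lim[of x] that by (intro tendsto_intros) auto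
      moreover have "max (-1) (min 1 (s x)) = s x" using assms(3)[of x] by auto
      moreover have "(\<lambda>n. c n x - q n x) \<longlonglongrightarrow> 0"
        by (rule Lim_null_comparison[OF always_eventually LIMSEQ_inverse_real_of_nat])
          (use q(2) that in \<open>auto intro: less_imp_le\<close>)
      ultimately have "(\<lambda>n. c n x - (c n x - q n x)) \<longlonglongrightarrow> s x - 0"
        by (intro tendsto_diff) auto
      then have "(\<lambda>n. q n x) \<longlonglongrightarrow> s x" by simp
      then have "(\<lambda>n. p n x) \<longlonglongrightarrow> inverse (1 + 0) * s x"
        unfolding p_def by (intro tendsto_intros LIMSEQ_inverse_real_of_nat) auto
      then show ?thesis by simp
    qed
    have "AE x in lebesgue. x \<notin> N"
      using N by (simp add: negligible_iff_null_sets AE_not_in)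
    then have "AE x in lebesgue_on S. x \<notin> N"
      using S by (auto simp: AE_restrict_space_iff)
    moreover have "AE x in lebesgue_on S. x \<in> S"
      using S by (auto simp: AE_restrict_space_iff)
    ultimately show "AE x in lebesgue_on S. (\<lambda>n. p n x) \<longlonglongrightarrow> s x"
      by eventually_elim (use lim' in auto)
  qed
qed

text \<open>Divided by K, each \<open>\<Phi> n\<close> is admissible for \<open>TV\<close>.
  Dominated convergence with majorant \<open>\<bar>w x\<bar> * B\<close> carries the estimate over
  to \<open>g\<close>, which may be discontinuous.\<close>

lemma TV_limit:
  fixes \<Phi> :: "nat \<Rightarrow> real^'d \<Rightarrow> real^'d"
  assumes w: "integrable (lebesgue_on \<Omega>) w" and \<Omega>: "\<Omega> \<in> sets lebesgue" and K: "0 < K"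
    and \<Phi>: "\<And>n. \<Phi> n \<in> C1c \<Omega>" "\<And>n x. norm (\<Phi> n x) \<le> K"
    and bnd: "\<And>n. AE x in lebesgue_on \<Omega>. \<bar>divergence (\<Phi> n) x\<bar> \<le> B"
    and lim: "AE x in lebesgue_on \<Omega>. (\<lambda>n. divergence (\<Phi> n) x) \<longlonglongrightarrow> g x"
    and g: "g \<in> borel_measurable (lebesgue_on \<Omega>)"
  shows "ereal (LINT x|lebesgue_on \<Omega>. w x * g x) \<le> ereal K * TV \<Omega> w"
proof -
  have C: "C1 (\<Phi> n)" for n using \<Phi>(1)[of n] by (auto simp: C1c_eq_C1)
  have m: "divergence (\<Phi> n) \<in> borel_measurable (lebesgue_on \<Omega>)" for n
    by (rule continuous_imp_measurable_on_sets_lebesgue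
        [OF continuous_on_subset[OF continuous_divergence[OF C]] \<Omega>]) simp
  have le: "ereal (LINT x|lebesgue_on \<Omega>. w x * divergence (\<Phi> n) x) \<le> ereal K * TV \<Omega> w" for n
  proof -
    have "(\<lambda>x. inverse K *\<^sub>R \<Phi> n x) \<in> C1c \<Omega>"
      using \<Phi>(1)[of n] K by (auto simp: C1c_eq_C1 intro!: C1_scaleR)
    moreover have "\<forall>x. norm (inverse K *\<^sub>R \<Phi> n x) \<le> 1"
      using \<Phi>(2) K by (auto simp: divide_simps)
    ultimately have "ereal (LINT x|lebesgue_on \<Omega>. w x * divergence (\<lambda>x. inverse K *\<^sub>R \<Phi> n x) x) \<le> TV \<Omega> w"
      unfolding TV_def by (intro SUP_upper) auto
    moreover have "(LINT x|lebesgue_on \<Omega>. w x * divergence (\<lambda>x. inverse K *\<^sub>R \<Phi> n x) x)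
        = inverse K * (LINT x|lebesgue_on \<Omega>. w x * divergence (\<Phi> n) x)"
      by (simp add: divergence_scaleR[OF C] mult.left_commute)
    ultimately have "ereal K * ereal (inverse K * (LINT x|lebesgue_on \<Omega>. w x * divergence (\<Phi> n) x)) \<le> ereal K * TV \<Omega> w"
      using K by (intro ereal_mult_left_mono) auto
    then show ?thesis using K by (simp flip: mult.assoc)
  qed
  have "(\<lambda>n. LINT x|lebesgue_on \<Omega>. w x * divergence (\<Phi> n) x) \<longlonglongrightarrow> (LINT x|lebesgue_on \<Omega>. w x * g x)"
  proof (rule integral_dominated_convergence[where w = "\<lambda>x. \<bar>w x\<bar> * B"])
    show "AE x in lebesgue_on \<Omega>. (\<lambda>n. w x * divergence (\<Phi> n) x) \<longlonglongrightarrow> w x * g x"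
      using lim by eventually_elim (intro tendsto_intros)
    show "AE x in lebesgue_on \<Omega>. norm (w x * divergence (\<Phi> n) x) \<le> \<bar>w x\<bar> * B" for n
      using bnd[of n] by eventually_elim (auto simp: abs_mult intro: mult_left_mono)
  qed (use w m g in auto)
  then show ?thesis
    by (intro Lim_bounded[where f = "\<lambda>n. ereal (LINT x|lebesgue_on \<Omega>. w x * divergence (\<Phi> n) x)"])
      (use le in auto)
qed

section \<open>Potentials on a cell\<close>

text \<open>Differentiation under the integral sign. The point of evaluation is affine in x for each
  u, which covers both the average over a whole segment and the average up to a moving
  endpoint.\<close>

lemma C1_integral:
  fixes f :: "'a::euclidean_space \<Rightarrow> real" and L :: "real \<Rightarrow> 'b::euclidean_space \<Rightarrow>\<^sub>L 'a"
  assumes f: "C1 f" and b: "continuous_on UNIV b" and L: "continuous_on UNIV L"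
  shows "C1 (\<lambda>x. integral {0..1} (\<lambda>u. f (b u + L u x)))"
proof -
  obtain D where D: "\<And>x. (f has_derivative blinfun_apply (D x)) (at x)" "continuous_on UNIV D"
    using f unfolding C1_def by blast
  define E where "E x u = D (b u + L u x) o\<^sub>L L u" for x u
  have "continuous_on UNIV (\<lambda>z. b (snd z) + L (snd z) (fst z))"
    by (intro continuous_intros continuous_on_compose2[OF b] continuous_on_compose2[OF L]) auto
  then have "continuous_on UNIV (\<lambda>z. D (b (snd z) + L (snd z) (fst z)) o\<^sub>L L (snd z))"
    by (intro continuous_intros continuous_on_compose2[OF L] continuous_on_compose2[OF b]
        continuous_on_compose2[OF D(2)]) auto
  then have E: "continuous_on (UNIV \<times> cbox 0 1) (\<lambda>(x, u). E x u)"
    unfolding E_def split_beta by (rule continuous_on_subset) auto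
  have "((\<lambda>x. integral (cbox 0 1) (\<lambda>u. f (b u + L u x))) has_derivative
      blinfun_apply (integral (cbox 0 1) (E x))) (at x within UNIV)" for x
  proof (rule leibniz_rule[OF _ _ E])
    fix x u
    have "((\<lambda>x. b u + L u x) has_derivative blinfun_apply (L u)) (at x)"
      by (auto intro!: derivative_eq_intros)
    from has_derivative_compose[OF this D(1)]
    show "((\<lambda>x. f (b u + L u x)) has_derivative blinfun_apply (E x u)) (at x within UNIV)"
      by (rule has_derivative_eq_rhs) (simp add: E_def fun_eq_iff)
  next
    fix x
    show "(\<lambda>u. f (b u + L u x)) integrable_on cbox 0 1"
      by (intro integrable_continuous continuous_on_compose2[OF C1_imp_continuous[OF f]]
          continuous_intros continuous_on_subset[OF b] continuous_on_subset[OF L]) auto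
  qed auto
  moreover have "continuous_on UNIV (\<lambda>x. integral (cbox 0 1) (E x))"
    by (rule integral_continuous_on_param[OF E])
  ultimately show ?thesis
    by (intro C1I) (auto simp: cbox_interval)
qed

lemma continuous_antiderivative_exists:
  fixes k :: "real \<Rightarrow> real"
  assumes "continuous_on UNIV k"
  obtains S where "\<And>t. (S has_real_derivative k t) (at t)"
proof -
  have "\<exists>F. \<forall>x::real. -\<infinity> < ereal x \<longrightarrow> ereal x < \<infinity> \<longrightarrow> (F has_vector_derivative k x) (at x)"
    using assms by (intro einterval_antiderivative) (auto simp: continuous_on_eq_continuous_at)
  then show ?thesis
    using that by (auto simp: has_real_derivative_iff_has_vector_derivative)
qed

text \<open>The fundamental theorem after substituting c + u * y. With the factor y on the left it
  holds for y = 0 and for negative y as well.\<close>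

lemma integral_rescaled:
  fixes k S :: "real \<Rightarrow> real"
  assumes "\<And>t. (S has_real_derivative k t) (at t)"
  shows "y * integral {0..1} (\<lambda>u. k (c + u * y)) = S (c + y) - S c"
proof -
  have "((\<lambda>u. y * k (c + u * y)) has_integral (S (c + 1 * y) - S (c + 0 * y))) {0..1}"
  proof (rule fundamental_theorem_of_calculus)
    fix u :: real
    have "((\<lambda>u. S (c + u * y)) has_real_derivative k (c + u * y) * y) (at u)"
      by (rule DERIV_chain2[OF assms]) (auto intro!: derivative_eq_intros)
    then show "((\<lambda>u. S (c + u * y)) has_vector_derivative y * k (c + u * y)) (at u within {0..1})"
      by (simp add: has_real_derivative_iff_has_vector_derivative[symmetric] mult.commute
          has_field_derivative_at_within)
  qed simp
  then show ?thesis
    by (simp add: integral_unique flip: integral_mult_right)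
qed

text \<open>\<open>v\<close> is the average of \<open>s\<close> over the cell in direction \<open>i\<close> and \<open>F\<close> is the antiderivative of
  \<open>s - v\<close> in that direction.\<close>

lemma directional_potential:
  fixes s :: "real^'d \<Rightarrow> real" and p :: "real^'d" and i :: 'd and l :: real
  defines "e \<equiv> axis i (1::real)" and "Q \<equiv> cbox p (\<chi> j. p $ j + l)"
  assumes s: "C1 s" and l: "0 < l" and bnd: "\<And>x. x \<in> Q \<Longrightarrow> \<bar>s x\<bar> \<le> 1"
  obtains F v where
    "\<And>x. ((\<lambda>t. F (x + t *\<^sub>R e)) has_real_derivative s x - v x) (at 0)" "C1 F" "C1 v"
    "\<And>x. x \<in> Q \<Longrightarrow> \<bar>F x\<bar> \<le> l / 2"
    "\<And>x. x $ i = p $ i \<Longrightarrow> F x = 0" "\<And>x. x $ i = p $ i + l \<Longrightarrow> F x = 0"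
    "\<And>x. x \<in> Q \<Longrightarrow> \<bar>v x\<bar> \<le> 1"
    "\<And>x t. v (x + t *\<^sub>R e) = v x"
    "\<And>d x t. d $ i = 0 \<Longrightarrow> (\<And>x t. s (x + t *\<^sub>R d) = s x) \<Longrightarrow> v (x + t *\<^sub>R d) = v x"
proof -
  define a where "a = p $ i"
  \<comment> \<open>\<open>k x\<close> is \<open>s\<close> on the line through x along axis i,
    parametrized by the i-th coordinate; it is thus the same function for all points of that
    line.\<close>
  define k where "k x t = s (x + (t - x $ i) *\<^sub>R e)" for x t
  \<comment> \<open>The mean of \<open>k x\<close> between a and a + y. Rescaling to the fixed
    interval {0..1} makes it differentiable in x even when y depends on x and passes through
    0.\<close>
  define J where "J x y = integral {0..1} (\<lambda>u. k x (a + u * y))" for x y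
  define v where "v x = J x l" for x
  define F where "F x = (x $ i - a) * J x (x $ i - a) - (x $ i - a) * v x" for x
  have ei: "e $ i = 1" by (simp add: e_def)
  have k_shift: "k (x + t *\<^sub>R e) = k x" for x t
    by (auto simp: k_def fun_eq_iff ei scaleR_left_diff_distrib scaleR_left_distrib)
  have k_cont: "continuous_on UNIV (k x)" for x
    unfolding k_def by (intro continuous_on_compose2[OF C1_imp_continuous[OF s]] continuous_intros) auto
  have "\<exists>S. \<forall>t. (S has_real_derivative k x t) (at t)" for x
    using continuous_antiderivative_exists[OF k_cont] by metis
  then obtain S where S: "\<And>x t. (S x has_real_derivative k x t) (at t)" by metis
  have J: "y * J x y = S x (a + y) - S x a" for x y
    unfolding J_def by (rule integral_rescaled[OF S])
  have v: "v x = (S x (a + l) - S x a) / l" for x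
    using J[of l x] l by (simp add: v_def field_simps)
  have J_shift: "J (x + t *\<^sub>R e) = J x" for x t
    by (simp add: J_def k_shift fun_eq_iff)
  have v_shift: "v (x + t *\<^sub>R e) = v x" for x t
    by (simp add: v_def J_shift)
  have F: "F x = S x (x $ i) - S x a - (x $ i - a) * v x" for x
    using J[of "x $ i - a" x] by (simp add: F_def)
  have kQ: "\<bar>k x t\<bar> \<le> 1" if "x \<in> Q" "a \<le> t" "t \<le> a + l" for x t
    unfolding k_def
    by (rule bnd) (use that in \<open>auto simp: Q_def e_def mem_box_cart a_def axis_def\<close>)
  have Sle: "\<bar>S x z - S x y\<bar> \<le> z - y" if "x \<in> Q" "a \<le> y" "y \<le> z" "z \<le> a + l" for x y z
  proof (cases "y < z")
    case True
    obtain c where "y < c" "c < z" "S x z - S x y = (z - y) * k x c"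
      using MVT2[OF True, of "S x" "k x"] S by blast
    then show ?thesis
      using kQ[OF that(1), of c] that True by (simp add: abs_mult mult_left_le)
  qed (use that in auto)
  show ?thesis
  proof (rule that[of F v])
    have vC: "C1 (\<lambda>x. integral {0..1} (\<lambda>u. s ((a + u * l) *\<^sub>R e + (id_blinfun - (blinfun_scaleR_left e o\<^sub>L blinfun_inner_left e)) x)))"
      by (rule C1_integral[OF s]) (intro continuous_intros)+
    have Cv: "C1 v"
      using vC by (simp add: v_def[abs_def] J_def k_def blinfun.diff_left blinfun.bilinear_simps
          e_def inner_axis algebra_simps scaleR_left_diff_distrib)
    then show "C1 v" .
    \<comment> \<open>Here the upper limit moves with x: the i-th coordinate of the evaluation point
      is a + u * (x_i - a), again affine in x for fixed u.\<close>
    have JC: "C1 (\<lambda>x. integral {0..1} (\<lambda>u. s ((a - u * a) *\<^sub>R e + (id_blinfun - (1 - u) *\<^sub>R (blinfun_scaleR_left e o\<^sub>L blinfun_inner_left e)) x)))"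
      by (rule C1_integral[OF s]) (intro continuous_intros)+
    have "C1 (\<lambda>x. J x (x $ i - a))"
      using JC by (simp add: J_def k_def blinfun.diff_left blinfun.bilinear_simps
          e_def inner_axis algebra_simps scaleR_left_diff_distrib)
    then show "C1 F"
      unfolding F_def[abs_def] by (intro C1_diff C1_mult Cv C1_nth C1_const)
    show "((\<lambda>t. F (x + t *\<^sub>R e)) has_real_derivative s x - v x) (at 0)" for x
    proof -
      have eq: "F (x + t *\<^sub>R e) = S x (x $ i + t) - S x a - (x $ i + t - a) * v x" for t
        using J[of "x $ i + t - a" x] by (simp add: F_def J_shift v_shift ei)
      have "((\<lambda>t. S x (x $ i + t) - S x a - (x $ i + t - a) * v x) has_real_derivative
          k x (x $ i + 0) * 1 - v x) (at 0)"
        by (rule derivative_eq_intros DERIV_chain2[OF S] refl | simp)+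
      then show ?thesis unfolding eq by (simp add: k_def)
    qed
    show "F x = 0" if "x $ i = p $ i" for x
      using that by (simp add: F a_def)
    show "F x = 0" if "x $ i = p $ i + l" for x
      using that l by (simp add: F v flip: a_def)
    show "\<bar>v x\<bar> \<le> 1" if "x \<in> Q" for x
      using Sle[OF that, of a "a + l"] l by (simp add: v)
    show "\<bar>F x\<bar> \<le> l / 2" if "x \<in> Q" for x
    proof -
      define y where "y = x $ i - a"
      have y: "0 \<le> y" "y \<le> l"
        using that by (auto simp: Q_def mem_box_cart y_def a_def dest: spec[of _ i])
      \<comment> \<open>The integral up to x_i and the integral beyond it are weighted by 1 - y / l
        and y / l. With \<open>\<bar>s\<bar> \<le> 1\<close> this gives 2 * y * (l - y) / l, whose
        maximum l / 2 is attained in the middle.\<close>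
      have "F x = (1 - y / l) * (S x (a + y) - S x a) - y / l * (S x (a + l) - S x (a + y))"
        using l by (simp add: F v y_def field_simps)
      also have "\<bar>\<dots>\<bar> \<le> (1 - y / l) * \<bar>S x (a + y) - S x a\<bar> + y / l * \<bar>S x (a + l) - S x (a + y)\<bar>"
        using y l by (intro order_trans[OF abs_triangle_ineq4]) (simp add: abs_mult)
      also have "\<dots> \<le> (1 - y / l) * y + y / l * (l - y)"
        using y l Sle[OF that, of a "a + y"] Sle[OF that, of "a + y" "a + l"]
        by (intro add_mono mult_left_mono) auto
      also have "\<dots> = l / 2 - 2 * (y - l / 2)\<^sup>2 / l"
        using l by (simp add: field_simps power2_eq_square)
      also have "\<dots> \<le> l / 2" using l by simp
      finally show ?thesis .
    qed
    show "v (x + t *\<^sub>R e) = v x" for x t by (rule v_shift)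
    show "v (x + t *\<^sub>R d) = v x" if "d $ i = 0" and "\<And>x t. s (x + t *\<^sub>R d) = s x" for d x t
    proof -
      have "k (x + t *\<^sub>R d) r = k x r" for r
        using that(2)[of "x + (r - x $ i) *\<^sub>R e" t] that(1) by (simp add: k_def add_ac)
      then show ?thesis by (simp add: v_def J_def)
    qed
  qed
qed

text \<open>Telescoping by induction on the set of directions already treated: \<open>v\<close> is
  the average of \<open>s\<close> over those coordinates. Averaging in a further direction keeps
  \<open>\<bar>v\<bar> \<le> 1\<close> on the cell and keeps the invariance along the earlier axes,
  so after all directions \<open>v\<close> is a constant.\<close>

lemma cell_potentials:
  fixes s :: "real^'d \<Rightarrow> real" and p :: "real^'d" and l :: real
  defines "Q \<equiv> cbox p (\<chi> j. p $ j + l)"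
  assumes s: "C1 s" and l: "0 < l" and bnd: "\<And>x. x \<in> Q \<Longrightarrow> \<bar>s x\<bar> \<le> 1"
  obtains F G :: "'d \<Rightarrow> real^'d \<Rightarrow> real" and c where
    "\<And>i. C1 (F i)" "\<And>i. continuous_on UNIV (G i)"
    "\<And>i x. ((\<lambda>t. F i (x + t *\<^sub>R axis i 1)) has_real_derivative G i x) (at 0)"
    "\<And>i x. x \<in> Q \<Longrightarrow> \<bar>F i x\<bar> \<le> l / 2"
    "\<And>i x. x $ i = p $ i \<Longrightarrow> F i x = 0" "\<And>i x. x $ i = p $ i + l \<Longrightarrow> F i x = 0"
    "\<And>x. s x - c = (\<Sum>i\<in>UNIV. G i x)"
proof -
  define ok where "ok i F G \<longleftrightarrow> C1 F \<and> continuous_on UNIV G \<and>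
      (\<forall>x. ((\<lambda>t. F (x + t *\<^sub>R axis i 1)) has_real_derivative G x) (at 0)) \<and>
      (\<forall>x\<in>Q. \<bar>F x\<bar> \<le> l / 2) \<and> (\<forall>x. x $ i = p $ i \<longrightarrow> F x = 0) \<and>
      (\<forall>x. x $ i = p $ i + l \<longrightarrow> F x = 0)" for i :: 'd and F G :: "real^'d \<Rightarrow> real"
  have "\<exists>F G v. (\<forall>i\<in>I. ok i (F i) (G i)) \<and> C1 v \<and> (\<forall>x\<in>Q. \<bar>v x\<bar> \<le> 1) \<and>
      (\<forall>i\<in>I. \<forall>x t. v (x + t *\<^sub>R axis i 1) = v x) \<and> (\<forall>x. s x - v x = (\<Sum>i\<in>I. G i x))"
    if "finite I" for I :: "'d set"
    using that
  proof induction
    case empty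
    show ?case using s bnd by (auto intro!: exI[of _ s])
  next
    case (insert i I)
    then obtain F G v where *: "\<forall>i\<in>I. ok i (F i) (G i)" "C1 v" "\<forall>x\<in>Q. \<bar>v x\<bar> \<le> 1"
      "\<forall>i\<in>I. \<forall>x t. v (x + t *\<^sub>R axis i 1) = v x" "\<forall>x. s x - v x = (\<Sum>i\<in>I. G i x)"
      by blast
    have b: "\<bar>v x\<bar> \<le> 1" if "x \<in> cbox p (\<chi> j. p $ j + l)" for x
      using *(3) that by (simp add: Q_def)
    obtain F' v' where F':
      "\<And>x. ((\<lambda>t. F' (x + t *\<^sub>R axis i 1)) has_real_derivative v x - v' x) (at 0)" "C1 F'" "C1 v'"
      "\<And>x. x \<in> cbox p (\<chi> j. p $ j + l) \<Longrightarrow> \<bar>F' x\<bar> \<le> l / 2"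
      "\<And>x. x $ i = p $ i \<Longrightarrow> F' x = 0" "\<And>x. x $ i = p $ i + l \<Longrightarrow> F' x = 0"
      "\<And>x. x \<in> cbox p (\<chi> j. p $ j + l) \<Longrightarrow> \<bar>v' x\<bar> \<le> 1"
      "\<And>x t. v' (x + t *\<^sub>R axis i 1) = v' x"
      "\<And>d x t. d $ i = 0 \<Longrightarrow> (\<And>x t. v (x + t *\<^sub>R d) = v x) \<Longrightarrow> v' (x + t *\<^sub>R d) = v' x"
      by (rule directional_potential[OF *(2) l b, of p i]) (assumption, rule that, assumption+, blast)
    have "ok i F' (\<lambda>x. v x - v' x)"
      unfolding ok_def using F' *(2) by (auto simp: Q_def intro!: C1_imp_continuous C1_diff)
    moreover have "v' (x + t *\<^sub>R axis j 1) = v' x" if "j \<in> insert i I" for j x t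
      using that insert.hyps F'(8) F'(9)[of "axis j 1" x t] *(4) by (cases "j = i") (auto simp: axis_def)
    moreover have "s x - v' x = (\<Sum>j\<in>insert i I. (G(i := \<lambda>x. v x - v' x)) j x)" for x
    proof -
      have "(\<Sum>j\<in>I. (G(i := \<lambda>x. v x - v' x)) j x) = (\<Sum>j\<in>I. G j x)"
        using insert.hyps by (intro sum.cong) auto
      also have "\<dots> = s x - v x" using *(5) by simp
      finally show ?thesis using insert.hyps by simp
    qed
    ultimately show ?case
      using *(1) F'(3) F'(7)[folded Q_def] insert.hyps
      by (intro exI[of _ "F(i := F')"] exI[of _ "G(i := \<lambda>x. v x - v' x)"] exI[of _ v']) auto
  qed
  from this[of UNIV] obtain F G v where *: "\<forall>i. ok i (F i) (G i)"
    "\<forall>i. \<forall>x t. v (x + t *\<^sub>R axis i 1) = v x" "\<forall>x. s x - v x = (\<Sum>i\<in>UNIV. G i x)"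
    by auto
  have sh: "v (t *\<^sub>R axis i 1 + y) = v y" for t i y
    using *(2) by (simp add: add.commute[of "t *\<^sub>R axis i 1" y])
  \<comment> \<open>Invariance along every axis makes \<open>v\<close> constant: x is reached from
    the origin by moving along one axis at a time.\<close>
  have "v (\<Sum>i\<in>I. x $ i *\<^sub>R axis i 1) = v 0" if "finite I" for I x
    using that by induction (auto simp: sh)
  from this[of UNIV] have "v x = v 0" for x
    by (simp add: basis_expansion scalar_mult_eq_scaleR[symmetric])
  then have "s x - v 0 = (\<Sum>i\<in>UNIV. G i x)" for x
    using *(3) by metis
  then show ?thesis
    using *(1) unfolding ok_def by (intro that[of F G "v 0"]) auto
qed

section \<open>Meshes of cubes\<close>

definition cube :: "real \<Rightarrow> real^'d \<Rightarrow> (real^'d) set" where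
  "cube l p = cbox p (\<chi> i. p $ i + l)"

definition open_cube :: "real \<Rightarrow> real^'d \<Rightarrow> (real^'d) set" where
  "open_cube l p = box p (\<chi> i. p $ i + l)"

lemma mem_cube: "x \<in> cube l p \<longleftrightarrow> (\<forall>i. p $ i \<le> x $ i \<and> x $ i \<le> p $ i + l)"
  by (simp add: cube_def mem_box_cart)

lemma mem_open_cube: "x \<in> open_cube l p \<longleftrightarrow> (\<forall>i. p $ i < x $ i \<and> x $ i < p $ i + l)"
  by (simp add: open_cube_def mem_box_cart)

lemma open_cube_subset_cube: "open_cube l p \<subseteq> cube l p"
  by (auto simp: mem_cube mem_open_cube less_imp_le)

lemma interior_cube: "interior (cube l p) = open_cube l p"
  by (simp add: cube_def open_cube_def)

lemma open_open_cube [simp]: "open (open_cube l p)"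
  unfolding open_cube_def by (rule open_box)

lemma compact_cube [simp]: "compact (cube l p)"
  by (simp add: cube_def)

lemma closed_cube [simp]: "closed (cube l p)"
  unfolding cube_def by (rule closed_cbox)

lemma closure_open_cube: "0 < l \<Longrightarrow> closure (open_cube l p) = cube l p"
  unfolding open_cube_def cube_def by (rule closure_box) (simp add: interval_eq_empty_cart)

lemma cube_inject: "0 < l \<Longrightarrow> cube l p = cube l q \<longleftrightarrow> p = q"
  unfolding cube_def by (subst eq_cbox) (auto simp: vec_eq_iff interval_eq_empty_cart)

lemma negligible_cube_boundary: "negligible (cube l p - open_cube l p)"
  by (simp add: cube_def open_cube_def negligible_frontier_interval)

lemma AE_lebesgue_on_not_in_negligible:
  assumes "negligible N" "S \<in> sets lebesgue"
  shows "AE x in lebesgue_on S. x \<notin> N"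
proof -
  have "AE x in lebesgue. x \<notin> N"
    using assms by (simp add: negligible_iff_null_sets AE_not_in)
  then show ?thesis
    using assms(2) by (auto simp: AE_restrict_space_iff)
qed

text \<open>A point of \<open>U\<close> outside \<open>\<Omega>\<close> would be a frontier point.
  Near it the points strictly below the Lipschitz graph form a nonempty open subset of
  \<open>U\<close> that misses \<open>\<Omega>\<close>, so \<open>U - \<Omega>\<close> would not be
  negligible. Slits and punctures are excluded in this way.\<close>

lemma lipschitz_domain_absorbs_open:
  assumes \<Omega>: "lipschitz_domain \<Omega>" and U: "open U" "negligible (U - \<Omega>)"
  shows "U \<subseteq> \<Omega>"
proof
  fix x assume x: "x \<in> U"
  show "x \<in> \<Omega>"
  proof (rule ccontr)
    assume "x \<notin> \<Omega>"
    have "open \<Omega>" using \<Omega> by (simp add: lipschitz_domain_def)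
    have no_open: "V = {}" if "open V" "V \<subseteq> U" "V \<inter> \<Omega> = {}" for V
    proof -
      have "negligible V" using that by (intro negligible_subset[OF U(2)]) auto
      then show ?thesis using open_not_negligible that(1) by blast
    qed
    have "U - closure \<Omega> = {}"
      using U closure_subset[of \<Omega>] by (rule_tac no_open) auto
    then have "x \<in> frontier \<Omega>"
      using x \<open>x \<notin> \<Omega>\<close> \<open>open \<Omega>\<close> by (auto simp: frontier_def interior_open)
    then obtain e r L \<gamma> where e: "norm e = 1" "0 < r" "L-lipschitz_on {v. v \<bullet> e = 0} \<gamma>"
      and iff: "\<forall>y\<in>ball x r. y \<in> \<Omega> \<longleftrightarrow> \<gamma> (y - (y \<bullet> e) *\<^sub>R e) < y \<bullet> e"
      using \<Omega> unfolding lipschitz_domain_def by blast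
    have ee: "e \<bullet> e = 1" using e(1) by (simp add: norm_eq_1)
    obtain \<rho> where \<rho>: "0 < \<rho>" "ball x \<rho> \<subseteq> U" using U(1) x openE by blast
    define \<delta> where "\<delta> = min \<rho> r"
    define V where "V = ball x \<delta> \<inter> {y. y \<bullet> e < \<gamma> (y - (y \<bullet> e) *\<^sub>R e)}"
    have cont: "continuous_on UNIV (\<lambda>y. \<gamma> (y - (y \<bullet> e) *\<^sub>R e))"
      by (rule continuous_on_compose2[OF lipschitz_on_continuous_on[OF e(3)]])
        (auto intro!: continuous_intros simp: inner_diff_left ee)
    have "open V"
      unfolding V_def by (intro open_Int open_ball open_Collect_less cont) (intro continuous_intros)
    moreover have "V \<subseteq> U" "V \<inter> \<Omega> = {}" using \<rho> iff by (auto simp: V_def \<delta>_def)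
    ultimately have "V = {}" by (rule no_open)
    \<comment> \<open>Moving down along \<open>e\<close> leaves the projection onto the hyperplane
      unchanged, while x itself is not above the graph; the new point is therefore strictly below
      it.\<close>
    moreover have "x - (\<delta> / 2) *\<^sub>R e \<in> V"
    proof -
      have "0 < \<delta>" using \<rho> e by (simp add: \<delta>_def)
      moreover have eq: "x - (\<delta> / 2) *\<^sub>R e - ((x - (\<delta> / 2) *\<^sub>R e) \<bullet> e) *\<^sub>R e = x - (x \<bullet> e) *\<^sub>R e"
        by (simp add: inner_diff_left ee algebra_simps)
      moreover have "x \<bullet> e \<le> \<gamma> (x - (x \<bullet> e) *\<^sub>R e)"
        using iff \<open>x \<notin> \<Omega>\<close> e(2) by (auto simp: not_less)
      ultimately show ?thesis
        unfolding V_def Int_iff mem_Collect_eq eq by (simp add: dist_norm e(1) inner_diff_left ee)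
    qed
    ultimately show False by simp
  qed
qed

text \<open>Cells are represented by their lower corners. Conformity is recorded through facets: a
  second cell touching the relative interior of an i-facet is the translate of the first by
  \<open>l\<close> along axis i. Whether a facet is shared thus becomes membership of the translated
  corner in \<open>P\<close>.\<close>

locale cube_mesh =
  fixes \<Omega> :: "(real^'d) set" and l :: real and P :: "(real^'d) set"
  assumes l_pos: "0 < l" and fin: "finite P"
    and \<Omega>_eq: "\<Omega> = interior (\<Union>p\<in>P. cube l p)"
    and disj: "\<And>p q. p \<in> P \<Longrightarrow> q \<in> P \<Longrightarrow> p \<noteq> q \<Longrightarrow> open_cube l p \<inter> open_cube l q = {}"
    and facet_upper: "\<And>p q x i. p \<in> P \<Longrightarrow> q \<in> P \<Longrightarrow> p \<noteq> q \<Longrightarrow> x \<in> cube l q \<Longrightarrow>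
      (\<And>j. j \<noteq> i \<Longrightarrow> p $ j < x $ j \<and> x $ j < p $ j + l) \<Longrightarrow> x $ i = p $ i + l \<Longrightarrow>
      q = p + l *\<^sub>R axis i 1"
    and facet_lower: "\<And>p q x i. p \<in> P \<Longrightarrow> q \<in> P \<Longrightarrow> p \<noteq> q \<Longrightarrow> x \<in> cube l q \<Longrightarrow>
      (\<And>j. j \<noteq> i \<Longrightarrow> p $ j < x $ j \<and> x $ j < p $ j + l) \<Longrightarrow> x $ i = p $ i \<Longrightarrow>
      q = p - l *\<^sub>R axis i 1"

text \<open>A face containing x contains the whole segment through x along axis j, from one j-facet
  to the other. That segment has length \<open>l\<close> and lies in the second cube of side
  \<open>l\<close>, which forces the j-th coordinates of the corners to agree.\<close>

lemma face_of_cube_coordinate: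
  assumes "cube l p \<inter> cube l q face_of cube l p" "x \<in> cube l p" "x \<in> cube l q"
    "p $ j < x $ j" "x $ j < p $ j + l"
  shows "q $ j = p $ j"
proof -
  define a where "a = x + (p $ j - x $ j) *\<^sub>R axis j 1"
  define b where "b = x + (p $ j + l - x $ j) *\<^sub>R axis j 1"
  have l: "0 < l" using assms(4,5) by simp
  have ab: "a \<in> cube l p" "b \<in> cube l p"
    using assms(2,4,5) by (auto simp: a_def b_def mem_cube axis_def)
  have "x \<in> open_segment a b"
    unfolding in_segment
  proof (intro conjI exI)
    show "a \<noteq> b" using l by (auto simp: a_def b_def axis_def vec_eq_iff dest: spec[of _ j])
    show "0 < (x $ j - p $ j) / l" "(x $ j - p $ j) / l < 1" using assms(4,5) l by auto
    show "x = (1 - (x $ j - p $ j) / l) *\<^sub>R a + ((x $ j - p $ j) / l) *\<^sub>R b"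
      using l by (auto simp: vec_eq_iff a_def b_def axis_def field_simps)
  qed
  then have "a \<in> cube l q" "b \<in> cube l q"
    using assms ab unfolding face_of_def by blast+
  then have "q $ j \<le> a $ j" "b $ j \<le> q $ j + l"
    by (auto simp: mem_cube)
  then show ?thesis by (simp add: a_def b_def axis_def)
qed

text \<open>The corners agree in every coordinate except i by
  \<open>face_of_cube_coordinate\<close>. In coordinate i they differ by at least \<open>l\<close>,
  as the interiors are disjoint, and the position of x makes the difference exactly \<open>l\<close>
  and fixes its sign.\<close>

lemma cube_neighbour:
  assumes face: "cube l p \<inter> cube l q face_of cube l p" and dj: "open_cube l p \<inter> open_cube l q = {}"
    and x: "x \<in> cube l q" "\<And>j. j \<noteq> i \<Longrightarrow> p $ j < x $ j \<and> x $ j < p $ j + l"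
    and l: "0 < l"
  shows "x $ i = p $ i + l \<Longrightarrow> q = p + l *\<^sub>R axis i 1" "x $ i = p $ i \<Longrightarrow> q = p - l *\<^sub>R axis i 1"
proof -
  have eq: "q $ j = p $ j" if "j \<noteq> i" "x \<in> cube l p" for j
    using face_of_cube_coordinate[OF face that(2) x(1), of j] x(2)[OF that(1)] by simp
  have far: "\<bar>q $ i - p $ i\<bar> \<ge> l" if "x \<in> cube l p"
  proof (rule ccontr)
    assume *: "\<not> ?thesis"
    \<comment> \<open>If the corners were closer than \<open>l\<close> in coordinate i, the midpoint
      of the overlap there, with the centre of the cell in the other coordinates, would be interior
      to both cells.\<close>
    have "(\<chi> j. if j = i then (p $ i + q $ i + l) / 2 else p $ j + l / 2) \<in> open_cube l p \<inter> open_cube l q"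
      using * l eq[OF _ that] by (auto simp: mem_open_cube abs_if split: if_splits)
    then show False using dj by blast
  qed
  have xi: "q $ i \<le> x $ i" "x $ i \<le> q $ i + l" using x(1) by (auto simp: mem_cube)
  have xp: "x \<in> cube l p" if "p $ i \<le> x $ i" "x $ i \<le> p $ i + l"
    unfolding mem_cube using x(2) that by (metis less_imp_le)
  show "q = p + l *\<^sub>R axis i 1" if "x $ i = p $ i + l"
  proof -
    have "x \<in> cube l p" using that l by (intro xp) auto
    from far[OF this] eq[OF _ this] show ?thesis
      using xi that by (auto simp: vec_eq_iff axis_def)
  qed
  show "q = p - l *\<^sub>R axis i 1" if "x $ i = p $ i"
  proof -
    have "x \<in> cube l p" using that l by (intro xp) auto
    from far[OF this] eq[OF _ this] show ?thesis
      using xi that by (auto simp: vec_eq_iff axis_def)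
  qed
qed

lemma mesh_imp_cube_mesh:
  assumes \<Omega>: "lipschitz_domain \<Omega>" and M: "is_mesh \<Omega> l M"
  obtains P where "M = cube l ` P" "cube_mesh \<Omega> l P"
proof (rule that)
  define P where "P = {p. cube l p \<in> M}"
  have l: "0 < l" and finM: "finite M" and ax: "\<And>Q. Q \<in> M \<Longrightarrow> axis_cube l Q"
    and dj: "pairwise (\<lambda>Q Q'. interior Q \<inter> interior Q' = {}) M"
    and neg: "negligible ((\<Union>M - \<Omega>) \<union> (\<Omega> - \<Union>M))"
    and conf: "pairwise (\<lambda>Q Q'. Q \<inter> Q' = {} \<or> (Q \<inter> Q' face_of Q \<and> Q \<inter> Q' face_of Q')) M"
    using M by (auto simp: is_mesh_def)
  show MP: "M = cube l ` P"
    using ax by (fastforce simp: P_def axis_cube_def cube_def)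
  have op: "open \<Omega>" using \<Omega> by (simp add: lipschitz_domain_def)
  have clM: "closed (\<Union>M)" unfolding MP using finM
    by (intro closed_Union) (auto simp: MP)
  have neg2: "negligible (\<Union>M - \<Omega>)" "negligible (\<Omega> - \<Union>M)"
    using neg by (auto simp: negligible_Un_eq)
  have "interior (\<Union>M) \<subseteq> \<Omega>"
    using interior_subset by (intro lipschitz_domain_absorbs_open[OF \<Omega>]
        open_interior negligible_subset[OF neg2(1)]) blast
  \<comment> \<open>The union of the cells is closed, so this difference is open; being negligible,
    it is empty.\<close>
  moreover have "\<Omega> - \<Union>M = {}"
    using open_not_negligible[of "\<Omega> - \<Union>M"] neg2(2) op clM by blast
  then have "\<Omega> \<subseteq> interior (\<Union>M)" using op by (intro interior_maximal) auto
  ultimately have eq: "\<Omega> = interior (\<Union>M)" by blast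
  have *: "cube l p \<inter> cube l q face_of cube l p" "open_cube l p \<inter> open_cube l q = {}"
    if "p \<in> P" "q \<in> P" "p \<noteq> q" for p q
  proof -
    have ne: "cube l p \<noteq> cube l q" using that(3) cube_inject[OF l] by auto
    show "cube l p \<inter> cube l q face_of cube l p"
      using pairwiseD[OF conf _ _ ne] that by (auto simp: P_def empty_face_of)
    show "open_cube l p \<inter> open_cube l q = {}"
      using pairwiseD[OF dj _ _ ne] that by (auto simp: P_def interior_cube)
  qed
  show "cube_mesh \<Omega> l P"
  proof
    show "0 < l" by (rule l)
    have "inj_on (cube l) P" using cube_inject[OF l] by (auto simp: inj_on_def)
    then show "finite P" using finM MP finite_imageD by blast
    show "\<Omega> = interior (\<Union>p\<in>P. cube l p)" using eq MP by simp
    show "open_cube l p \<inter> open_cube l q = {}" if "p \<in> P" "q \<in> P" "p \<noteq> q" for p q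
      by (rule *(2)[OF that])
    fix p q x i assume pq: "p \<in> P" "q \<in> P" "p \<noteq> q" "x \<in> cube l q"
      "\<And>j. j \<noteq> i \<Longrightarrow> p $ j < x $ j \<and> x $ j < p $ j + l"
    show "q = p + l *\<^sub>R axis i 1" if "x $ i = p $ i + l"
      using cube_neighbour(1)[OF *[OF pq(1-3)] pq(4,5) l that] by blast
    show "q = p - l *\<^sub>R axis i 1" if "x $ i = p $ i"
      using cube_neighbour(2)[OF *[OF pq(1-3)] pq(4,5) l that] by blast
  qed
qed

context cube_mesh
begin

lemma open_\<Omega>: "open \<Omega>"
  by (simp add: \<Omega>_eq)

lemma lebesgue_\<Omega> [simp]: "\<Omega> \<in> sets lebesgue"
  using open_\<Omega> by (simp add: sets_completionI_sets)

lemma \<Omega>_subset: "\<Omega> \<subseteq> (\<Union>p\<in>P. cube l p)"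
  using interior_subset by (auto simp: \<Omega>_eq)

lemma open_cube_subset: "p \<in> P \<Longrightarrow> open_cube l p \<subseteq> \<Omega>"
  unfolding \<Omega>_eq using open_cube_subset_cube by (intro interior_maximal) auto

lemma cell_unique:
  assumes "p \<in> P" "q \<in> P" "x \<in> open_cube l p" "x \<in> cube l q"
  shows "p = q"
proof (rule ccontr)
  assume "p \<noteq> q"
  then have "open_cube l p \<inter> closure (open_cube l q) = {}"
    using disj[OF assms(1,2)] open_Int_closure_eq_empty[OF open_open_cube] by blast
  then show False using assms closure_open_cube[OF l_pos] by blast
qed

lemma AE_open_cube: "AE x in lebesgue_on \<Omega>. \<exists>p\<in>P. x \<in> open_cube l p"
proof -
  have "negligible (\<Union>p\<in>P. cube l p - open_cube l p)"
    using fin negligible_cube_boundary by (intro negligible_Union) auto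
  from AE_lebesgue_on_not_in_negligible[OF this lebesgue_\<Omega>] AE_space
  show ?thesis
  proof eventually_elim
    case (elim x)
    then have "x \<in> \<Omega>" by simp
    then show ?case using elim(1) \<Omega>_subset by blast
  qed
qed

text \<open>The open box spanned by two adjacent cells contains their common open facet and is
  covered by the two closed cells, hence it lies in the interior of the union. Fields supported
  across a shared facet are admissible for this reason.\<close>

lemma double_cell_subset:
  assumes "p \<in> P" "p + l *\<^sub>R axis i 1 \<in> P"
    and "\<And>j. j \<noteq> i \<Longrightarrow> p $ j < x $ j \<and> x $ j < p $ j + l" "p $ i < x $ i" "x $ i < p $ i + 2 * l"
  shows "x \<in> \<Omega>"
proof -
  let ?B = "box p (\<chi> j. p $ j + (if j = i then 2 * l else l))"
  have "?B \<subseteq> cube l p \<union> cube l (p + l *\<^sub>R axis i 1)"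
  proof
    fix y assume "y \<in> ?B"
    then have y: "p $ j < y $ j" "y $ j < p $ j + (if j = i then 2 * l else l)" for j
      by (auto simp: mem_box_cart)
    show "y \<in> cube l p \<union> cube l (p + l *\<^sub>R axis i 1)"
    proof (cases "y $ i \<le> p $ i + l")
      case True
      then have "y \<in> cube l p"
        unfolding mem_cube using y by (metis less_imp_le)
      then show ?thesis by simp
    next
      case False
      have "y \<in> cube l (p + l *\<^sub>R axis i 1)"
        unfolding mem_cube
      proof
        fix j
        show "(p + l *\<^sub>R axis i 1) $ j \<le> y $ j \<and> y $ j \<le> (p + l *\<^sub>R axis i 1) $ j + l"
          using y[of j] False by (cases "j = i") (auto simp: axis_def)
      qed
      then show ?thesis by simp
    qed
  qed
  then have "?B \<subseteq> \<Omega>"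
    unfolding \<Omega>_eq using assms(1,2) by (intro interior_maximal) auto
  moreover have "x \<in> ?B" using assms(3-5) by (auto simp: mem_box_cart)
  ultimately show ?thesis by blast
qed

text \<open>Here x is the midpoint of the upper facet for \<open>\<sigma> = 1\<close> and of the
  lower facet for \<open>\<sigma> = -1\<close>. No other cell contains x, so in a small ball only
  the cell \<open>p\<close> remains and \<open>\<Omega>\<close> looks like a half-space.\<close>

lemma outer_normal_unshared_facet:
  fixes i :: 'd
  assumes p: "p \<in> P" and \<sigma>: "\<sigma> = 1 \<or> \<sigma> = -1" and q: "p + (\<sigma> * l) *\<^sub>R axis i 1 \<notin> P"
  defines "x \<equiv> \<chi> j. p $ j + (if j = i then (1 + \<sigma>) / 2 * l else l / 2)"
  shows "outer_unit_normal \<Omega> x (\<sigma> *\<^sub>R axis i 1)"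
proof -
  have x_nth: "x $ j = p $ j + (if j = i then (1 + \<sigma>) / 2 * l else l / 2)" for j
    by (simp add: x_def)
  have "x \<notin> cube l q" if "q \<in> P" "q \<noteq> p" for q
  proof
    assume "x \<in> cube l q"
    then have "q = p + (\<sigma> * l) *\<^sub>R axis i 1"
      using facet_upper[OF p that(1) that(2)[symmetric], of x i]
        facet_lower[OF p that(1) that(2)[symmetric], of x i] l_pos \<sigma> by (auto simp: x_nth)
    then show False using q that by simp
  qed
  then have "x \<notin> (\<Union>q\<in>P - {p}. cube l q)" by blast
  moreover have "closed (\<Union>q\<in>P - {p}. cube l q)"
    using fin by (intro closed_UN) auto
  ultimately obtain r0 where r0: "0 < r0" "ball x r0 \<inter> (\<Union>q\<in>P - {p}. cube l q) = {}"
    using openE[of "- (\<Union>q\<in>P - {p}. cube l q)" x] by (auto simp: closed_def disjoint_eq_subset_Compl)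
  define r where "r = min r0 (l / 2)"
  have r: "0 < r" using r0 l_pos by (simp add: r_def)
  have dot: "(y - x) \<bullet> (\<sigma> *\<^sub>R axis i 1) = \<sigma> * (y $ i - x $ i)" for y
    by (simp add: inner_axis)
  have near: "\<bar>y $ j - x $ j\<bar> < l / 2" if "y \<in> ball x r" for y j
    using component_le_norm_cart[of "y - x" j] that by (simp add: r_def dist_norm norm_minus_commute)
  have inside: "y \<in> \<Omega>" if "y \<in> ball x r" "(y - x) \<bullet> (\<sigma> *\<^sub>R axis i 1) < 0" for y
  proof -
    have "p $ j < y $ j \<and> y $ j < p $ j + l" for j
    proof -
      have "y $ j - x $ j < l / 2" "- (l / 2) < y $ j - x $ j"
        using near[OF that(1), of j] by linarith+
      then show ?thesis
        using that(2) \<sigma> l_pos unfolding dot by (cases "j = i") (auto simp: x_nth)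
    qed
    then show ?thesis using open_cube_subset[OF p] by (auto simp: mem_open_cube)
  qed
  have outside: "y \<notin> \<Omega>" if "y \<in> ball x r" "(y - x) \<bullet> (\<sigma> *\<^sub>R axis i 1) > 0" for y
  proof -
    have "\<not> (p $ i \<le> y $ i \<and> y $ i \<le> p $ i + l)"
      using that(2) \<sigma> unfolding dot by (auto simp: x_nth)
    then have "y \<notin> cube l p" by (auto simp: mem_cube)
    moreover have "y \<in> ball x r0" using that(1) by (simp add: r_def)
    ultimately show ?thesis using r0(2) \<Omega>_subset by blast
  qed
  have shifted: "x + t *\<^sub>R (\<sigma> *\<^sub>R axis i 1) \<in> ball x r"
      "(x + t *\<^sub>R (\<sigma> *\<^sub>R axis i 1) - x) \<bullet> (\<sigma> *\<^sub>R axis i 1) = t" if "\<bar>t\<bar> < r" for t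
    using that \<sigma> by (auto simp: dist_norm inner_axis)
  have "x \<in> frontier \<Omega>"
    unfolding frontier_straddle
  proof (intro allI impI conjI)
    fix e :: real assume "0 < e"
    define t where "t = min (e / 2) (r / 2)"
    have t: "0 < t" "t < e" "t < r" using \<open>0 < e\<close> r by (auto simp: t_def)
    have tr: "\<bar>- t\<bar> < r" "\<bar>t\<bar> < r" using t by auto
    have "x + (- t) *\<^sub>R (\<sigma> *\<^sub>R axis i 1) \<in> \<Omega>"
      using inside[OF shifted(1)[OF tr(1)], unfolded shifted(2)[OF tr(1)]] t by simp
    moreover have "dist x (x + (- t) *\<^sub>R (\<sigma> *\<^sub>R axis i 1)) < e"
      using t \<sigma> by (auto simp: dist_norm)
    ultimately show "\<exists>y\<in>\<Omega>. dist x y < e" by blast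
    have "x + t *\<^sub>R (\<sigma> *\<^sub>R axis i 1) \<notin> \<Omega>"
      using outside[OF shifted(1)[OF tr(2)], unfolded shifted(2)[OF tr(2)]] t by simp
    moreover have "dist x (x + t *\<^sub>R (\<sigma> *\<^sub>R axis i 1)) < e"
      using t \<sigma> by (auto simp: dist_norm)
    ultimately show "\<exists>y. y \<notin> \<Omega> \<and> dist x y < e" by blast
  qed
  moreover have "norm (\<sigma> *\<^sub>R axis i 1 :: real^'d) = 1" using \<sigma> by auto
  moreover have "((y - x) \<bullet> (\<sigma> *\<^sub>R axis i 1) < - \<epsilon> * norm (y - x) \<longrightarrow> y \<in> \<Omega>) \<and>
      ((y - x) \<bullet> (\<sigma> *\<^sub>R axis i 1) > \<epsilon> * norm (y - x) \<longrightarrow> y \<notin> \<Omega>)"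
    if "0 < \<epsilon>" "y \<in> ball x r" for \<epsilon> y
  proof -
    have "0 \<le> \<epsilon> * norm (y - x)" using that by simp
    then show ?thesis using inside[OF that(2)] outside[OF that(2)] by auto
  qed
  ultimately show ?thesis
    unfolding outer_unit_normal_def using r by blast
qed

end

section \<open>Integration by parts on a cell\<close>

abbreviation partial_deriv :: "'d \<Rightarrow> (real^'d \<Rightarrow> real) \<Rightarrow> real^'d \<Rightarrow> real" where
  "partial_deriv i f x \<equiv> frechet_derivative f (at x) (axis i 1)"

lemma
  fixes f :: "real^'d \<Rightarrow> real"
  assumes "C1 f"
  shows has_partial_deriv: "((\<lambda>t. f (x + t *\<^sub>R axis i 1)) has_real_derivative partial_deriv i f x) (at 0)"
    and continuous_partial_deriv: "continuous_on S (partial_deriv i f)"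
    and frechet_derivative_sum_partial_deriv:
      "frechet_derivative f (at x) v = (\<Sum>j\<in>UNIV. partial_deriv j f x * v $ j)"
proof -
  obtain D where D: "\<And>x. (f has_derivative blinfun_apply (D x)) (at x)" "continuous_on UNIV D"
    using assms unfolding C1_def by blast
  have fr: "frechet_derivative f (at x) = D x" for x
    using D(1) by (metis frechet_derivative_at)
  have "((\<lambda>t::real. x + t *\<^sub>R axis i 1) has_derivative (\<lambda>t. t *\<^sub>R axis i 1)) (at 0)"
    by (auto intro!: derivative_eq_intros)
  moreover have "(f has_derivative D x) (at (x + (0::real) *\<^sub>R axis i 1))"
    using D by simp
  ultimately have "((\<lambda>t::real. f (x + t *\<^sub>R axis i 1)) has_derivative (\<lambda>t. D x (t *\<^sub>R axis i 1))) (at 0)"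
    by (rule has_derivative_compose)
  then show "((\<lambda>t. f (x + t *\<^sub>R axis i 1)) has_real_derivative partial_deriv i f x) (at 0)"
    by (simp add: fr has_field_derivative_def blinfun.scaleR_right mult_commute_abs)
  show "continuous_on S (partial_deriv i f)"
    unfolding fr by (intro continuous_intros continuous_on_subset[OF D(2)]) auto
  have "D x v = D x (\<Sum>j\<in>UNIV. v $ j *\<^sub>R axis j 1)"
    by (simp add: basis_expansion scalar_mult_eq_scaleR[symmetric])
  then show "frechet_derivative f (at x) v = (\<Sum>j\<in>UNIV. partial_deriv j f x * v $ j)"
    by (simp add: fr blinfun.sum_right blinfun.scaleR_right mult.commute)
qed

lemma DERIV_shift_0:
  fixes f :: "'a::real_normed_vector \<Rightarrow> real"
  assumes "\<And>x. ((\<lambda>t. f (x + t *\<^sub>R e)) has_real_derivative f' x) (at 0)"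
  shows "((\<lambda>t. f (x + t *\<^sub>R e)) has_real_derivative f' (x + r *\<^sub>R e)) (at r)"
proof -
  have "((\<lambda>t. f ((x + r *\<^sub>R e) + t *\<^sub>R e)) has_real_derivative f' (x + r *\<^sub>R e)) (at 0)"
    by (rule assms)
  then have "((\<lambda>t. f (x + (r + t) *\<^sub>R e)) has_real_derivative f' (x + r *\<^sub>R e)) (at 0)"
    by (simp add: scaleR_left_distrib add.assoc)
  then show ?thesis
    using DERIV_at_within_shift[of "\<lambda>t. f (x + t *\<^sub>R e)" "f' (x + r *\<^sub>R e)" r 0 UNIV]
    by simp
qed

lemma lebesgue_on_integral_lborel:
  fixes f :: "'a::euclidean_space \<Rightarrow> real"
  assumes "S \<in> sets borel" "f \<in> borel_measurable borel"
  shows "(LINT x|lebesgue_on S. f x) = (LINT x|lborel. indicator S x * f x)"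
proof -
  have "(LINT x|lebesgue_on S. f x) = (LINT x|lebesgue. indicator S x * f x)"
    using assms by (subst integral_restrict_space) (auto simp: sets_completionI_sets)
  also have "\<dots> = (LINT x|lborel. indicator S x * f x)"
    using assms by (intro integral_completion) auto
  finally show ?thesis .
qed

lemma AE_lborel_not_in_negligible:
  assumes "negligible N" "N \<in> sets borel"
  shows "AE x in lborel. x \<notin> N"
  using assms by (intro AE_not_in) (auto simp: negligible_iff_null_sets null_sets_completion_iff)

text \<open>The function \<open>k\<close>, cut off outside the closed cell, stays Lipschitz in direction \<open>i\<close>.\<close>

lemma integral_cell_derivative_eq_0:
  fixes k k' :: "real^'d \<Rightarrow> real"
  assumes l: "0 < l" and k: "continuous_on UNIV k" and k': "continuous_on UNIV k'"
    and deriv: "\<And>x. ((\<lambda>t. k (x + t *\<^sub>R axis i 1)) has_real_derivative k' x) (at 0)"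
    and zero: "\<And>x. x \<in> cube l p \<Longrightarrow> x $ i = p $ i \<or> x $ i = p $ i + l \<Longrightarrow> k x = 0"
  shows "(LINT x|lebesgue_on (open_cube l p). k' x) = 0"
proof -
  define e where "e = (axis i 1 :: real^'d)"
  define f where "f x = indicator (cube l p) x * k x" for x
  have ei: "e $ i = 1" and ej: "\<And>j. j \<noteq> i \<Longrightarrow> e $ j = 0" by (auto simp: e_def axis_def)
  have "bounded (k' ` cube l p)"
    by (intro compact_imp_bounded compact_continuous_image continuous_on_subset[OF k']) auto
  then obtain C where C: "\<And>x. x \<in> cube l p \<Longrightarrow> \<bar>k' x\<bar> \<le> C"
    unfolding bounded_iff by auto
  have mk: "k \<in> borel_measurable borel" "k' \<in> borel_measurable borel"
    using k k' by (auto intro: borel_measurable_continuous_onI)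
  have "(LINT x|lborel. indicator (open_cube l p) x * k' x) = 0"
  proof (rule integral_directional_derivative_eq_0[where f = f and e = e and C = C])
    have "integrable lborel (\<lambda>x. indicator (cube l p) x *\<^sub>R k x)"
      by (rule borel_integrable_compact) (auto intro: continuous_on_subset[OF k])
    then show "integrable lborel f" by (simp add: f_def[abs_def])
    show "bounded {x. f x \<noteq> 0}"
      by (rule bounded_subset[OF compact_imp_bounded[OF compact_cube[of l p]]]) (auto simp: f_def indicator_def)
    show "(\<lambda>x. indicator (open_cube l p) x * k' x) \<in> borel_measurable borel"
      using mk by (intro borel_measurable_times borel_measurable_indicator) auto
    show "\<bar>f (x + t *\<^sub>R e) - f x\<bar> \<le> C * \<bar>t\<bar>" for x t
    proof (cases "\<forall>j. j \<noteq> i \<longrightarrow> p $ j \<le> x $ j \<and> x $ j \<le> p $ j + l")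
      case False
      then obtain j where j: "j \<noteq> i" "\<not> (p $ j \<le> x $ j \<and> x $ j \<le> p $ j + l)" by blast
      then have "x + t *\<^sub>R e \<notin> cube l p" for t
        unfolding mem_cube by (intro notI) (auto dest!: spec[of _ j] simp: ej)
      from this[of t] this[of 0] have z: "f (x + t *\<^sub>R e) = 0" "f x = 0" by (auto simp: f_def)
      have "p \<in> cube l p" using l by (simp add: mem_cube)
      then have "0 \<le> C" using C[of p] by linarith
      then show ?thesis using z by simp
    next
      case True
      \<comment> \<open>Along a line that meets the cell, \<open>f\<close> equals \<open>g\<close>
        composed with clamping to the cell, because \<open>k\<close> vanishes where the line enters
        and leaves. Clamping does not increase distances, so the mean value bound inside the cell
        becomes a global Lipschitz bound.\<close>
      define cl where "cl r = max (p $ i) (min r (p $ i + l))" for r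
      define g where "g r = k (x + (r - x $ i) *\<^sub>R e)" for r
      have line: "x + (r - x $ i) *\<^sub>R e \<in> cube l p \<longleftrightarrow> p $ i \<le> r \<and> r \<le> p $ i + l" for r
      proof -
        have "(x + (r - x $ i) *\<^sub>R e) $ j = (if j = i then r else x $ j)" for j
          by (simp add: ei ej)
        then show ?thesis
          unfolding mem_cube using True by metis
      qed
      have f_line: "f (x + (r - x $ i) *\<^sub>R e) = g (cl r)" for r
      proof (cases "p $ i \<le> r \<and> r \<le> p $ i + l")
        case True
        then show ?thesis using line[of r] by (simp add: f_def cl_def g_def)
      next
        case False
        then have "cl r = p $ i \<or> cl r = p $ i + l" "p $ i \<le> cl r" "cl r \<le> p $ i + l"
          using l by (auto simp: cl_def)
        then have "g (cl r) = 0"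
          unfolding g_def using line[of "cl r"] by (intro zero) (auto simp: ei)
        then show ?thesis using False line[of r] by (simp add: f_def)
      qed
      have dg: "(g has_real_derivative k' (x + (r - x $ i) *\<^sub>R e)) (at r)" for r
      proof -
        have "((\<lambda>t. k (x + t *\<^sub>R e)) has_real_derivative k' (x + (r - x $ i) *\<^sub>R e)) (at (r - x $ i))"
          unfolding e_def by (rule DERIV_shift_0[OF deriv])
        moreover have "((\<lambda>r. r - x $ i) has_real_derivative 1) (at r)"
          by (auto intro!: derivative_eq_intros)
        ultimately show ?thesis
          unfolding g_def[abs_def] by (rule DERIV_chain2[THEN DERIV_cong]) simp
      qed
      have lip: "\<bar>g b - g a\<bar> \<le> C * (b - a)" if "p $ i \<le> a" "a \<le> b" "b \<le> p $ i + l" for a b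
      proof (cases "a < b")
        case True
        obtain z where z: "a < z" "z < b" "g b - g a = (b - a) * k' (x + (z - x $ i) *\<^sub>R e)"
          using MVT2[OF True dg] by blast
        have "\<bar>k' (x + (z - x $ i) *\<^sub>R e)\<bar> \<le> C"
          using z that by (intro C) (simp add: line)
        then show ?thesis using z True by (simp add: abs_mult mult.commute mult_right_mono)
      qed (use that in auto)
      have lip2: "\<bar>g (cl b) - g (cl a)\<bar> \<le> C * \<bar>b - a\<bar>" for a b
      proof -
        have "p \<in> cube l p" using l by (simp add: mem_cube)
        then have C0: "0 \<le> C" using C[of p] by linarith
        have r: "p $ i \<le> cl r" "cl r \<le> p $ i + l" for r using l by (auto simp: cl_def)
        have "\<bar>g (cl b) - g (cl a)\<bar> \<le> C * \<bar>cl b - cl a\<bar>"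
          using lip[of "cl a" "cl b"] lip[of "cl b" "cl a"] r by (cases "cl a \<le> cl b") (auto simp: abs_minus_commute)
        also have "\<dots> \<le> C * \<bar>b - a\<bar>"
          using C0 by (intro mult_left_mono) (auto simp: cl_def)
        finally show ?thesis .
      qed
      have "f (x + t *\<^sub>R e) = g (cl (x $ i + t))" "f x = g (cl (x $ i))"
        using f_line[of "x $ i + t"] f_line[of "x $ i"] by simp_all
      then show ?thesis using lip2[of "x $ i + t" "x $ i"] by simp
    qed
    have "AE x in lborel. x \<notin> cube l p - open_cube l p"
      using negligible_cube_boundary by (intro AE_lborel_not_in_negligible) auto
    then show "AE x in lborel. ((\<lambda>t. f (x + t *\<^sub>R e)) has_real_derivative indicator (open_cube l p) x * k' x) (at 0)"
    proof eventually_elim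
      case (elim x)
      have cont: "continuous_on UNIV (\<lambda>t. x + t *\<^sub>R e)" by (intro continuous_intros)
      show ?case
      proof (cases "x \<in> open_cube l p")
        case True
        have op: "open ((\<lambda>t. x + t *\<^sub>R e) -` open_cube l p)"
          using cont by (intro open_vimage) auto
        have "((\<lambda>t. f (x + t *\<^sub>R e)) has_real_derivative k' x) (at 0)"
          by (rule has_field_derivative_transform_within_open[OF deriv[folded e_def] op])
            (use True open_cube_subset_cube in \<open>auto simp: f_def indicator_def\<close>)
        then show ?thesis using True by simp
      next
        case False
        then have x: "x \<notin> cube l p" using elim by simp
        have op: "open ((\<lambda>t. x + t *\<^sub>R e) -` (- cube l p))"
          using cont by (intro open_vimage) (auto simp: open_Compl)
        have "((\<lambda>t. f (x + t *\<^sub>R e)) has_real_derivative 0) (at 0)"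
          by (rule has_field_derivative_transform_within_open[OF DERIV_const[of 0] op])
            (use x in \<open>auto simp: f_def\<close>)
        then show ?thesis using False by simp
      qed
    qed
  qed
  then show ?thesis
    by (subst lebesgue_on_integral_lborel) (use mk in auto)
qed

lemma partial_deriv_eq_0:
  fixes f :: "real^'d \<Rightarrow> real"
  assumes "C1 f" "open U" "x \<in> U" "\<And>y. y \<in> U \<Longrightarrow> f y = 0"
  shows "partial_deriv i f x = 0"
proof -
  have "open ((\<lambda>t. x + t *\<^sub>R axis i 1) -` U)"
    using assms(2) by (intro open_vimage continuous_intros)
  from has_field_derivative_transform_within_open[OF has_partial_deriv[OF assms(1)] this]
  have "((\<lambda>t. 0) has_real_derivative partial_deriv i f x) (at 0)"
    using assms by auto
  then show ?thesis by (metis DERIV_const DERIV_unique)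
qed

text \<open>The support fits into one large open cube; there \<open>\<psi>\<close> vanishes on the
  boundary and \<open>integral_cell_derivative_eq_0\<close> applies.\<close>

lemma integral_partial_deriv_C1c_eq_0:
  fixes \<psi> :: "real^'d \<Rightarrow> real"
  assumes \<psi>: "\<psi> \<in> C1c \<Omega>" and \<Omega>: "open \<Omega>"
  shows "(LINT x|lebesgue_on \<Omega>. partial_deriv i \<psi> x) = 0"
proof -
  define K where "K = closure {x. \<psi> x \<noteq> 0}"
  have C: "C1 \<psi>" and K: "compact K" "K \<subseteq> \<Omega>"
    using assms by (auto simp: C1c_eq_C1 K_def)
  have K0: "\<psi> x = 0" if "x \<notin> K" for x
    using closure_subset[of "{x. \<psi> x \<noteq> 0}"] that by (auto simp: K_def)
  have zero: "partial_deriv i \<psi> x = 0" if "x \<notin> K" for x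
    by (rule partial_deriv_eq_0[OF C, of "- K"]) (use that K K0 in \<open>auto simp: compact_imp_closed open_Compl\<close>)
  obtain r where r: "0 < r" "\<And>x. x \<in> K \<Longrightarrow> norm x < r"
    using compact_imp_bounded[OF K(1)] unfolding bounded_pos_less by blast
  define p :: "real^'d" where "p = (\<chi> j. - r)"
  have "x \<in> open_cube (2 * r) p" if "x \<in> K" for x
    unfolding mem_open_cube
  proof
    fix j
    have "\<bar>x $ j\<bar> < r" using component_le_norm_cart[of x j] r(2)[OF that] by linarith
    then show "p $ j < x $ j \<and> x $ j < p $ j + 2 * r" by (auto simp: p_def)
  qed
  then have sub: "K \<subseteq> open_cube (2 * r) p" by blast
  have "(LINT x|lebesgue_on (open_cube (2 * r) p). partial_deriv i \<psi> x) = 0"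
  proof (rule integral_cell_derivative_eq_0)
    show "\<psi> x = 0" if "x \<in> cube (2 * r) p" "x $ i = p $ i \<or> x $ i = p $ i + 2 * r" for x
    proof -
      have "x \<notin> open_cube (2 * r) p" using that(2) by (auto simp: mem_open_cube intro!: exI[of _ i])
      then show ?thesis using sub K0 by blast
    qed
  qed (use r C in \<open>auto intro: C1_imp_continuous continuous_partial_deriv has_partial_deriv\<close>)
  moreover have "(\<lambda>x. indicator \<Omega> x * partial_deriv i \<psi> x) =
      (\<lambda>x. indicator (open_cube (2 * r) p) x * partial_deriv i \<psi> x)"
  proof
    show "indicator \<Omega> x * partial_deriv i \<psi> x = indicator (open_cube (2 * r) p) x * partial_deriv i \<psi> x" for x
      using zero[of x] sub K(2) by (cases "x \<in> K") (auto simp: indicator_def)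
  qed
  moreover have "partial_deriv i \<psi> \<in> borel_measurable borel"
    by (intro borel_measurable_continuous_onI continuous_partial_deriv[OF C])
  ultimately show ?thesis
    using \<Omega> by (simp add: lebesgue_on_integral_lborel)
qed

lemma integrable_lebesgue_on_subset:
  fixes f :: "'a::euclidean_space \<Rightarrow> real"
  assumes "integrable (lebesgue_on S) f" "T \<subseteq> S" "S \<in> sets lebesgue" "T \<in> sets lebesgue"
  shows "integrable (lebesgue_on T) f"
proof -
  have "integrable lebesgue (\<lambda>x. indicator S x *\<^sub>R f x)"
    using assms by (simp add: integrable_restrict_space)
  then have "integrable lebesgue (\<lambda>x. indicator T x *\<^sub>R (indicator S x *\<^sub>R f x))"
    by (rule integrable_mult_indicator[OF assms(4)])
  moreover have "(\<lambda>x. indicator T x *\<^sub>R (indicator S x *\<^sub>R f x)) = (\<lambda>x. indicator T x *\<^sub>R f x)"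
    using assms(2) by (auto simp: indicator_def fun_eq_iff)
  ultimately show ?thesis
    using assms by (simp add: integrable_restrict_space)
qed

lemma lebesgue_open_cube [simp]: "open_cube l p \<in> sets lebesgue"
  by (simp add: sets_completionI_sets borel_open)

lemma lebesgue_cube [simp]: "cube l p \<in> sets lebesgue"
  by (simp add: sets_completionI_sets borel_closed)

lemma continuous_integrable_open_cube:
  fixes h :: "real^'d \<Rightarrow> real"
  assumes "continuous_on UNIV h" shows "integrable (lebesgue_on (open_cube l p)) h"
proof (rule integrable_lebesgue_on_subset[OF _ open_cube_subset_cube])
  show "integrable (lebesgue_on (cube l p)) h"
    unfolding cube_def
    by (rule continuous_imp_integrable[OF continuous_on_subset[OF assms]]) auto
qed auto

text \<open>Only the facet \<open>x $ i = b\<close> contributes a boundary term; it is expressed through the integral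
  of the \<open>i\<close>-th derivative of \<open>\<psi>\<close>.\<close>

lemma integral_rt0_gradient_cell:
  fixes \<psi> :: "real^'d \<Rightarrow> real"
  assumes l: "0 < l" and \<psi>: "C1 \<psi>"
    and zero: "\<And>x j. x \<in> cube l p \<Longrightarrow> x $ j = p $ j \<or> x $ j = p $ j + l \<Longrightarrow>
      \<not> (j = i \<and> x $ j = b) \<Longrightarrow> \<psi> x = 0"
  shows "(LINT x|lebesgue_on (open_cube l p). frechet_derivative \<psi> (at x) (rt0 a c x))
    = (a $ i + c $ i * b) * (LINT x|lebesgue_on (open_cube l p). partial_deriv i \<psi> x)
      - (\<Sum>j\<in>UNIV. c $ j) * (LINT x|lebesgue_on (open_cube l p). \<psi> x)"
proof -
  define S where "S = open_cube l p"
  note cont = C1_imp_continuous[OF \<psi>] continuous_partial_deriv[OF \<psi>]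
  \<comment> \<open>The i-th component is shifted by a constant so that it vanishes at x_i = b. The
    shifted field then has no boundary contribution at all, and the constant taken away multiplies
    the integral of the i-th derivative of \<open>\<psi>\<close>.\<close>
  define a' where "a' j = (if j = i then - c $ i * b else a $ j)" for j
  have part: "(LINT x|lebesgue_on S. partial_deriv j \<psi> x * (a' j + c $ j * x $ j) + \<psi> x * c $ j) = 0" for j
    unfolding S_def
  proof (rule integral_cell_derivative_eq_0[OF l, where k = "\<lambda>x. \<psi> x * (a' j + c $ j * x $ j)" and i = j])
    show "\<psi> x * (a' j + c $ j * x $ j) = 0"
      if "x \<in> cube l p" "x $ j = p $ j \<or> x $ j = p $ j + l" for x
      using zero[OF that] by (cases "j = i \<and> x $ j = b") (auto simp: a'_def)
    show "((\<lambda>t. \<psi> (x + t *\<^sub>R axis j 1) * (a' j + c $ j * (x + t *\<^sub>R axis j 1) $ j)) has_real_derivative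
       partial_deriv j \<psi> x * (a' j + c $ j * x $ j) + \<psi> x * c $ j) (at 0)" for x
      by (auto intro!: derivative_eq_intros has_partial_deriv[OF \<psi>])
  qed (intro continuous_intros cont)+
  have eq: "frechet_derivative \<psi> (at x) (rt0 a c x) =
      (\<Sum>j\<in>UNIV. partial_deriv j \<psi> x * (a' j + c $ j * x $ j) + \<psi> x * c $ j)
      + (a $ i + c $ i * b) * partial_deriv i \<psi> x - (\<Sum>j\<in>UNIV. c $ j) * \<psi> x" for x
  proof -
    have "(\<Sum>j\<in>UNIV. partial_deriv j \<psi> x * (a' j + c $ j * x $ j)) + (a $ i + c $ i * b) * partial_deriv i \<psi> x
      = (\<Sum>j\<in>UNIV. partial_deriv j \<psi> x * (a' j + c $ j * x $ j) + (if j = i then (a $ i + c $ i * b) * partial_deriv i \<psi> x else 0))"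
      by (simp add: sum.distrib)
    also have "\<dots> = (\<Sum>j\<in>UNIV. partial_deriv j \<psi> x * (a $ j + c $ j * x $ j))"
      by (intro sum.cong refl) (simp add: a'_def ring_distribs)
    also have "\<dots> = frechet_derivative \<psi> (at x) (rt0 a c x)"
      by (subst frechet_derivative_sum_partial_deriv[OF \<psi>, of x "rt0 a c x"]) (simp add: rt0_def)
    finally have "frechet_derivative \<psi> (at x) (rt0 a c x) =
      (\<Sum>j\<in>UNIV. partial_deriv j \<psi> x * (a' j + c $ j * x $ j)) + (a $ i + c $ i * b) * partial_deriv i \<psi> x"
      by (rule sym)
    moreover have "(\<Sum>j\<in>UNIV. \<psi> x * c $ j) = (\<Sum>j\<in>UNIV. c $ j) * \<psi> x"
      by (simp add: sum_distrib_left[symmetric])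
    ultimately show ?thesis
      unfolding sum.distrib by linarith
  qed
  define G where "G j x = partial_deriv j \<psi> x * (a' j + c $ j * x $ j) + \<psi> x * c $ j" for j x
  have "(LINT x|lebesgue_on S. frechet_derivative \<psi> (at x) (rt0 a c x)) =
     (LINT x|lebesgue_on S. (\<Sum>j\<in>UNIV. G j x)
      + (a $ i + c $ i * b) * partial_deriv i \<psi> x - (\<Sum>j\<in>UNIV. c $ j) * \<psi> x)"
    by (simp only: eq G_def)
  also have "\<dots> = (\<Sum>j\<in>UNIV. LINT x|lebesgue_on S. G j x)
      + (a $ i + c $ i * b) * (LINT x|lebesgue_on S. partial_deriv i \<psi> x)
      - (\<Sum>j\<in>UNIV. c $ j) * (LINT x|lebesgue_on S. \<psi> x)"
  proof -
    have 1: "integrable (lebesgue_on S) (G j)" for j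
      unfolding S_def G_def[abs_def] by (intro continuous_integrable_open_cube continuous_intros cont)
    have 2: "integrable (lebesgue_on S) \<psi>" "integrable (lebesgue_on S) (partial_deriv i \<psi>)"
      unfolding S_def by (intro continuous_integrable_open_cube cont)+
    show ?thesis
      by (intro has_bochner_integral_integral_eq has_bochner_integral_diff has_bochner_integral_add
          has_bochner_integral_sum has_bochner_integral_mult_right has_bochner_integral_integrable 1 2)
  qed
  also have "(\<Sum>j\<in>UNIV. LINT x|lebesgue_on S. G j x) = 0"
    unfolding G_def using part by simp
  finally show ?thesis
    by (simp add: S_def)
qed

section \<open>Test functions supported in one cell\<close>

lemma ramp_left: "0 < e \<Longrightarrow> 4 * e \<le> l \<Longrightarrow> t \<le> e \<Longrightarrow> ramp l e t = 0"
  by (simp add: ramp_def)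

lemma prod_cutoff_bounds:
  assumes "0 < e"
  shows "0 \<le> (\<Prod>j\<in>J. cutoff l e (f j))" "(\<Prod>j\<in>J. cutoff l e (f j)) \<le> 1"
  using cutoff_nonneg[OF assms] cutoff_le_1[OF assms] by (auto intro: prod_nonneg prod_le_1)

lemma C1_cutoff_nth: "0 < e \<Longrightarrow> C1 (\<lambda>x::real^'d. cutoff l e (x $ j - c))"
  by (rule C1_compose[OF C1_cutoff]) (auto intro: C1_diff C1_nth)

lemma C1_stretch_nth: "0 < e \<Longrightarrow> 4 * e \<le> l \<Longrightarrow> C1 (\<lambda>x::real^'d. stretch l e (x $ j - c))"
  by (rule C1_compose[OF C1_stretch]) (auto intro: C1_diff C1_nth)

text \<open>Testing with polynomials that approximate the sign of \<open>G\<close>, cut off near the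
  boundary of the cell, gives in the limit that the integral of \<open>\<bar>G\<bar>\<close> is
  zero.\<close>

lemma fundamental_lemma_cell:
  fixes G :: "real^'d \<Rightarrow> real"
  assumes l: "0 < l" and G: "integrable (lebesgue_on (open_cube l p)) G"
    and zero: "\<And>\<psi>. \<psi> \<in> C1c (open_cube l p) \<Longrightarrow> (LINT x|lebesgue_on (open_cube l p). G x * \<psi> x) = 0"
  shows "AE x in lebesgue_on (open_cube l p). G x = 0"
proof -
  define S where "S = open_cube l p"
  have mG: "G \<in> borel_measurable (lebesgue_on S)" using G by (auto simp: S_def)
  define s where "s x = (if x \<in> S then sgn (G x) else 0)" for x
  have "(\<lambda>x. sgn (G x)) \<in> borel_measurable (lebesgue_on S)"
    by (rule measurable_compose[OF mG borel_measurable_sgn])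
  then have "s \<in> borel_measurable lebesgue"
    unfolding s_def by (subst borel_measurable_if) (auto simp: S_def)
  then have sm: "s \<in> borel_measurable (lebesgue_on (cube l p))" by (rule measurable_restrict_space1)
  have sb: "\<bar>s x\<bar> \<le> 1" for x by (auto simp: s_def sgn_if)
  obtain q where q: "\<And>n. real_polynomial_function (q n)"
      "\<And>n x. x \<in> cube l p \<Longrightarrow> \<bar>q n x\<bar> \<le> 1"
      "AE x in lebesgue_on (cube l p). (\<lambda>n. q n x) \<longlonglongrightarrow> s x"
    by (rule polynomial_AE_approximation[OF compact_cube sm sb]) (rule that, assumption+)
  define e where "e n = l / (4 * real (Suc n))" for n
  have e: "0 < e n" "e \<longlonglongrightarrow> 0" for n
  proof -
    have "(\<lambda>n. (l / 4) * inverse (real (Suc n))) \<longlonglongrightarrow> (l / 4) * 0"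
      by (intro tendsto_intros LIMSEQ_inverse_real_of_nat)
    then show "e \<longlonglongrightarrow> 0" by (simp add: e_def[abs_def] field_simps)
  qed (use l in \<open>simp add: e_def\<close>)
  define \<psi> where "\<psi> n x = q n x * (\<Prod>j\<in>UNIV. cutoff l (e n) (x $ j - p $ j))" for n and x :: "real^'d"
  have \<psi>: "\<psi> n \<in> C1c S" for n
  proof (rule C1cI)
    show "C1 (\<psi> n)"
      unfolding \<psi>_def[abs_def] by (intro C1_mult C1_real_polynomial_function q C1_prod C1_cutoff_nth e)
    show "compact (cbox (\<chi> j. p $ j + e n) (\<chi> j. p $ j + l - e n))" by simp
    show "cbox (\<chi> j. p $ j + e n) (\<chi> j. p $ j + l - e n) \<subseteq> S"
    proof
      fix x assume "x \<in> cbox (\<chi> j. p $ j + e n) (\<chi> j. p $ j + l - e n)"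
      then have "p $ j + e n \<le> x $ j \<and> x $ j \<le> p $ j + l - e n" for j by (simp add: mem_box_cart)
      then have "p $ j < x $ j \<and> x $ j < p $ j + l" for j using e(1)[of n] by (smt (verit))
      then show "x \<in> S" by (simp add: S_def mem_open_cube)
    qed
    fix x assume "x \<notin> cbox (\<chi> j. p $ j + e n) (\<chi> j. p $ j + l - e n)"
    then obtain j where "\<not> (p $ j + e n \<le> x $ j \<and> x $ j \<le> p $ j + l - e n)"
      by (auto simp: mem_box_cart)
    then have "x $ j - p $ j \<le> e n \<or> l - e n \<le> x $ j - p $ j" by linarith
    then have "cutoff l (e n) (x $ j - p $ j) = 0"
      using cutoff_left[OF e(1)] cutoff_right[OF e(1)] by blast
    then show "\<psi> n x = 0" unfolding \<psi>_def by (auto intro: prod_zero)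
  qed
  have "(\<lambda>n. LINT x|lebesgue_on S. G x * \<psi> n x) \<longlonglongrightarrow> (LINT x|lebesgue_on S. \<bar>G x\<bar>)"
  proof (rule integral_dominated_convergence[where w = "\<lambda>x. \<bar>G x\<bar>"])
    show "AE x in lebesgue_on S. (\<lambda>n. G x * \<psi> n x) \<longlonglongrightarrow> \<bar>G x\<bar>"
    proof -
      have "AE x in lebesgue_on S. (\<lambda>n. q n x) \<longlonglongrightarrow> s x"
        using q(3) open_cube_subset_cube[of l p]
        by (auto simp: AE_restrict_space_iff S_def elim!: eventually_mono)
      then show ?thesis
        using AE_space
      proof eventually_elim
        case (elim x)
        then have x: "x \<in> S" by simp
        have "(\<lambda>n. \<Prod>j\<in>UNIV. cutoff l (e n) (x $ j - p $ j)) \<longlonglongrightarrow> (\<Prod>j\<in>(UNIV::'d set). 1)"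
          using x by (intro tendsto_prod tendsto_cutoff e) (auto simp: S_def mem_open_cube algebra_simps)
        then have "(\<lambda>n. G x * \<psi> n x) \<longlonglongrightarrow> G x * (s x * 1)"
          unfolding \<psi>_def using elim(1) by (intro tendsto_intros) auto
        moreover have "G x * (s x * 1) = \<bar>G x\<bar>" using x by (simp add: s_def sgn_if)
        ultimately show ?case by simp
      qed
    qed
    show "AE x in lebesgue_on S. norm (G x * \<psi> n x) \<le> \<bar>G x\<bar>" for n
      using AE_space
    proof eventually_elim
      case (elim x)
      then have "x \<in> cube l p" using open_cube_subset_cube by (auto simp: S_def)
      moreover have "\<bar>\<Prod>j\<in>UNIV. cutoff l (e n) (x $ j - p $ j)\<bar> \<le> 1"
        using prod_cutoff_bounds[OF e(1)] by (subst abs_of_nonneg)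
      ultimately have "\<bar>q n x\<bar> * \<bar>\<Prod>j\<in>UNIV. cutoff l (e n) (x $ j - p $ j)\<bar> \<le> 1"
        using q(2) by (intro mult_le_one) auto
      then show ?case by (simp add: \<psi>_def abs_mult mult_left_le)
    qed
    show "(\<lambda>x. G x * \<psi> n x) \<in> borel_measurable (lebesgue_on S)" for n
    proof -
      have "\<psi> n \<in> borel_measurable (lebesgue_on S)"
        using \<psi>[of n] by (intro continuous_imp_measurable_on_sets_lebesgue)
          (auto simp: C1c_eq_C1 S_def intro: C1_imp_continuous)
      then show ?thesis using mG by simp
    qed
  qed (use G mG in \<open>auto simp: S_def\<close>)
  moreover have "(LINT x|lebesgue_on S. G x * \<psi> n x) = 0" for n
    using zero \<psi>[of n] by (simp add: S_def)
  ultimately have "(LINT x|lebesgue_on S. \<bar>G x\<bar>) = 0"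
    by (simp add: LIMSEQ_const_iff)
  then have "AE x in lebesgue_on S. \<bar>G x\<bar> = 0"
    using G by (subst (asm) integral_nonneg_eq_0_iff_AE) (auto simp: S_def)
  then show ?thesis unfolding S_def by (simp only: abs_eq_0)
qed

text \<open>The exceptional set \<open>S - C\<close> is open and negligible, hence empty. It turns
  almost everywhere bounds on continuous maps into pointwise bounds.\<close>

lemma AE_open_imp_subset_closed:
  assumes "open S" "closed C" "AE x in lebesgue_on S. x \<in> C"
  shows "S \<subseteq> C"
proof -
  have S: "S \<in> sets lebesgue" using assms(1) by (simp add: sets_completionI_sets)
  have "AE x in lebesgue. x \<notin> S - C"
    using assms(3) S by (auto simp: AE_restrict_space_iff elim!: eventually_mono)
  moreover have "S - C \<in> sets lebesgue"
    using assms S by (intro sets.Diff) (auto simp: sets_completionI_sets borel_closed)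
  ultimately have "negligible (S - C)"
    by (simp add: negligible_iff_null_sets AE_iff_null_sets)
  then have "S - C = {}"
    using open_not_negligible[of "S - C"] assms by blast
  then show ?thesis by blast
qed

context cube_mesh
begin

section \<open>Bump functions attached to shared facets\<close>

definition eps :: "nat \<Rightarrow> real" where
  "eps n = l / (4 * real (Suc n))"

lemma eps: "0 < eps n" "4 * eps n \<le> l" "eps \<longlonglongrightarrow> 0"
proof -
  show "0 < eps n" using l_pos by (simp add: eps_def)
  show "4 * eps n \<le> l" using l_pos by (simp add: eps_def divide_le_eq)
  have "(\<lambda>n. (l / 4) * inverse (real (Suc n))) \<longlonglongrightarrow> (l / 4) * 0"
    by (intro tendsto_intros LIMSEQ_inverse_real_of_nat)
  then show "eps \<longlonglongrightarrow> 0" by (simp add: eps_def[abs_def] field_simps)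
qed

text \<open>A flattened hat function of the facet between the cell at \<open>p\<close> and its
  neighbour at \<open>p + l *\<^sub>R axis i 1\<close>: along axis i it rises from 0 to 1 in the
  first cell and falls back to 0 in the second. This is the profile of the Raviart-Thomas basis
  field of that facet, made smooth and cut off in the other directions.\<close>

definition bump :: "nat \<Rightarrow> real^'d \<Rightarrow> 'd \<Rightarrow> real^'d \<Rightarrow> real" where
  "bump n p i x = (\<Prod>j\<in>UNIV - {i}. cutoff l (eps n) (x $ j - p $ j)) *
     ((stretch l (eps n) (x $ i - p $ i) - stretch l (eps n) (x $ i - (p $ i + l))) * inverse l)"

lemma C1_bump: "C1 (bump n p i)"
  unfolding bump_def[abs_def]
  by (intro C1_mult C1_prod C1_cutoff_nth C1_diff C1_stretch_nth C1_const eps)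

lemma bump_support:
  assumes "bump n p i x \<noteq> 0"
  shows "j \<noteq> i \<Longrightarrow> p $ j + eps n < x $ j \<and> x $ j < p $ j + l - eps n"
    and "p $ i + eps n < x $ i \<and> x $ i < p $ i + 2 * l - eps n"
proof -
  show "p $ j + eps n < x $ j \<and> x $ j < p $ j + l - eps n" if "j \<noteq> i"
  proof (rule ccontr)
    assume "\<not> ?thesis"
    then have "x $ j - p $ j \<le> eps n \<or> l - eps n \<le> x $ j - p $ j" by linarith
    then have "cutoff l (eps n) (x $ j - p $ j) = 0"
      using cutoff_left[OF eps(1)] cutoff_right[OF eps(1)] by blast
    then have "(\<Prod>j\<in>UNIV - {i}. cutoff l (eps n) (x $ j - p $ j)) = 0"
      using that by (intro prod_zero) auto
    then show False using assms by (simp add: bump_def)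
  qed
  show "p $ i + eps n < x $ i \<and> x $ i < p $ i + 2 * l - eps n"
  proof (rule ccontr)
    assume "\<not> ?thesis"
    then consider "x $ i \<le> p $ i + eps n" | "p $ i + 2 * l - eps n \<le> x $ i" by linarith
    then have "stretch l (eps n) (x $ i - p $ i) = stretch l (eps n) (x $ i - (p $ i + l))"
    proof cases
      case 1
      then show ?thesis
        using l_pos by (subst (1 2) stretch_left[OF eps(1,2)]) auto
    next
      case 2
      then show ?thesis
        using l_pos eps(1,2)[of n] by (subst (1 2) stretch_right[OF eps(1,2)]) auto
    qed
    then show False using assms by (simp add: bump_def)
  qed
qed

lemma bump_C1c:
  assumes "p \<in> P" "p + l *\<^sub>R axis i 1 \<in> P"
  shows "bump n p i \<in> C1c \<Omega>"
proof (rule C1cI[OF C1_bump])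
  let ?K = "cbox (\<chi> j. p $ j + eps n) (\<chi> j. p $ j + (if j = i then 2 * l else l) - eps n)"
  show "compact ?K" by simp
  show "?K \<subseteq> \<Omega>"
  proof
    fix x assume "x \<in> ?K"
    then have x: "p $ j + eps n \<le> x $ j \<and> x $ j \<le> p $ j + (if j = i then 2 * l else l) - eps n" for j
      by (simp add: mem_box_cart)
    show "x \<in> \<Omega>"
    proof (rule double_cell_subset[OF assms])
      show "p $ j < x $ j \<and> x $ j < p $ j + l" if "j \<noteq> i" for j
        using x[of j] that eps(1)[of n] by auto
      show "p $ i < x $ i" "x $ i < p $ i + 2 * l"
        using x[of i] eps(1)[of n] by auto
    qed
  qed
  show "bump n p i x = 0" if "x \<notin> ?K" for x
  proof (rule ccontr)
    assume "bump n p i x \<noteq> 0"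
    note s = bump_support[OF this]
    have "p $ j + eps n \<le> x $ j \<and> x $ j \<le> p $ j + (if j = i then 2 * l else l) - eps n" for j
      using s(1)[of j] s(2) by (cases "j = i") auto
    then have "x \<in> ?K" by (simp add: mem_box_cart)
    then show False using that by simp
  qed
qed

lemma bump_cell:
  assumes "p \<in> P" "p + l *\<^sub>R axis i 1 \<in> P" "r \<in> P" "x \<in> open_cube l r" "bump n p i x \<noteq> 0"
  shows "r = p \<or> r = p + l *\<^sub>R axis i 1"
proof -
  note s = bump_support[OF assms(5)] eps(1)[of n]
  show ?thesis
  proof (cases "x $ i \<le> p $ i + l")
    case True
    have "p $ j \<le> x $ j \<and> x $ j \<le> p $ j + l" for j
      using s(1)[of j] s(2,3) True by (cases "j = i") auto
    then have "x \<in> cube l p" by (simp add: mem_cube)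
    then show ?thesis using cell_unique[OF assms(3,1,4)] by simp
  next
    case False
    have "(p + l *\<^sub>R axis i 1) $ j \<le> x $ j \<and> x $ j \<le> (p + l *\<^sub>R axis i 1) $ j + l" for j
      using s(1)[of j] s(2,3) False by (cases "j = i") (auto simp: axis_def)
    then have "x \<in> cube l (p + l *\<^sub>R axis i 1)" by (simp add: mem_cube)
    then show ?thesis using cell_unique[OF assms(3,2,4)] by simp
  qed
qed

text \<open>These are the rising half of the bump on the upper i-facet and the falling half of the
  bump on the lower one. They add up to the cut-off product, so combining them interpolates between
  two traces.\<close>

lemma bump_own_cell:
  assumes "x \<in> open_cube l r"
  shows "bump n r i x = (\<Prod>j\<in>UNIV - {i}. cutoff l (eps n) (x $ j - r $ j)) *
      (stretch l (eps n) (x $ i - r $ i) * inverse l)"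
    and "bump n (r - l *\<^sub>R axis i 1) i x = (\<Prod>j\<in>UNIV - {i}. cutoff l (eps n) (x $ j - r $ j)) *
      ((l - stretch l (eps n) (x $ i - r $ i)) * inverse l)"
proof -
  have x: "r $ i < x $ i" "x $ i < r $ i + l" using assms by (auto simp: mem_open_cube)
  have "stretch l (eps n) (x $ i - (r $ i + l)) = 0"
    using x eps(1)[of n] by (intro stretch_left eps) auto
  then show "bump n r i x = (\<Prod>j\<in>UNIV - {i}. cutoff l (eps n) (x $ j - r $ j)) *
      (stretch l (eps n) (x $ i - r $ i) * inverse l)"
    by (simp add: bump_def)
  have "stretch l (eps n) (x $ i - (r $ i - l)) = l"
    using x eps(1)[of n] by (intro stretch_right eps) auto
  moreover have "(\<Prod>j\<in>UNIV - {i}. cutoff l (eps n) (x $ j - (r - l *\<^sub>R axis i 1) $ j)) =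
      (\<Prod>j\<in>UNIV - {i}. cutoff l (eps n) (x $ j - r $ j))"
    by (intro prod.cong) (auto simp: axis_def)
  ultimately show "bump n (r - l *\<^sub>R axis i 1) i x = (\<Prod>j\<in>UNIV - {i}. cutoff l (eps n) (x $ j - r $ j)) *
      ((l - stretch l (eps n) (x $ i - r $ i)) * inverse l)"
    by (simp add: bump_def)
qed

text \<open>On the cell the derivative is a product of cut-offs and a ramp, hence nonnegative, and
  it is nonzero at the centre. The strict sign permits cancelling this integral when traces are
  compared.\<close>

lemma partial_deriv_bump_pos:
  "0 < (LINT x|lebesgue_on (open_cube l p). partial_deriv i (bump 0 p i) x)"
proof -
  define G where "G x = partial_deriv i (bump 0 p i) x" for x
  have G: "G x = (\<Prod>j\<in>UNIV - {i}. cutoff l (eps 0) (x $ j - p $ j)) * (ramp l (eps 0) (x $ i - p $ i) * inverse l)"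
    if "x \<in> cube l p" for x
  proof -
    have 1: "((\<lambda>t. stretch l (eps 0) (x $ i + t - c)) has_real_derivative ramp l (eps 0) (x $ i - c)) (at 0)" for c
    proof -
      have "((\<lambda>t. x $ i + t - c) has_real_derivative 1) (at 0)"
        by (auto intro!: derivative_eq_intros)
      from DERIV_chain2[OF has_real_derivative_stretch[OF eps(1,2)] this] show ?thesis by simp
    qed
    have b: "(\<lambda>t. bump 0 p i (x + t *\<^sub>R axis i 1)) = (\<lambda>t. (\<Prod>j\<in>UNIV - {i}. cutoff l (eps 0) (x $ j - p $ j)) *
     ((stretch l (eps 0) (x $ i + t - p $ i) - stretch l (eps 0) (x $ i + t - (p $ i + l))) * inverse l))"
      unfolding bump_def by (auto simp: axis_def fun_eq_iff intro!: prod.cong)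
    have "((\<lambda>t. bump 0 p i (x + t *\<^sub>R axis i 1))
      has_real_derivative (\<Prod>j\<in>UNIV - {i}. cutoff l (eps 0) (x $ j - p $ j)) *
       ((ramp l (eps 0) (x $ i - p $ i) - ramp l (eps 0) (x $ i - (p $ i + l))) * inverse l)) (at 0)"
      unfolding b by (intro DERIV_cmult DERIV_cmult_right DERIV_diff 1)
    then have "G x = (\<Prod>j\<in>UNIV - {i}. cutoff l (eps 0) (x $ j - p $ j)) *
       ((ramp l (eps 0) (x $ i - p $ i) - ramp l (eps 0) (x $ i - (p $ i + l))) * inverse l)"
      unfolding G_def by (rule DERIV_unique[OF has_partial_deriv[OF C1_bump]])
    moreover have "ramp l (eps 0) (x $ i - (p $ i + l)) = 0"
      using that eps(1)[of 0] by (intro ramp_left eps) (auto simp: mem_cube dest!: spec[of _ i])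
    ultimately show ?thesis by simp
  qed
  have contG: "continuous_on S G" for S
    unfolding G_def by (rule continuous_partial_deriv[OF C1_bump])
  have nonneg: "0 \<le> G x" if "x \<in> cube l p" for x
    unfolding G[OF that] using l_pos prod_cutoff_bounds[OF eps(1)] ramp_nonneg[OF eps(1,2)]
    by (intro mult_nonneg_nonneg) auto
  define m where "m = (\<chi> j. p $ j + l / 2)"
  have m: "m \<in> cube l p" using l_pos by (simp add: m_def mem_cube)
  \<comment> \<open>Since \<open>eps 0 = l / 4\<close>, both plateaus shrink to the single point l /
    2, and the centre is exactly there.\<close>
  have mid: "2 * eps 0 \<le> l / 2" "l / 2 \<le> l - 2 * eps 0" using l_pos by (auto simp: eps_def)
  have "G m = 1 * (l / (l - 3 * eps 0) * inverse l)"
    unfolding G[OF m] using cutoff_middle[OF eps(1) mid] ramp_middle[OF eps(1,2) mid] by (simp add: m_def)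
  then have "G m \<noteq> 0" using l_pos by (simp add: eps_def)
  have "(LINT x|lebesgue_on (open_cube l p). G x) = integral (open_cube l p) G"
    by (rule lebesgue_integral_eq_integral[OF continuous_integrable_open_cube[OF contG]]) simp
  also have "\<dots> = integral (cube l p) G"
    unfolding open_cube_def cube_def by (rule integral_open_interval)
  also have "\<dots> > 0"
  proof -
    have "box p (\<chi> i. p $ i + l) \<noteq> {}"
      using l_pos by (simp add: interval_eq_empty_cart)
    from integral_cbox_eq_0_iff[OF contG this] nonneg m \<open>G m \<noteq> 0\<close>
    have "integral (cube l p) G \<noteq> 0"
      unfolding cube_def by blast
    moreover have "0 \<le> integral (cube l p) G"
      by (rule integral_nonneg) (use nonneg in \<open>auto simp: cube_def intro!: integrable_continuous contG\<close>)
    ultimately show ?thesis by simp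
  qed
  finally show ?thesis by (simp add: G_def)
qed

section \<open>Assembling statements and integrals from the cells\<close>

lemma AE_cellsI:
  assumes "\<And>p. p \<in> P \<Longrightarrow> AE x in lebesgue_on (open_cube l p). R x"
  shows "AE x in lebesgue_on \<Omega>. R x"
proof -
  have "AE x in lebesgue. \<forall>p\<in>P. x \<in> open_cube l p \<longrightarrow> R x"
    using assms fin by (intro AE_finite_allI) (auto simp: AE_restrict_space_iff)
  moreover have "AE x in lebesgue. x \<in> \<Omega> \<longrightarrow> (\<exists>p\<in>P. x \<in> open_cube l p)"
    using AE_open_cube by (simp add: AE_restrict_space_iff)
  ultimately have "AE x in lebesgue. x \<in> \<Omega> \<longrightarrow> R x"
    by eventually_elim blast
  then show ?thesis by (simp add: AE_restrict_space_iff)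
qed

lemma AE_cellD:
  assumes "AE x in lebesgue_on \<Omega>. R x" "p \<in> P"
  shows "AE x in lebesgue_on (open_cube l p). R x"
proof -
  have "AE x in lebesgue. x \<in> \<Omega> \<longrightarrow> R x"
    using assms(1) by (simp add: AE_restrict_space_iff)
  then have "AE x in lebesgue. x \<in> open_cube l p \<longrightarrow> R x"
    by eventually_elim (use open_cube_subset[OF assms(2)] in blast)
  then show ?thesis by (simp add: AE_restrict_space_iff)
qed

lemma indicator_cells_eq:
  assumes "p \<in> P" "x \<in> open_cube l p"
  shows "(\<Sum>q\<in>P. indicator (open_cube l q) x * f q) = (f p :: real)"
proof -
  have "(\<Sum>q\<in>P. indicator (open_cube l q) x * f q) = (\<Sum>q\<in>P. if q = p then f q else 0)"
  proof (intro sum.cong refl)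
    fix q assume "q \<in> P"
    then have "x \<in> open_cube l q \<longleftrightarrow> q = p"
      using assms cell_unique[OF assms(1) _ assms(2)] open_cube_subset_cube by blast
    then show "indicator (open_cube l q) x * f q = (if q = p then f q else 0)"
      by (auto simp: indicator_def)
  qed
  then show ?thesis using assms fin by simp
qed

lemma integral_cells:
  fixes h :: "real^'d \<Rightarrow> real"
  assumes h: "h \<in> borel_measurable (lebesgue_on \<Omega>)"
    and k: "\<And>p. p \<in> P \<Longrightarrow> integrable (lebesgue_on (open_cube l p)) (k p)"
    and eq: "\<And>p. p \<in> P \<Longrightarrow> AE x in lebesgue_on (open_cube l p). h x = k p x"
  shows "integrable (lebesgue_on \<Omega>) h"
    and "(LINT x|lebesgue_on \<Omega>. h x) = (\<Sum>p\<in>P. LINT x|lebesgue_on (open_cube l p). k p x)"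
proof -
  have ik: "integrable (lebesgue_on \<Omega>) (\<lambda>x. indicator (open_cube l p) x * k p x)"
    and Ik: "(LINT x|lebesgue_on \<Omega>. indicator (open_cube l p) x * k p x) = (LINT x|lebesgue_on (open_cube l p). k p x)"
    if "p \<in> P" for p
  proof -
    have *: "(\<lambda>x. indicator \<Omega> x *\<^sub>R (indicator (open_cube l p) x * k p x)) = (\<lambda>x. indicator (open_cube l p) x *\<^sub>R k p x)"
      using open_cube_subset[OF that] by (auto simp: indicator_def fun_eq_iff)
    show "integrable (lebesgue_on \<Omega>) (\<lambda>x. indicator (open_cube l p) x * k p x)"
      using k[OF that] * by (simp add: integrable_restrict_space)
    show "(LINT x|lebesgue_on \<Omega>. indicator (open_cube l p) x * k p x) = (LINT x|lebesgue_on (open_cube l p). k p x)"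
      using * by (simp add: integral_restrict_space)
  qed
  have AE: "AE x in lebesgue_on \<Omega>. (\<Sum>p\<in>P. indicator (open_cube l p) x * k p x) = h x"
  proof (rule AE_cellsI)
    fix p assume p: "p \<in> P"
    show "AE x in lebesgue_on (open_cube l p). (\<Sum>p\<in>P. indicator (open_cube l p) x * k p x) = h x"
      using eq[OF p] AE_space
      by eventually_elim (simp add: indicator_cells_eq[OF p])
  qed
  have iS: "integrable (lebesgue_on \<Omega>) (\<lambda>x. \<Sum>p\<in>P. indicator (open_cube l p) x * k p x)"
    using ik by (intro Bochner_Integration.integrable_sum)
  show "integrable (lebesgue_on \<Omega>) h"
    by (rule integrable_cong_AE_imp[OF iS h AE])
  have "(LINT x|lebesgue_on \<Omega>. h x) = (LINT x|lebesgue_on \<Omega>. (\<Sum>p\<in>P. indicator (open_cube l p) x * k p x))"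
    using AE iS h by (intro integral_cong_AE) (auto elim: eventually_mono)
  also have "\<dots> = (\<Sum>p\<in>P. LINT x|lebesgue_on (open_cube l p). k p x)"
    using ik Ik by (subst Bochner_Integration.integral_sum) auto
  finally show "(LINT x|lebesgue_on \<Omega>. h x) = (\<Sum>p\<in>P. LINT x|lebesgue_on (open_cube l p). k p x)" .
qed

lemma finite_measure_\<Omega>: "emeasure (lebesgue_on \<Omega>) (space (lebesgue_on \<Omega>)) \<noteq> \<infinity>"
proof -
  have "bounded \<Omega>"
    using fin by (intro bounded_subset[OF _ \<Omega>_subset] bounded_UN) (auto intro: compact_imp_bounded)
  then have "\<Omega> \<in> lmeasurable" using open_\<Omega> by (intro lmeasurable_open)
  then show ?thesis by (simp add: emeasure_restrict_space fmeasurable_def)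
qed

lemma L2_imp_integrable:
  assumes "g \<in> L2 \<Omega>" shows "integrable (lebesgue_on \<Omega>) (g :: real^'d \<Rightarrow> real)"
proof (rule Bochner_Integration.integrable_bound)
  interpret finite_measure "lebesgue_on \<Omega>"
    using finite_measure_\<Omega> by (rule finite_measureI)
  show "integrable (lebesgue_on \<Omega>) (\<lambda>x. 1 + (norm (g x))\<^sup>2)"
    using assms by (auto simp: L2_def)
  show "g \<in> borel_measurable (lebesgue_on \<Omega>)" using assms by (simp add: L2_def)
  have "\<bar>y\<bar> \<le> 1 + y\<^sup>2" for y :: real
    using zero_le_power2[of "\<bar>y\<bar> - 1"] by (simp add: power2_eq_square algebra_simps)
  then show "AE x in lebesgue_on \<Omega>. norm (g x) \<le> norm (1 + (norm (g x))\<^sup>2)" by auto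
qed

end

section \<open>Traces and divergence of Raviart--Thomas fields\<close>

text \<open>One competitor in the supremum \<open>TVh\<close>. \<open>RT0\<close> asserts only that
  coefficients exist on each cell; here a choice of them is fixed as functions of the
  corner.\<close>

locale rt0_field = cube_mesh \<Omega> l P
  for \<Omega> :: "(real^'d) set" and l :: real and P :: "(real^'d) set" +
  fixes \<phi> :: "real^'d \<Rightarrow> real^'d" and g :: "real^'d \<Rightarrow> real"
    and a c :: "real^'d \<Rightarrow> real^'d"
  assumes \<phi>: "\<phi> \<in> RT0_0 \<Omega> (cube l ` P)" and norm_\<phi>: "Linf_norm \<Omega> \<phi> \<le> 1"
    and g: "weak_divergence \<Omega> \<phi> g"
    and rep: "\<And>p. p \<in> P \<Longrightarrow> AE x in lebesgue_on (cube l p). \<phi> x = rt0 (a p) (c p) x"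
begin

lemma \<phi>_measurable: "\<phi> \<in> borel_measurable (lebesgue_on \<Omega>)"
  using \<phi> by (auto simp: RT0_0_def RT0_def Hdiv_def L2_def)

lemma g_integrable: "integrable (lebesgue_on \<Omega>) g"
  using g by (intro L2_imp_integrable) (simp add: weak_divergence_def)

lemma g_measurable: "g \<in> borel_measurable (lebesgue_on \<Omega>)"
  using g_integrable by auto

lemma rep_open: "p \<in> P \<Longrightarrow> AE x in lebesgue_on (open_cube l p). \<phi> x = rt0 (a p) (c p) x"
proof -
  assume "p \<in> P"
  then have "AE x in lebesgue. x \<in> cube l p \<longrightarrow> \<phi> x = rt0 (a p) (c p) x"
    using rep by (simp add: AE_restrict_space_iff)
  then have "AE x in lebesgue. x \<in> open_cube l p \<longrightarrow> \<phi> x = rt0 (a p) (c p) x"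
    by eventually_elim (use open_cube_subset_cube in blast)
  then show ?thesis by (simp add: AE_restrict_space_iff)
qed

text \<open>The essential bound holds at every point of the open cell because the affine
  representative is continuous, and it extends to the closed cell. Its values at the corners are
  what later bounds the divergence.\<close>

lemma norm_rt0_le_1:
  assumes "p \<in> P" "x \<in> cube l p"
  shows "norm (rt0 (a p) (c p) x) \<le> 1"
proof -
  define C where "C = {x. norm (rt0 (a p) (c p) x) \<le> 1}"
  have "AE x in lebesgue_on \<Omega>. ereal (norm (\<phi> x)) \<le> Linf_norm \<Omega> \<phi>"
    unfolding Linf_norm_def by (rule esssup_AE)
  then have "AE x in lebesgue_on \<Omega>. norm (\<phi> x) \<le> 1"
  proof eventually_elim
    case (elim x)
    then have "ereal (norm (\<phi> x)) \<le> 1" using norm_\<phi> by (rule order_trans)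
    then show ?case by simp
  qed
  from AE_cellD[OF this assms(1)] rep_open[OF assms(1)]
  have "AE x in lebesgue_on (open_cube l p). x \<in> C"
    by eventually_elim (simp add: C_def)
  moreover have closed: "closed C"
    unfolding C_def rt0_def
    by (intro closed_Collect_le continuous_intros continuous_on_vec_lambda)
  ultimately have "open_cube l p \<subseteq> C"
    by (intro AE_open_imp_subset_closed) auto
  then have "closure (open_cube l p) \<subseteq> C"
    using closed by (rule closure_minimal)
  then show ?thesis
    using assms(2) by (auto simp: closure_open_cube[OF l_pos] C_def)
qed

lemma integral_gradient_cells:
  assumes "\<psi> \<in> C1c \<Omega>"
  shows "(\<Sum>p\<in>P. LINT x|lebesgue_on (open_cube l p). frechet_derivative \<psi> (at x) (rt0 (a p) (c p) x))
    = - (LINT x|lebesgue_on \<Omega>. g x * \<psi> x)"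
proof -
  have C: "C1 \<psi>" using assms by (simp add: C1c_eq_C1)
  define h where "h x = frechet_derivative \<psi> (at x) (\<phi> x)" for x
  define k where "k p x = frechet_derivative \<psi> (at x) (rt0 (a p) (c p) x)" for p x
  have h: "h x = (\<Sum>j\<in>UNIV. partial_deriv j \<psi> x * \<phi> x $ j)" for x
    unfolding h_def by (rule frechet_derivative_sum_partial_deriv[OF C])
  have k: "k p x = (\<Sum>j\<in>UNIV. partial_deriv j \<psi> x * rt0 (a p) (c p) x $ j)" for p x
    unfolding k_def by (rule frechet_derivative_sum_partial_deriv[OF C])
  have "h \<in> borel_measurable (lebesgue_on \<Omega>)"
  proof -
    have "(\<lambda>x. \<phi> x $ j) \<in> borel_measurable (lebesgue_on \<Omega>)" for j
      by (rule measurable_compose[OF \<phi>_measurable borel_measurable_continuous_onI])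
        (intro continuous_intros)
    moreover have "partial_deriv j \<psi> \<in> borel_measurable (lebesgue_on \<Omega>)" for j
      by (intro continuous_imp_measurable_on_sets_lebesgue continuous_partial_deriv[OF C]) simp
    ultimately show ?thesis
      unfolding h by (intro borel_measurable_sum borel_measurable_times)
  qed
  moreover have "integrable (lebesgue_on (open_cube l p)) (k p)" for p
    unfolding k rt0_def
    by (intro continuous_integrable_open_cube)
      (auto intro!: continuous_intros continuous_partial_deriv[OF C])
  moreover have "AE x in lebesgue_on (open_cube l p). h x = k p x" if "p \<in> P" for p
    using rep_open[OF that] by eventually_elim (simp add: h_def k_def)
  ultimately have "(LINT x|lebesgue_on \<Omega>. h x) = (\<Sum>p\<in>P. LINT x|lebesgue_on (open_cube l p). k p x)"
    by (intro integral_cells)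
  moreover have "(LINT x|lebesgue_on \<Omega>. h x) = - (LINT x|lebesgue_on \<Omega>. g x * \<psi> x)"
    using g assms unfolding weak_divergence_def h_def by blast
  ultimately show ?thesis by (simp add: k_def)
qed

lemma frechet_derivative_eq_0:
  assumes "C1 f" "open U" "x \<in> U" "\<And>y. y \<in> U \<Longrightarrow> f y = (0::real)"
  shows "frechet_derivative f (at x) (v :: real^'d) = 0"
proof -
  have "partial_deriv j f x = 0" for j
    by (rule partial_deriv_eq_0[OF assms])
  then show ?thesis
    by (subst frechet_derivative_sum_partial_deriv[OF assms(1)]) simp
qed

text \<open>For test functions supported in one cell the weak divergence identity involves that cell
  alone, and integrating the affine map by parts leaves the sum of the slopes; the fundamental lemma
  concludes.\<close>

lemma g_cell:
  assumes p: "p \<in> P"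
  shows "AE x in lebesgue_on (open_cube l p). g x = (\<Sum>j\<in>UNIV. c p $ j)"
proof -
  define s where "s = (\<Sum>j\<in>UNIV. c p $ j)"
  have ig: "integrable (lebesgue_on (open_cube l p)) g"
    by (rule integrable_lebesgue_on_subset[OF g_integrable open_cube_subset[OF p]]) auto
  have is1: "integrable (lebesgue_on (open_cube l p)) (\<lambda>x. s)"
    by (intro continuous_integrable_open_cube continuous_intros)
  have "AE x in lebesgue_on (open_cube l p). g x - s = 0"
  proof (rule fundamental_lemma_cell[OF l_pos])
    show "integrable (lebesgue_on (open_cube l p)) (\<lambda>x. g x - s)"
      using ig is1 by (rule Bochner_Integration.integrable_diff)
    fix \<psi> :: "real^'d \<Rightarrow> real" assume \<psi>: "\<psi> \<in> C1c (open_cube l p)"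
    have \<psi>\<Omega>: "\<psi> \<in> C1c \<Omega>" using \<psi> C1c_mono[OF open_cube_subset[OF p]] by blast
    have C: "C1 \<psi>" using \<psi> by (simp add: C1c_eq_C1)
    have out: "\<psi> x = 0" if "x \<notin> open_cube l p" for x
      using \<psi> closure_subset[of "{x. \<psi> x \<noteq> 0}"] that by (auto simp: C1c_eq_C1)
    \<comment> \<open>\<open>integral_rt0_gradient_cell\<close> singles out one direction. Any will
      do: \<open>\<psi>\<close> vanishes on all facets, and the integral of its i-th derivative is
      zero.\<close>
    fix i :: 'd
    have "(LINT x|lebesgue_on (open_cube l q). frechet_derivative \<psi> (at x) (rt0 (a q) (c q) x)) = 0"
      if "q \<in> P" "q \<noteq> p" for q
    proof -
      have "(LINT x|lebesgue_on (open_cube l q). frechet_derivative \<psi> (at x) (rt0 (a q) (c q) x)) =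
          (LINT x|lebesgue_on (open_cube l q). 0)"
      proof (intro Bochner_Integration.integral_cong refl frechet_derivative_eq_0[OF C, of "open_cube l q"])
        show "\<psi> y = 0" if "y \<in> open_cube l q" for y
          using disj[OF \<open>q \<in> P\<close> p \<open>q \<noteq> p\<close>] that by (intro out) blast
      qed auto
      then show ?thesis by simp
    qed
    then have "(\<Sum>q\<in>P. LINT x|lebesgue_on (open_cube l q). frechet_derivative \<psi> (at x) (rt0 (a q) (c q) x))
        = (LINT x|lebesgue_on (open_cube l p). frechet_derivative \<psi> (at x) (rt0 (a p) (c p) x))"
      using p fin by (subst sum.remove[of P p]) auto
    also have "\<dots> = (a p $ i + c p $ i * 0) * (LINT x|lebesgue_on (open_cube l p). partial_deriv i \<psi> x)
      - s * (LINT x|lebesgue_on (open_cube l p). \<psi> x)"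
      unfolding s_def
    proof (rule integral_rt0_gradient_cell[OF l_pos C])
      show "\<psi> x = 0" if "x \<in> cube l p" "x $ j = p $ j \<or> x $ j = p $ j + l" for x j
        using that(2) by (intro out) (auto simp: mem_open_cube intro!: exI[of _ j])
    qed
    also have "\<dots> = - s * (LINT x|lebesgue_on (open_cube l p). \<psi> x)"
      using integral_partial_deriv_C1c_eq_0[OF \<psi>, of i] by simp
    finally have "(LINT x|lebesgue_on \<Omega>. g x * \<psi> x) = s * (LINT x|lebesgue_on (open_cube l p). \<psi> x)"
      using integral_gradient_cells[OF \<psi>\<Omega>] by simp
    moreover have "(LINT x|lebesgue_on \<Omega>. g x * \<psi> x) = (LINT x|lebesgue_on (open_cube l p). g x * \<psi> x)"
    proof -
      have "(\<lambda>x. indicator \<Omega> x *\<^sub>R (g x * \<psi> x)) = (\<lambda>x. indicator (open_cube l p) x *\<^sub>R (g x * \<psi> x))"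
        using out open_cube_subset[OF p] by (auto simp: indicator_def fun_eq_iff)
      then show ?thesis by (simp add: integral_restrict_space)
    qed
    moreover have "(LINT x|lebesgue_on (open_cube l p). (g x - s) * \<psi> x)
        = (LINT x|lebesgue_on (open_cube l p). g x * \<psi> x) - s * (LINT x|lebesgue_on (open_cube l p). \<psi> x)"
    proof -
      obtain B where B: "\<And>x. \<bar>\<psi> x\<bar> \<le> B"
      proof -
        have "bounded (\<psi> ` cube l p)"
          by (intro compact_imp_bounded compact_continuous_image C1_imp_continuous[OF C]) simp
        then obtain B where B: "\<And>x. x \<in> cube l p \<Longrightarrow> \<bar>\<psi> x\<bar> \<le> B" unfolding bounded_iff by auto
        have "\<bar>\<psi> x\<bar> \<le> max B 0" for x
          using B[of x] out[of x] open_cube_subset_cube[of l p] by (cases "x \<in> cube l p") (auto simp: le_max_iff_disj)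
        then show ?thesis by (rule that)
      qed
      have m\<psi>: "\<psi> \<in> borel_measurable (lebesgue_on (open_cube l p))"
        by (intro continuous_imp_measurable_on_sets_lebesgue C1_imp_continuous[OF C]) simp
      have "integrable (lebesgue_on (open_cube l p)) (\<lambda>x. g x * \<psi> x)"
      proof (rule Bochner_Integration.integrable_bound[of _ "\<lambda>x. g x * B"])
        show "AE x in lebesgue_on (open_cube l p). norm (g x * \<psi> x) \<le> norm (g x * B)"
          using B by (auto simp: abs_mult intro!: AE_I2 mult_left_mono intro: order_trans[OF B abs_ge_self])
      qed (use ig m\<psi> in auto)
      moreover have "integrable (lebesgue_on (open_cube l p)) \<psi>"
        by (intro continuous_integrable_open_cube C1_imp_continuous[OF C])
      ultimately show ?thesis by (simp add: left_diff_distrib)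
    qed
    ultimately show "(LINT x|lebesgue_on (open_cube l p). (g x - s) * \<psi> x) = 0" by simp
  qed
  then show ?thesis by (simp add: s_def)
qed

text \<open>The i-th component of the affine representative depends on x_i alone and is therefore
  constant on each i-facet. \<open>upper\<close> and \<open>lower\<close> are these constants, that
  is, the normal traces up to sign.\<close>

definition upper :: "real^'d \<Rightarrow> 'd \<Rightarrow> real" where
  "upper p i = a p $ i + c p $ i * (p $ i + l)"

definition lower :: "real^'d \<Rightarrow> 'd \<Rightarrow> real" where
  "lower p i = a p $ i + c p $ i * p $ i"

text \<open>The trace is constant along the facet, so the boundary condition at its midpoint
  determines it, and there the outer normal is known.\<close>

lemma trace_unshared:
  assumes p: "p \<in> P" and \<sigma>: "\<sigma> = 1 \<or> \<sigma> = -1" and q: "p + (\<sigma> * l) *\<^sub>R axis i 1 \<notin> P"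
  shows "a p $ i + c p $ i * (p $ i + (1 + \<sigma>) / 2 * l) = 0"
proof -
  define x where "x = (\<chi> j. p $ j + (if j = i then (1 + \<sigma>) / 2 * l else l / 2))"
  have n: "outer_unit_normal \<Omega> x (\<sigma> *\<^sub>R axis i 1)"
    unfolding x_def by (rule outer_normal_unshared_facet[OF p \<sigma> q])
  have "x \<in> cube l p"
    using l_pos \<sigma> by (auto simp: mem_cube x_def)
  moreover have "x \<in> frontier \<Omega>" using n by (simp add: outer_unit_normal_def)
  moreover have "\<forall>Q\<in>cube l ` P. \<forall>a c. (AE x in lebesgue_on Q. \<phi> x = rt0 a c x) \<longrightarrow>
     (\<forall>x \<in> Q \<inter> frontier \<Omega>. \<forall>n. outer_unit_normal \<Omega> x n \<longrightarrow> rt0 a c x \<bullet> n = 0)"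
    using \<phi> by (simp add: RT0_0_def)
  ultimately have "rt0 (a p) (c p) x \<bullet> (\<sigma> *\<^sub>R axis i 1) = 0"
    using n p rep[OF p] by blast
  then show ?thesis using \<sigma> by (auto simp: rt0_def inner_axis x_def)
qed

lemma upper_unshared: "p \<in> P \<Longrightarrow> p + l *\<^sub>R axis i 1 \<notin> P \<Longrightarrow> upper p i = 0"
  using trace_unshared[of p 1 i] by (simp add: upper_def)

lemma lower_unshared: "p \<in> P \<Longrightarrow> p - l *\<^sub>R axis i 1 \<notin> P \<Longrightarrow> lower p i = 0"
  using trace_unshared[of p "-1" i] by (simp add: lower_def)

text \<open>Normal continuity of an H(div) field. The bump of the facet is nonzero only in the two
  adjacent cells and vanishes on all their other facets. Tested with it, the weak divergence
  identity says that the two traces, weighted by the integrals \<open>I p\<close> and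
  \<open>I q\<close>, sum to zero; since \<open>I p + I q = 0\<close> and
  \<open>I p \<noteq> 0\<close>, the traces agree.\<close>

lemma trace_shared:
  assumes p: "p \<in> P" and q: "p + l *\<^sub>R axis i 1 \<in> P"
  shows "upper p i = lower (p + l *\<^sub>R axis i 1) i"
proof -
  define q where "q = p + l *\<^sub>R axis i 1"
  define \<psi> where "\<psi> = bump 0 p i"
  define b where "b = p $ i + l"
  have qi: "q $ i = b" "\<And>j. j \<noteq> i \<Longrightarrow> q $ j = p $ j" by (auto simp: q_def b_def axis_def)
  have pq: "p \<in> P" "q \<in> P" "p \<noteq> q" using p q l_pos qi(1) by (auto simp: q_def b_def axis_def vec_eq_iff)
  have C: "C1 \<psi>" unfolding \<psi>_def by (rule C1_bump)
  have \<psi>: "\<psi> \<in> C1c \<Omega>" unfolding \<psi>_def by (rule bump_C1c[OF p q])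
  have other: "\<psi> x = 0" if "r \<in> P" "r \<noteq> p" "r \<noteq> q" "x \<in> open_cube l r" for r x
    using bump_cell[OF p q that(1,4)] that by (auto simp: \<psi>_def q_def)
  have other_closed: "\<psi> x = 0" if "r \<in> P" "r \<noteq> p" "r \<noteq> q" "x \<in> cube l r" for r x
  proof -
    have "closed {x. \<psi> x = 0}"
      by (intro closed_Collect_eq C1_imp_continuous[OF C] continuous_intros)
    then have "closure (open_cube l r) \<subseteq> {x. \<psi> x = 0}"
      using other[OF that(1-3)] by (intro closure_minimal) auto
    then show ?thesis using that(4) closure_open_cube[OF l_pos] by blast
  qed
  define I where "I r = (LINT x|lebesgue_on (open_cube l r). partial_deriv i \<psi> x)" for r
  define J where "J r = (LINT x|lebesgue_on (open_cube l r). \<psi> x)" for r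
  have grad: "(LINT x|lebesgue_on (open_cube l r). frechet_derivative \<psi> (at x) (rt0 (a r) (c r) x))
      = (a r $ i + c r $ i * b) * I r - (\<Sum>j\<in>UNIV. c r $ j) * J r" if r: "r \<in> P" for r
    unfolding I_def J_def
  proof (rule integral_rt0_gradient_cell[OF l_pos C])
    fix x j assume x: "x \<in> cube l r" "x $ j = r $ j \<or> x $ j = r $ j + l" "\<not> (j = i \<and> x $ j = b)"
    show "\<psi> x = 0"
    proof (rule ccontr)
      assume n0: "\<psi> x \<noteq> 0"
      then have "r = p \<or> r = q" using other_closed[OF r _ _ x(1)] by blast
      then show False
        using x(2,3) bump_support(1)[OF n0[unfolded \<psi>_def], of j] bump_support(2)[OF n0[unfolded \<psi>_def]]
          eps(1)[of 0] l_pos qi(1) qi(2)[of j]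
        unfolding b_def by (cases "j = i") auto
    qed
  qed
  have "(LINT x|lebesgue_on \<Omega>. g x * \<psi> x) = (\<Sum>r\<in>P. LINT x|lebesgue_on (open_cube l r). (\<Sum>j\<in>UNIV. c r $ j) * \<psi> x)"
  proof (rule integral_cells)
    have "\<psi> \<in> borel_measurable (lebesgue_on \<Omega>)"
      by (intro continuous_imp_measurable_on_sets_lebesgue C1_imp_continuous[OF C]) simp
    then show "(\<lambda>x. g x * \<psi> x) \<in> borel_measurable (lebesgue_on \<Omega>)"
      using g_measurable by simp
    show "integrable (lebesgue_on (open_cube l r)) (\<lambda>x. (\<Sum>j\<in>UNIV. c r $ j) * \<psi> x)" for r
      by (intro continuous_integrable_open_cube continuous_intros C1_imp_continuous[OF C])
    show "AE x in lebesgue_on (open_cube l r). g x * \<psi> x = (\<Sum>j\<in>UNIV. c r $ j) * \<psi> x" if "r \<in> P" for r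
      using g_cell[OF that] by eventually_elim simp
  qed
  also have "\<dots> = (\<Sum>r\<in>P. (\<Sum>j\<in>UNIV. c r $ j) * J r)"
    by (simp add: J_def)
  finally have "(\<Sum>r\<in>P. (a r $ i + c r $ i * b) * I r - (\<Sum>j\<in>UNIV. c r $ j) * J r)
      = - (\<Sum>r\<in>P. (\<Sum>j\<in>UNIV. c r $ j) * J r)"
    using integral_gradient_cells[OF \<psi>] grad by simp
  \<comment> \<open>The terms with the slopes \<open>c\<close> occur on both sides, because
    \<open>g\<close> is their sum on each cell; only the contributions of the plane x_i = b
    remain.\<close>
  then have eq1: "(\<Sum>r\<in>P. (a r $ i + c r $ i * b) * I r) = 0"
    by (simp add: sum_subtractf)
  have eq2: "(\<Sum>r\<in>P. I r) = 0"
  proof -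
    have "(LINT x|lebesgue_on \<Omega>. partial_deriv i \<psi> x) = (\<Sum>r\<in>P. I r)"
      unfolding I_def
    proof (rule integral_cells)
      show "partial_deriv i \<psi> \<in> borel_measurable (lebesgue_on \<Omega>)"
        by (intro continuous_imp_measurable_on_sets_lebesgue continuous_partial_deriv[OF C]) simp
      show "integrable (lebesgue_on (open_cube l r)) (partial_deriv i \<psi>)" for r
        by (intro continuous_integrable_open_cube continuous_partial_deriv[OF C])
    qed auto
    then show ?thesis using integral_partial_deriv_C1c_eq_0[OF \<psi> open_\<Omega>, of i] by simp
  qed
  have I0: "I r = 0" if "r \<in> P" "r \<noteq> p" "r \<noteq> q" for r
  proof -
    have "I r = (LINT x|lebesgue_on (open_cube l r). 0)"
      unfolding I_def
    proof (intro Bochner_Integration.integral_cong refl)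
      fix x assume "x \<in> space (lebesgue_on (open_cube l r))"
      then have "x \<in> open_cube l r" by simp
      then show "partial_deriv i \<psi> x = 0"
        using other[OF that] by (intro partial_deriv_eq_0[OF C open_open_cube]) auto
    qed
    then show ?thesis by simp
  qed
  have two: "(\<Sum>r\<in>P. f r * I r) = f p * I p + f q * I q" for f
  proof -
    have "(\<Sum>r\<in>P. f r * I r) = (\<Sum>r\<in>{p, q}. f r * I r)"
      using I0 pq fin by (intro sum.mono_neutral_right) auto
    then show ?thesis using pq(3) by simp
  qed
  have "I p + I q = 0" using eq2 two[of "\<lambda>_. 1"] by simp
  then have "(a p $ i + c p $ i * b) * I p = (a q $ i + c q $ i * b) * I p"
    using eq1 two[of "\<lambda>r. a r $ i + c r $ i * b"] by (simp add: add_eq_0_iff)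
  moreover have "I p \<noteq> 0"
    using partial_deriv_bump_pos[of p i] by (simp add: I_def \<psi>_def)
  ultimately show ?thesis
    using qi(1) by (simp add: upper_def lower_def b_def flip: q_def)
qed

end

section \<open>Fields assembled from cells\<close>

context cube_mesh
begin

text \<open>Within \<open>eps n\<close> of a facet the normal coordinate is sent exactly onto that
  facet, so composition with this map makes a function constant in the normal direction there. All
  of space is mapped into the closed cell, where the bounds on \<open>F\<close> are
  available.\<close>

definition cell_map :: "nat \<Rightarrow> real^'d \<Rightarrow> real^'d \<Rightarrow> real^'d" where
  "cell_map n p x = (\<chi> j. p $ j + stretch l (eps n) (x $ j - p $ j))"

lemma cell_map_cube: "cell_map n p x \<in> cube l p"
  using stretch_bounds[OF eps(1,2)] by (auto simp: cell_map_def mem_cube)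

lemma C1_cell_map: "C1 (cell_map n p)"
  unfolding cell_map_def[abs_def] by (intro C1_vec C1_add C1_const C1_stretch_nth eps)

lemma tendsto_cell_map:
  assumes "x \<in> open_cube l p" shows "(\<lambda>n. cell_map n p x) \<longlonglongrightarrow> x"
proof (rule vec_tendstoI)
  fix j
  have "(\<lambda>n. p $ j + stretch l (eps n) (x $ j - p $ j)) \<longlonglongrightarrow> p $ j + (x $ j - p $ j)"
    using assms by (intro tendsto_intros tendsto_stretch eps) (auto simp: mem_open_cube algebra_simps)
  then show "(\<lambda>n. cell_map n p x $ j) \<longlonglongrightarrow> x $ j" by (simp add: cell_map_def)
qed

text \<open>In each cell the \<open>i\<close>-th component is flattened near the \<open>i\<close>-facets by \<open>cell_map\<close> and cut off
  near the other facets, which keeps the norm bound and creates no new term in the divergence.\<close>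

lemma TV_cellwise:
  fixes \<Phi> :: "nat \<Rightarrow> real^'d \<Rightarrow> real^'d" and F G :: "real^'d \<Rightarrow> 'd \<Rightarrow> real^'d \<Rightarrow> real"
  assumes w: "integrable (lebesgue_on \<Omega>) w" and K: "0 < K"
    and \<Phi>: "\<And>n. \<Phi> n \<in> C1c \<Omega>"
    and cell: "\<And>n p x i. p \<in> P \<Longrightarrow> x \<in> open_cube l p \<Longrightarrow>
      \<Phi> n x $ i = (\<Prod>j\<in>UNIV - {i}. cutoff l (eps n) (x $ j - p $ j)) * F p i (cell_map n p x)"
    and deriv: "\<And>p i x. p \<in> P \<Longrightarrow> ((\<lambda>t. F p i (x + t *\<^sub>R axis i 1)) has_real_derivative G p i x) (at 0)"
    and contG: "\<And>p i. p \<in> P \<Longrightarrow> continuous_on UNIV (G p i)"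
    and bound: "\<And>p x. p \<in> P \<Longrightarrow> x \<in> cube l p \<Longrightarrow> norm (\<chi> i. F p i x) \<le> K"
    and h: "h \<in> borel_measurable (lebesgue_on \<Omega>)"
    and h_eq: "\<And>p. p \<in> P \<Longrightarrow> AE x in lebesgue_on (open_cube l p). h x = (\<Sum>i\<in>UNIV. G p i x)"
  shows "ereal (LINT x|lebesgue_on \<Omega>. w x * h x) \<le> ereal K * TV \<Omega> w"
proof -
  define cut where "cut n p i x = (\<Prod>j\<in>UNIV - {i}. cutoff l (eps n) (x $ j - p $ j))" for n p i and x :: "real^'d"
  have cut: "0 \<le> cut n p i x" "cut n p i x \<le> 1" for n p i x
    unfolding cut_def by (rule prod_cutoff_bounds[OF eps(1)])+
  have C: "C1 (\<Phi> n)" for n using \<Phi>[of n] by (simp add: C1c_eq_C1)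
  have norm_cell: "norm (\<Phi> n x) \<le> K" if "p \<in> P" "x \<in> open_cube l p" for n p x
  proof -
    \<comment> \<open>All components are evaluated at the same point of the cell and multiplied by
      factors in [0, 1]; hence the bound K is inherited without loss.\<close>
    have "norm (\<Phi> n x) \<le> norm (\<chi> i. F p i (cell_map n p x))"
    proof (rule norm_le_componentwise_cart)
      fix i
      have "\<bar>cut n p i x * F p i (cell_map n p x)\<bar> \<le> \<bar>F p i (cell_map n p x)\<bar>"
        using cut[of n p i x] by (simp add: abs_mult mult_left_le_one_le)
      then show "norm (\<Phi> n x $ i) \<le> norm ((\<chi> i. F p i (cell_map n p x)) $ i)"
        by (simp add: cell[OF that] cut_def)
    qed
    then show ?thesis using bound[OF that(1) cell_map_cube] by (rule order_trans)
  qed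
  have norm: "norm (\<Phi> n x) \<le> K" for n x
  proof (cases "\<exists>p\<in>P. x \<in> cube l p")
    case True
    then obtain p where p: "p \<in> P" "x \<in> cube l p" by blast
    have "closed {x. norm (\<Phi> n x) \<le> K}"
      by (intro closed_Collect_le continuous_intros C1_imp_continuous[OF C])
    then have "closure (open_cube l p) \<subseteq> {x. norm (\<Phi> n x) \<le> K}"
      using norm_cell[OF p(1)] by (intro closure_minimal) auto
    then show ?thesis using p(2) closure_open_cube[OF l_pos] by blast
  next
    case False
    then have "x \<notin> \<Omega>" using \<Omega>_subset by blast
    then have "\<Phi> n x = 0"
      using \<Phi>[of n] closure_subset[of "{x. \<Phi> n x \<noteq> 0}"] by (auto simp: C1c_eq_C1)
    then show ?thesis using K by simp
  qed
  have div: "divergence (\<Phi> n) x = (\<Sum>i\<in>UNIV. cut n p i x * (G p i (cell_map n p x) * ramp l (eps n) (x $ i - p $ i)))"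
    if p: "p \<in> P" "x \<in> open_cube l p" for n p x
  proof (rule divergence_eq[OF C])
    fix i
    define y where "y = cell_map n p x"
    have shift: "cell_map n p (x + t *\<^sub>R axis i 1) =
        y + (stretch l (eps n) (x $ i + t - p $ i) - stretch l (eps n) (x $ i - p $ i)) *\<^sub>R axis i 1" for t
      by (auto simp: y_def cell_map_def vec_eq_iff axis_def)
    have "((\<lambda>t. x $ i + t - p $ i) has_real_derivative 1) (at 0)"
      by (auto intro!: derivative_eq_intros)
    from DERIV_chain2[OF has_real_derivative_stretch[OF eps(1,2)] this]
    have "((\<lambda>t. stretch l (eps n) (x $ i + t - p $ i) - stretch l (eps n) (x $ i - p $ i))
        has_real_derivative ramp l (eps n) (x $ i - p $ i)) (at 0)"
      by (auto intro!: derivative_eq_intros)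
    then have "((\<lambda>t. F p i (y + (stretch l (eps n) (x $ i + t - p $ i) - stretch l (eps n) (x $ i - p $ i)) *\<^sub>R axis i 1))
        has_real_derivative G p i y * ramp l (eps n) (x $ i - p $ i)) (at 0)"
      using deriv[OF p(1), of i y] by (intro DERIV_chain2[where f = "\<lambda>s. F p i (y + s *\<^sub>R axis i 1)"]) auto
    then have d: "((\<lambda>t. cut n p i x * F p i (cell_map n p (x + t *\<^sub>R axis i 1)))
        has_real_derivative cut n p i x * (G p i y * ramp l (eps n) (x $ i - p $ i))) (at 0)"
      unfolding shift by (rule DERIV_cmult)
    have op: "open ((\<lambda>t. x + t *\<^sub>R axis i 1) -` open_cube l p)"
      by (intro open_vimage continuous_intros) auto
    \<comment> \<open>The product leaves out the factor j = i and so is constant along axis i; the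
      steep slopes of the cut-offs never reach the divergence.\<close>
    have cut_shift: "cut n p i (x + t *\<^sub>R axis i 1) = cut n p i x" for t
      unfolding cut_def by (intro prod.cong) (auto simp: axis_def)
    show "((\<lambda>t. \<Phi> n (x + t *\<^sub>R axis i 1) $ i) has_real_derivative
        cut n p i x * (G p i (cell_map n p x) * ramp l (eps n) (x $ i - p $ i))) (at 0)"
      unfolding y_def[symmetric]
      by (rule has_field_derivative_transform_within_open[OF d op])
        (use p cut_shift in \<open>auto simp: cell[OF p(1)] cut_def\<close>)
  qed
  have "\<exists>C. \<forall>x\<in>cube l p. \<bar>G p i x\<bar> \<le> C" if "p \<in> P" for p i
  proof -
    have "bounded (G p i ` cube l p)"
      by (intro compact_imp_bounded compact_continuous_image continuous_on_subset[OF contG[OF that]]) auto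
    then show ?thesis by (auto simp: bounded_iff)
  qed
  then obtain Cb where Cb: "\<And>p i x. p \<in> P \<Longrightarrow> x \<in> cube l p \<Longrightarrow> \<bar>G p i x\<bar> \<le> Cb p i"
    by metis
  have Cb0: "0 \<le> Cb p i" if "p \<in> P" for p i
    using Cb[OF that, of p i] l_pos by (force simp: mem_cube)
  \<comment> \<open>The factor 4 is the bound on \<open>ramp\<close>. Summing over all cells gives
    one constant that serves every n and every cell.\<close>
  define B where "B = (\<Sum>p\<in>P. \<Sum>i\<in>UNIV. 4 * Cb p i)"
  show ?thesis
  proof (rule TV_limit[OF w lebesgue_\<Omega> K \<Phi> norm _ _ h])
    show "AE x in lebesgue_on \<Omega>. \<bar>divergence (\<Phi> n) x\<bar> \<le> B" for n
      using AE_open_cube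
    proof eventually_elim
      case (elim x)
      then obtain p where p: "p \<in> P" "x \<in> open_cube l p" by blast
      have "\<bar>divergence (\<Phi> n) x\<bar> \<le> (\<Sum>i\<in>UNIV. 4 * Cb p i)"
        unfolding div[OF p]
      proof (rule order_trans[OF sum_abs], intro sum_mono)
        fix i
        have "\<bar>G p i (cell_map n p x) * ramp l (eps n) (x $ i - p $ i)\<bar> \<le> Cb p i * 4"
          unfolding abs_mult using Cb[OF p(1) cell_map_cube] ramp_nonneg[OF eps(1,2)] ramp_le[OF eps(1,2)] Cb0[OF p(1)]
          by (intro mult_mono) auto
        moreover have "\<bar>cut n p i x * b\<bar> \<le> \<bar>b\<bar>" for b
          using cut[of n p i x] by (simp add: abs_mult mult_left_le_one_le)
        ultimately show "\<bar>cut n p i x * (G p i (cell_map n p x) * ramp l (eps n) (x $ i - p $ i))\<bar> \<le> 4 * Cb p i"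
          by (metis mult.commute order_trans)
      qed
      also have "\<dots> \<le> B"
        unfolding B_def using p(1) fin Cb0 by (intro member_le_sum sum_nonneg) auto
      finally show ?case .
    qed
    show "AE x in lebesgue_on \<Omega>. (\<lambda>n. divergence (\<Phi> n) x) \<longlonglongrightarrow> h x"
    proof (rule AE_cellsI)
      fix p assume p: "p \<in> P"
      show "AE x in lebesgue_on (open_cube l p). (\<lambda>n. divergence (\<Phi> n) x) \<longlonglongrightarrow> h x"
        using h_eq[OF p] AE_space
      proof eventually_elim
        case (elim x)
        then have x: "x \<in> open_cube l p" by simp
        have in0: "0 < x $ j - p $ j" "x $ j - p $ j < l" for j
          using x by (auto simp: mem_open_cube algebra_simps)
        have "(\<lambda>n. cut n p i x) \<longlonglongrightarrow> (\<Prod>j\<in>UNIV - {i}. 1)" for i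
          unfolding cut_def by (intro tendsto_prod tendsto_cutoff eps in0)
        moreover have "(\<lambda>n. G p i (cell_map n p x)) \<longlonglongrightarrow> G p i x" for i
          by (rule continuous_on_tendsto_compose[OF contG[OF p] tendsto_cell_map[OF x]]) auto
        moreover have "(\<lambda>n. ramp l (eps n) (x $ i - p $ i)) \<longlonglongrightarrow> 1" for i
          by (intro tendsto_ramp eps in0)
        ultimately have "(\<lambda>n. divergence (\<Phi> n) x) \<longlonglongrightarrow> (\<Sum>i\<in>UNIV. (\<Prod>j\<in>UNIV - {i}. 1) * (G p i x * 1))"
          unfolding div[OF p x] by (intro tendsto_sum tendsto_mult)
        then show ?case using elim by simp
      qed
    qed
  qed
qed

end

context rt0_field
begin

text \<open>Each facet is indexed by the cell below it, and its bump is weighted by the common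
  trace. Unshared upper facets have trace zero by \<open>upper_unshared\<close>, so only bumps
  supported inside \<open>\<Omega>\<close> contribute.\<close>

definition field :: "nat \<Rightarrow> real^'d \<Rightarrow> real^'d" where
  "field n x = (\<chi> i. \<Sum>p\<in>P. upper p i * bump n p i x)"

text \<open>Only the bumps of the two i-facets of the cell are active. Their weights t / l and (l -
  t) / l interpolate linearly between the two traces, which reproduces the affine component at the
  stretched coordinate \<open>r $ i + t\<close>.\<close>

lemma field_cell:
  assumes r: "r \<in> P" and x: "x \<in> open_cube l r"
  shows "field n x $ i = (\<Prod>j\<in>UNIV - {i}. cutoff l (eps n) (x $ j - r $ j)) *
    (a r $ i + c r $ i * cell_map n r x $ i)"
proof -
  define r' where "r' = r - l *\<^sub>R axis i 1"
  define A where "A = (\<Prod>j\<in>UNIV - {i}. cutoff l (eps n) (x $ j - r $ j))"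
  define t where "t = stretch l (eps n) (x $ i - r $ i)"
  have ne: "r' \<noteq> r" using l_pos by (auto simp: r'_def axis_def vec_eq_iff)
  have bumps: "bump n r i x = A * (t * inverse l)" "bump n r' i x = A * ((l - t) * inverse l)"
    unfolding r'_def A_def t_def by (rule bump_own_cell[OF x])+
  have zero: "upper p i * bump n p i x = 0" if "p \<in> P" "p \<noteq> r" "p \<noteq> r'" for p
  proof (rule ccontr)
    assume "upper p i * bump n p i x \<noteq> 0"
    then have "p + l *\<^sub>R axis i 1 \<in> P" "bump n p i x \<noteq> 0"
      using upper_unshared[OF that(1)] by auto
    then have "r = p \<or> r = p + l *\<^sub>R axis i 1"
      using bump_cell[OF that(1) _ r x] by blast
    then show False using that by (auto simp: r'_def)
  qed
  \<comment> \<open>If the cell below exists, its upper trace is the lower trace of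
    \<open>r\<close>; otherwise the lower trace of \<open>r\<close> is zero, in agreement with the
    absent bump.\<close>
  have low: "(if r' \<in> P then upper r' i else 0) = lower r i"
    using trace_shared[of r' i] lower_unshared[OF r, of i] r by (auto simp: r'_def)
  have "field n x $ i = (\<Sum>p\<in>P. upper p i * bump n p i x)"
    by (simp add: field_def)
  also have "\<dots> = (\<Sum>p\<in>P \<inter> {r, r'}. upper p i * bump n p i x)"
    using zero fin by (intro sum.mono_neutral_right) auto
  also have "\<dots> = upper r i * bump n r i x + (if r' \<in> P then upper r' i else 0) * bump n r' i x"
    using r ne by (cases "r' \<in> P") (auto simp: Int_insert_right)
  also have "\<dots> = A * ((upper r i * t + lower r i * (l - t)) * inverse l)"
    unfolding low bumps by (simp add: algebra_simps)
  also have "(upper r i * t + lower r i * (l - t)) * inverse l = a r $ i + c r $ i * (r $ i + t)"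
    using l_pos by (simp add: upper_def lower_def field_simps)
  finally show ?thesis by (simp add: A_def t_def cell_map_def)
qed

lemma field_C1c: "field n \<in> C1c \<Omega>"
proof -
  define K where "K = (\<Union>p\<in>P. \<Union>i\<in>{i. p + l *\<^sub>R axis i 1 \<in> P}. closure {x. bump n p i x \<noteq> 0})"
  have b: "compact (closure {x. bump n p i x \<noteq> 0})" "closure {x. bump n p i x \<noteq> 0} \<subseteq> \<Omega>"
    if "p \<in> P" "p + l *\<^sub>R axis i 1 \<in> P" for p i
    using bump_C1c[OF that, of n] by (auto simp: C1c_eq_C1)
  show ?thesis
  proof (rule C1cI)
    show "C1 (field n)"
      unfolding field_def[abs_def] by (intro C1_vec C1_sum C1_mult C1_const C1_bump)
    show "compact K" unfolding K_def using fin b by (intro compact_UN) auto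
    show "K \<subseteq> \<Omega>" unfolding K_def using b by blast
    fix x assume x: "x \<notin> K"
    have "upper p i * bump n p i x = 0" if "p \<in> P" for p i
    proof (cases "p + l *\<^sub>R axis i 1 \<in> P")
      case True
      then have "bump n p i x = 0"
        using x that closure_subset[of "{x. bump n p i x \<noteq> 0}"] unfolding K_def by blast
      then show ?thesis by simp
    qed (simp add: upper_unshared that)
    then show "field n x = 0" by (auto simp: field_def vec_eq_iff intro!: sum.neutral)
  qed
qed

lemma integral_divergence_le_TV:
  assumes "integrable (lebesgue_on \<Omega>) w"
  shows "ereal (LINT x|lebesgue_on \<Omega>. w x * g x) \<le> TV \<Omega> w"
proof -
  have "ereal (LINT x|lebesgue_on \<Omega>. w x * g x) \<le> ereal 1 * TV \<Omega> w"
  proof (rule TV_cellwise[OF assms _ field_C1c, where F = "\<lambda>p i x. a p $ i + c p $ i * x $ i"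
        and G = "\<lambda>p i x. c p $ i"])
    show "((\<lambda>t. a p $ i + c p $ i * (x + t *\<^sub>R axis i 1) $ i) has_real_derivative c p $ i) (at 0)" for p x i
      by (auto intro!: derivative_eq_intros)
    show "norm (\<chi> i. a p $ i + c p $ i * x $ i) \<le> 1" if "p \<in> P" "x \<in> cube l p" for p x
      using norm_rt0_le_1[OF that] by (simp add: rt0_def)
  qed (auto simp: field_cell g_cell g_measurable)
  then show ?thesis by (simp add: one_ereal_def[symmetric])
qed

text \<open>Between opposite corners of a cell the i-th component changes by
  \<open>c p $ i * l\<close>, while both values lie in [-1, 1]. Hence each slope is at most 2 / l,
  and there are d of them.\<close>

lemma abs_divergence_le: "AE x in lebesgue_on \<Omega>. \<bar>g x\<bar> \<le> 2 * real CARD('d) / l"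
proof (rule AE_cellsI)
  fix p assume p: "p \<in> P"
  define q where "q = (\<chi> j. p $ j + l)"
  have "\<bar>c p $ i\<bar> \<le> 2 / l" for i
  proof -
    have in_cube: "p \<in> cube l p" "q \<in> cube l p" using l_pos by (auto simp: mem_cube q_def)
    have "\<bar>rt0 (a p) (c p) x $ i\<bar> \<le> 1" if "x \<in> cube l p" for x
      using component_le_norm_cart[of "rt0 (a p) (c p) x" i] norm_rt0_le_1[OF p that] by linarith
    from this[OF in_cube(1)] this[OF in_cube(2)]
    have "\<bar>c p $ i * l\<bar> \<le> 2" by (simp add: rt0_def q_def algebra_simps)
    then show ?thesis using l_pos by (simp add: abs_mult field_simps)
  qed
  then have "(\<Sum>i\<in>UNIV. \<bar>c p $ i\<bar>) \<le> (\<Sum>i\<in>(UNIV::'d set). 2 / l)" by (rule sum_mono)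
  with sum_abs have "\<bar>\<Sum>i\<in>UNIV. c p $ i\<bar> \<le> (\<Sum>i\<in>(UNIV::'d set). 2 / l)" by (rule order_trans)
  then have "\<bar>\<Sum>i\<in>UNIV. c p $ i\<bar> \<le> 2 * real CARD('d) / l" by (simp add: mult.commute)
  then show "AE x in lebesgue_on (open_cube l p). \<bar>g x\<bar> \<le> 2 * real CARD('d) / l"
    using g_cell[OF p] by (auto elim: eventually_mono)
qed

end

section \<open>Mean deviation\<close>

lemma norm_le_if_components_le:
  fixes x :: "real^'d"
  assumes "\<And>i. \<bar>x $ i\<bar> \<le> b"
  shows "norm x \<le> sqrt (real CARD('d)) * b"
proof -
  have b: "0 \<le> b" using assms[of undefined] by linarith
  have "norm x \<le> norm (\<chi> i::'d. b)"
    using assms b by (intro norm_le_componentwise_cart) simp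
  also have "\<dots> = sqrt (real CARD('d)) * b"
    using b by (simp add: norm_vec_def L2_set_def real_sqrt_mult)
  finally show ?thesis .
qed

context cube_mesh
begin

text \<open>Both \<open>w - m p\<close> and \<open>q - k p\<close> integrate to zero over the cell,
  so pairing the former with \<open>q\<close> equals pairing \<open>w\<close> with
  \<open>q - k p\<close>. The latter is the divergence of potentials with components at most l / 2,
  and \<open>TV_cellwise\<close> applies with K = sqrt d * l / 2.\<close>

lemma mean_deviation_test:
  fixes m :: "real^'d \<Rightarrow> real"
  assumes w: "integrable (lebesgue_on \<Omega>) w"
    and m: "\<And>p. p \<in> P \<Longrightarrow> (LINT x|lebesgue_on (open_cube l p). w x - m p) = 0"
    and q: "C1 q" "\<And>p x. p \<in> P \<Longrightarrow> x \<in> cube l p \<Longrightarrow> \<bar>q x\<bar> \<le> 1"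
  shows "ereal (\<Sum>p\<in>P. LINT x|lebesgue_on (open_cube l p). (w x - m p) * q x)
    \<le> ereal (sqrt (real CARD('d)) * (l / 2)) * TV \<Omega> w"
proof -
  define ok where "ok p F G k \<longleftrightarrow> (\<forall>i. C1 (F i)) \<and> (\<forall>i. continuous_on UNIV (G i)) \<and>
    (\<forall>i x. ((\<lambda>t. F i (x + t *\<^sub>R axis i 1)) has_real_derivative G i x) (at 0)) \<and>
    (\<forall>i. \<forall>x\<in>cube l p. \<bar>F i x\<bar> \<le> l / 2) \<and>
    (\<forall>i x. x $ i = p $ i \<longrightarrow> F i x = 0) \<and> (\<forall>i x. x $ i = p $ i + l \<longrightarrow> F i x = 0) \<and>
    (\<forall>x. q x - k = (\<Sum>i\<in>UNIV. G i x))"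
    for p :: "real^'d" and F G :: "'d \<Rightarrow> real^'d \<Rightarrow> real" and k :: real
  have "\<exists>F G k. ok p F G k" if p: "p \<in> P" for p
  proof -
    have b: "\<bar>q x\<bar> \<le> 1" if "x \<in> cbox p (\<chi> j. p $ j + l)" for x
      using q(2)[OF p] that by (simp add: cube_def)
    show ?thesis
    proof (rule cell_potentials[OF q(1) l_pos b])
      fix F G :: "'d \<Rightarrow> real^'d \<Rightarrow> real" and c
      assume "\<And>i. C1 (F i)" "\<And>i. continuous_on UNIV (G i)"
        "\<And>i x. ((\<lambda>t. F i (x + t *\<^sub>R axis i 1)) has_real_derivative G i x) (at 0)"
        "\<And>i x. x \<in> cbox p (\<chi> j. p $ j + l) \<Longrightarrow> \<bar>F i x\<bar> \<le> l / 2"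
        "\<And>i x. x $ i = p $ i \<Longrightarrow> F i x = 0" "\<And>i x. x $ i = p $ i + l \<Longrightarrow> F i x = 0"
        "\<And>x. q x - c = (\<Sum>i\<in>UNIV. G i x)"
      then have "ok p F G c" unfolding ok_def cube_def by blast
      then show ?thesis by blast
    qed
  qed
  then obtain F G k where FGk: "\<And>p. p \<in> P \<Longrightarrow> ok p (F p) (G p) (k p)" by metis
  have F: "C1 (F p i)" "continuous_on UNIV (G p i)"
    "((\<lambda>t. F p i (x + t *\<^sub>R axis i 1)) has_real_derivative G p i x) (at 0)"
    "y \<in> cube l p \<Longrightarrow> \<bar>F p i y\<bar> \<le> l / 2"
    "x $ i = p $ i \<Longrightarrow> F p i x = 0" "x $ i = p $ i + l \<Longrightarrow> F p i x = 0"
    "q x - k p = (\<Sum>i\<in>UNIV. G p i x)" if "p \<in> P" for p i x y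
    using FGk[OF that] unfolding ok_def by blast+
  define cut where "cut n p i x = (\<Prod>j\<in>UNIV - {i}. cutoff l (eps n) (x $ j - p $ j))" for n p i and x :: "real^'d"
  define \<Phi> where "\<Phi> n x = (\<chi> i. \<Sum>p\<in>P. cut n p i x * F p i (cell_map n p x))" for n and x :: "real^'d"
  define Kn where "Kn n = (\<Union>p\<in>P. cbox (\<chi> j. p $ j + eps n) (\<chi> j. p $ j + l - eps n))" for n
  \<comment> \<open>Distance \<open>eps n\<close> from the cell boundary comes from two sources:
    near an i-facet \<open>cell_map\<close> lands on the facet, where the potential is zero, and
    near any other facet the cut-off is zero. The cells can thus be treated independently.\<close>
  have supp: "p $ j + eps n \<le> x $ j \<and> x $ j \<le> p $ j + l - eps n"
    if "p \<in> P" "cut n p i x * F p i (cell_map n p x) \<noteq> 0" for n p i x j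
  proof (rule ccontr)
    assume "\<not> ?thesis"
    then have j: "x $ j - p $ j \<le> eps n \<or> l - eps n \<le> x $ j - p $ j" by linarith
    show False
    proof (cases "j = i")
      case True
      then have "cell_map n p x $ i = p $ i \<or> cell_map n p x $ i = p $ i + l"
        using j stretch_left[OF eps(1,2)] stretch_right[OF eps(1,2)] by (auto simp: cell_map_def)
      then show False using F(5,6)[OF that(1)] that(2) by auto
    next
      case False
      have "cutoff l (eps n) (x $ j - p $ j) = 0"
        using j cutoff_left[OF eps(1)] cutoff_right[OF eps(1)] by blast
      then have "cut n p i x = 0" unfolding cut_def using False by (intro prod_zero) auto
      then show False using that(2) by simp
    qed
  qed
  have supp_open: "x \<in> open_cube l p" if "p \<in> P" "cut n p i x * F p i (cell_map n p x) \<noteq> 0" for n p i x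
    using supp[OF that] eps(1)[of n] by (auto simp: mem_open_cube intro: less_le_trans le_less_trans)
      (smt (verit))+
  define h where "h x = (\<Sum>p\<in>P. indicator (open_cube l p) x * (q x - k p))" for x
  have "ereal (LINT x|lebesgue_on \<Omega>. w x * h x) \<le> ereal (sqrt (real CARD('d)) * (l / 2)) * TV \<Omega> w"
  proof (rule TV_cellwise[OF w, where \<Phi> = \<Phi> and F = F and G = G])
    show "0 < sqrt (real CARD('d)) * (l / 2)" using l_pos by simp
    show "\<Phi> n \<in> C1c \<Omega>" for n
    proof (rule C1cI)
      have "C1 (cut n p i)" for p i
        unfolding cut_def[abs_def] by (intro C1_prod C1_cutoff_nth eps)
      then show "C1 (\<Phi> n)"
        unfolding \<Phi>_def[abs_def] by (intro C1_vec C1_sum C1_mult C1_compose[OF F(1) C1_cell_map])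
      show "compact (Kn n)" unfolding Kn_def using fin by (intro compact_UN) auto
      show "Kn n \<subseteq> \<Omega>"
      proof
        fix x assume "x \<in> Kn n"
        then obtain p where p: "p \<in> P" "\<And>j. p $ j + eps n \<le> x $ j \<and> x $ j \<le> p $ j + l - eps n"
          by (auto simp: Kn_def mem_box_cart)
        have "p $ j < x $ j \<and> x $ j < p $ j + l" for j
          using p(2)[of j] eps(1)[of n] by auto
        then show "x \<in> \<Omega>" using open_cube_subset[OF p(1)] by (auto simp: mem_open_cube)
      qed
      show "\<Phi> n x = 0" if "x \<notin> Kn n" for x
      proof -
        have "cut n p i x * F p i (cell_map n p x) = 0" if "p \<in> P" for p i
        proof (rule ccontr)
          assume "cut n p i x * F p i (cell_map n p x) \<noteq> 0"
          from supp[OF that this] have "x \<in> Kn n"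
            unfolding Kn_def using that by (auto simp: mem_box_cart)
          then show False using \<open>x \<notin> Kn n\<close> by simp
        qed
        then show ?thesis by (auto simp: \<Phi>_def vec_eq_iff intro!: sum.neutral)
      qed
    qed
    show "\<Phi> n x $ i = (\<Prod>j\<in>UNIV - {i}. cutoff l (eps n) (x $ j - p $ j)) * F p i (cell_map n p x)"
      if p: "p \<in> P" "x \<in> open_cube l p" for n p x i
    proof -
      have "\<Phi> n x $ i = (\<Sum>r\<in>P. cut n r i x * F r i (cell_map n r x))" by (simp add: \<Phi>_def)
      also have "\<dots> = (\<Sum>r\<in>{p}. cut n r i x * F r i (cell_map n r x))"
      proof (rule sum.mono_neutral_right[OF fin])
        show "\<forall>r\<in>P - {p}. cut n r i x * F r i (cell_map n r x) = 0"
          using supp_open cell_unique[OF p(1) _ p(2)] open_cube_subset_cube by blast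
      qed (use p in auto)
      finally show ?thesis by (simp add: cut_def)
    qed
    show "norm (\<chi> i. F p i x) \<le> sqrt (real CARD('d)) * (l / 2)" if "p \<in> P" "x \<in> cube l p" for p x
      using F(4)[OF that] by (intro norm_le_if_components_le) simp
    have mq: "q \<in> borel_measurable (lebesgue_on \<Omega>)"
      by (intro continuous_imp_measurable_on_sets_lebesgue C1_imp_continuous[OF q(1)]) simp
    have "(\<lambda>x. indicator (open_cube l p) x :: real) \<in> borel_measurable (lebesgue_on \<Omega>)" for p
      by (intro measurable_restrict_space1 borel_measurable_indicator) simp
    then show "h \<in> borel_measurable (lebesgue_on \<Omega>)"
      unfolding h_def[abs_def]
      by (intro borel_measurable_sum borel_measurable_times borel_measurable_diff mq borel_measurable_const)
    show "AE x in lebesgue_on (open_cube l p). h x = (\<Sum>i\<in>UNIV. G p i x)" if p: "p \<in> P" for p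
      using AE_space
      by eventually_elim (simp add: h_def indicator_cells_eq[OF p] F(7)[OF p])
  qed (use F in auto)
  moreover have "(LINT x|lebesgue_on \<Omega>. w x * h x) = (\<Sum>p\<in>P. LINT x|lebesgue_on (open_cube l p). (w x - m p) * q x)"
  proof -
    have cell_int: "integrable (lebesgue_on (open_cube l p)) w" "integrable (lebesgue_on (open_cube l p)) (\<lambda>x. w x * q x)"
      "integrable (lebesgue_on (open_cube l p)) q" "integrable (lebesgue_on (open_cube l p)) (\<lambda>x. b)"
      if p: "p \<in> P" for p and b :: real
    proof -
      show iw: "integrable (lebesgue_on (open_cube l p)) w"
        by (rule integrable_lebesgue_on_subset[OF w open_cube_subset[OF p]]) auto
      show iq: "integrable (lebesgue_on (open_cube l p)) q" "integrable (lebesgue_on (open_cube l p)) (\<lambda>x. b)"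
        by (intro continuous_integrable_open_cube C1_imp_continuous[OF q(1)] continuous_intros)+
      show "integrable (lebesgue_on (open_cube l p)) (\<lambda>x. w x * q x)"
      proof (rule Bochner_Integration.integrable_bound[OF iw])
        show "AE x in lebesgue_on (open_cube l p). norm (w x * q x) \<le> norm (w x)"
          using AE_space
        proof eventually_elim
          case (elim x)
          then have "x \<in> cube l p" using open_cube_subset_cube by auto
          then show ?case using q(2)[OF p] by (simp add: abs_mult mult_left_le)
        qed
      qed (use iw iq in auto)
    qed
    have cell: "(LINT x|lebesgue_on (open_cube l p). w x * (q x - k p)) = (LINT x|lebesgue_on (open_cube l p). (w x - m p) * q x)"
      if p: "p \<in> P" for p
    proof -
      note int = cell_int[OF p]
      have 0: "(LINT x|lebesgue_on (open_cube l p). q x - k p) = 0"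
      proof -
        have "(LINT x|lebesgue_on (open_cube l p). q x - k p) = (LINT x|lebesgue_on (open_cube l p). (\<Sum>i\<in>UNIV. G p i x))"
          by (simp add: F(7)[OF p])
        also have "\<dots> = (\<Sum>i\<in>UNIV. LINT x|lebesgue_on (open_cube l p). G p i x)"
          by (intro Bochner_Integration.integral_sum continuous_integrable_open_cube F(2)[OF p])
        also have "\<dots> = 0"
          using F[OF p] by (intro sum.neutral ballI integral_cell_derivative_eq_0[OF l_pos, where k = "F p i" for i])
            (auto intro: C1_imp_continuous)
        finally show ?thesis .
      qed
      \<comment> \<open>Adding and subtracting the constants isolates two terms that are multiples
        of functions with integral zero.\<close>
      have "(\<lambda>x. w x * (q x - k p)) = (\<lambda>x. (w x - m p) * q x + (m p * (q x - k p) - k p * (w x - m p)))"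
        by (simp add: fun_eq_iff algebra_simps)
      then have "(LINT x|lebesgue_on (open_cube l p). w x * (q x - k p)) =
          (LINT x|lebesgue_on (open_cube l p). (w x - m p) * q x + (m p * (q x - k p) - k p * (w x - m p)))"
        by simp
      also have "\<dots> = (LINT x|lebesgue_on (open_cube l p). (w x - m p) * q x)
          + (m p * (LINT x|lebesgue_on (open_cube l p). q x - k p) - k p * (LINT x|lebesgue_on (open_cube l p). w x - m p))"
      proof -
        have 1: "integrable (lebesgue_on (open_cube l p)) (\<lambda>x. (w x - m p) * q x)"
          unfolding left_diff_distrib using int by (intro Bochner_Integration.integrable_diff integrable_mult_right)
        have 2: "integrable (lebesgue_on (open_cube l p)) (\<lambda>x. q x - k p)" "integrable (lebesgue_on (open_cube l p)) (\<lambda>x. w x - m p)"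
          using int by (auto intro: Bochner_Integration.integrable_diff)
        define A B C where "A x = (w x - m p) * q x" and "B x = q x - k p" and "C x = w x - m p" for x
        have i: "integrable (lebesgue_on (open_cube l p)) A" "integrable (lebesgue_on (open_cube l p)) B"
            "integrable (lebesgue_on (open_cube l p)) C"
          using 1 2 by (auto simp: A_def[abs_def] B_def[abs_def] C_def[abs_def])
        have "(LINT x|lebesgue_on (open_cube l p). A x + (m p * B x - k p * C x)) =
          (LINT x|lebesgue_on (open_cube l p). A x) + (m p * (LINT x|lebesgue_on (open_cube l p). B x) - k p * (LINT x|lebesgue_on (open_cube l p). C x))"
          by (intro has_bochner_integral_integral_eq has_bochner_integral_diff has_bochner_integral_add
            has_bochner_integral_mult_right has_bochner_integral_integrable i)
        then show ?thesis by (simp add: A_def B_def C_def)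
      qed
      finally show ?thesis using 0 m[OF p] by simp
    qed
    have "(LINT x|lebesgue_on \<Omega>. w x * h x) = (\<Sum>p\<in>P. LINT x|lebesgue_on (open_cube l p). w x * (q x - k p))"
    proof (rule integral_cells)
      have mq: "q \<in> borel_measurable (lebesgue_on \<Omega>)"
        by (intro continuous_imp_measurable_on_sets_lebesgue C1_imp_continuous[OF q(1)]) simp
      have "(\<lambda>x. indicator (open_cube l p) x :: real) \<in> borel_measurable (lebesgue_on \<Omega>)" for p
        by (intro measurable_restrict_space1 borel_measurable_indicator) simp
      then show "(\<lambda>x. w x * h x) \<in> borel_measurable (lebesgue_on \<Omega>)"
        unfolding h_def[abs_def] using w
        by (intro borel_measurable_times borel_measurable_sum borel_measurable_diff mq borel_measurable_const) auto
      show "integrable (lebesgue_on (open_cube l p)) (\<lambda>x. w x * (q x - k p))" if p: "p \<in> P" for p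
        unfolding right_diff_distrib using cell_int[OF p]
        by (intro Bochner_Integration.integrable_diff integrable_mult_left)
      show "AE x in lebesgue_on (open_cube l p). w x * h x = w x * (q x - k p)" if p: "p \<in> P" for p
        using AE_space by eventually_elim (simp add: h_def indicator_cells_eq[OF p])
    qed
    then show ?thesis using cell by simp
  qed
  ultimately show ?thesis by simp
qed

text \<open>The sign of the deviation is approximated on the union of all cells by one sequence of
  polynomials. The same \<open>q n\<close> then serves every cell, and the estimate is obtained for
  the whole sum with a single factor \<open>TV\<close>.\<close>

lemma mean_deviation_le_TV:
  fixes m :: "real^'d \<Rightarrow> real"
  assumes w: "integrable (lebesgue_on \<Omega>) w"
    and m: "\<And>p. p \<in> P \<Longrightarrow> (LINT x|lebesgue_on (open_cube l p). w x - m p) = 0"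
  shows "ereal (\<Sum>p\<in>P. LINT x|lebesgue_on (open_cube l p). \<bar>w x - m p\<bar>)
    \<le> ereal (sqrt (real CARD('d)) * (l / 2)) * TV \<Omega> w"
proof -
  define S where "S = (\<Union>p\<in>P. cube l p)"
  have S: "compact S" unfolding S_def using fin by (intro compact_UN) auto
  define M where "M x = (\<Sum>p\<in>P. indicator (open_cube l p) x * m p)" for x
  define s where "s x = (if x \<in> \<Omega> then sgn (w x - M x) else 0)" for x
  have "(\<lambda>x. indicator (open_cube l p) x :: real) \<in> borel_measurable (lebesgue_on \<Omega>)" for p
    by (intro measurable_restrict_space1 borel_measurable_indicator) simp
  then have "(\<lambda>x. w x - M x) \<in> borel_measurable (lebesgue_on \<Omega>)"
    unfolding M_def using w
    by (intro borel_measurable_diff borel_measurable_sum borel_measurable_times borel_measurable_const) auto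
  then have "(\<lambda>x. sgn (w x - M x)) \<in> borel_measurable (lebesgue_on \<Omega>)"
    by (rule measurable_compose[OF _ borel_measurable_sgn])
  then have "s \<in> borel_measurable lebesgue"
    unfolding s_def by (subst borel_measurable_if) auto
  then have sm: "s \<in> borel_measurable (lebesgue_on S)" by (rule measurable_restrict_space1)
  have sb: "\<bar>s x\<bar> \<le> 1" for x by (auto simp: s_def sgn_if)
  obtain q where q: "\<And>n. real_polynomial_function (q n)" "\<And>n x. x \<in> S \<Longrightarrow> \<bar>q n x\<bar> \<le> 1"
      "AE x in lebesgue_on S. (\<lambda>n. q n x) \<longlonglongrightarrow> s x"
    by (rule polynomial_AE_approximation[OF S sm sb]) (rule that, assumption+)
  have "(\<lambda>n. LINT x|lebesgue_on (open_cube l p). (w x - m p) * q n x) \<longlonglongrightarrow>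
      (LINT x|lebesgue_on (open_cube l p). \<bar>w x - m p\<bar>)" if p: "p \<in> P" for p
  proof (rule integral_dominated_convergence[where w = "\<lambda>x. \<bar>w x - m p\<bar>"])
    have iw: "integrable (lebesgue_on (open_cube l p)) (\<lambda>x. w x - m p)"
      by (intro Bochner_Integration.integrable_diff integrable_lebesgue_on_subset[OF w open_cube_subset[OF p]]
          continuous_integrable_open_cube continuous_intros) auto
    then show "integrable (lebesgue_on (open_cube l p)) (\<lambda>x. \<bar>w x - m p\<bar>)"
      by (rule Bochner_Integration.integrable_abs)
    show "(\<lambda>x. \<bar>w x - m p\<bar>) \<in> borel_measurable (lebesgue_on (open_cube l p))" using iw by simp
    have mq: "q n \<in> borel_measurable (lebesgue_on (open_cube l p))" for n
      by (intro continuous_imp_measurable_on_sets_lebesgue C1_imp_continuous C1_real_polynomial_function q) simp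
    show "(\<lambda>x. (w x - m p) * q n x) \<in> borel_measurable (lebesgue_on (open_cube l p))" for n
      using iw by (intro borel_measurable_times mq) simp
    have sub: "open_cube l p \<subseteq> S" using open_cube_subset_cube p by (auto simp: S_def)
    show "AE x in lebesgue_on (open_cube l p). norm ((w x - m p) * q n x) \<le> \<bar>w x - m p\<bar>" for n
      using AE_space
    proof eventually_elim
      case (elim x)
      then have "x \<in> S" using sub by auto
      then show ?case using q(2) by (simp add: abs_mult mult_left_le)
    qed
    have "AE x in lebesgue. x \<in> S \<longrightarrow> (\<lambda>n. q n x) \<longlonglongrightarrow> s x"
      using q(3) S by (simp add: AE_restrict_space_iff lmeasurable_compact fmeasurableD)
    then have "AE x in lebesgue. x \<in> open_cube l p \<longrightarrow> (\<lambda>n. q n x) \<longlonglongrightarrow> s x"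
      by eventually_elim (use sub in blast)
    then have "AE x in lebesgue_on (open_cube l p). (\<lambda>n. q n x) \<longlonglongrightarrow> s x"
      by (simp add: AE_restrict_space_iff)
    then show "AE x in lebesgue_on (open_cube l p). (\<lambda>n. (w x - m p) * q n x) \<longlonglongrightarrow> \<bar>w x - m p\<bar>"
      using AE_space
    proof eventually_elim
      case (elim x)
      then have x: "x \<in> open_cube l p" by simp
      then have "s x = sgn (w x - m p)"
        using open_cube_subset[OF p] indicator_cells_eq[OF p x] by (auto simp: s_def M_def)
      then have "(w x - m p) * s x = \<bar>w x - m p\<bar>" by (simp add: sgn_if)
      then show ?case using tendsto_mult_left[OF elim(1), of "w x - m p"] by simp
    qed
  qed
  then have "(\<lambda>n. \<Sum>p\<in>P. LINT x|lebesgue_on (open_cube l p). (w x - m p) * q n x) \<longlonglongrightarrow>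
      (\<Sum>p\<in>P. LINT x|lebesgue_on (open_cube l p). \<bar>w x - m p\<bar>)"
    by (rule tendsto_sum)
  then have lim: "(\<lambda>n. ereal (\<Sum>p\<in>P. LINT x|lebesgue_on (open_cube l p). (w x - m p) * q n x)) \<longlonglongrightarrow>
      ereal (\<Sum>p\<in>P. LINT x|lebesgue_on (open_cube l p). \<bar>w x - m p\<bar>)"
    by simp
  have "ereal (\<Sum>p\<in>P. LINT x|lebesgue_on (open_cube l p). (w x - m p) * q n x)
      \<le> ereal (sqrt (real CARD('d)) * (l / 2)) * TV \<Omega> w" for n
    by (rule mean_deviation_test[OF w m C1_real_polynomial_function[OF q(1)]])
      (use q(2) in \<open>auto simp: S_def\<close>)
  then show ?thesis by (intro Lim_bounded[OF lim]) auto
qed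

end

section \<open>Rounding\<close>

text \<open>An attained competitor makes the finite set of minimizers nonempty; only then does
  \<open>Min\<close> return one of them.\<close>

lemma rounded_value_closest:
  assumes "finite W" "\<omega> \<in> W" "0 < emeasure lebesgue {x\<in>Q. w x = real_of_int \<omega>}"
  shows "\<bar>cell_mean w Q - real_of_int (rounded_value W w Q)\<bar> \<le> \<bar>cell_mean w Q - real_of_int \<omega>\<bar>"
proof -
  define A where "A = {\<omega> \<in> W. 0 < emeasure lebesgue {x\<in>Q. w x = real_of_int \<omega>}}"
  define f where "f = (\<lambda>\<omega>. \<bar>cell_mean w Q - real_of_int \<omega>\<bar>)"
  define B where "B = {\<omega>. is_arg_min f (\<lambda>\<omega>. \<omega> \<in> A) \<omega>}"
  have A: "finite A" "\<omega> \<in> A" using assms by (auto simp: A_def)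
  have "B \<noteq> {}" using ex_is_arg_min_if_finite[OF A(1), of f] A(2) by (auto simp: B_def)
  moreover have "finite B" by (rule finite_subset[OF _ A(1)]) (auto simp: B_def is_arg_min_def)
  ultimately have "Min B \<in> B" by simp
  then have "\<not> f \<omega> < f (Min B)" using A(2) by (auto simp: B_def is_arg_min_def)
  moreover have "rounded_value W w Q = Min B"
    by (simp add: rounded_value_def B_def A_def f_def)
  ultimately show ?thesis by (simp add: f_def)
qed

context cube_mesh
begin

text \<open>\<open>cell_mean\<close> integrates over the closed cell and the claim over the open
  one; they agree because the boundary of the cell is negligible.\<close>

lemma cell_mean_deviation_eq_0:
  assumes w: "integrable (lebesgue_on \<Omega>) w" and p: "p \<in> P"
  shows "(LINT x|lebesgue_on (open_cube l p). w x - cell_mean w (cube l p)) = 0"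
proof -
  have iw: "integrable (lebesgue_on (open_cube l p)) w"
    by (rule integrable_lebesgue_on_subset[OF w open_cube_subset[OF p]]) auto
  then have "w absolutely_integrable_on open_cube l p"
    by (simp add: set_integrable_def integrable_restrict_space)
  then have "w absolutely_integrable_on cube l p"
    by (rule absolutely_integrable_spike_set)
      (use open_cube_subset_cube[of l p] negligible_cube_boundary[of l p]
        in \<open>auto intro: negligible_subset\<close>)
  then have iw': "integrable (lebesgue_on (cube l p)) w"
    by (simp add: set_integrable_def integrable_restrict_space)
  define c where "c = measure lebesgue (cube l p)"
  have c_eq: "c = measure lborel (cbox p (\<chi> i. p $ i + l))" by (simp add: c_def cube_def measure_completion)
  have "box p (\<chi> i. p $ i + l) \<noteq> {}" using l_pos by (simp add: interval_eq_empty_cart)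
  then have c: "0 < c" unfolding c_eq
    by (metis content_eq_0_interior interior_cbox measure_nonneg order_le_less)
  have "(LINT x|lebesgue_on (cube l p). w x) = integral (cube l p) w"
    by (rule lebesgue_integral_eq_integral[OF iw']) simp
  also have "\<dots> = integral (open_cube l p) w"
    unfolding open_cube_def cube_def by (rule integral_open_interval[symmetric])
  also have "\<dots> = (LINT x|lebesgue_on (open_cube l p). w x)"
    by (rule lebesgue_integral_eq_integral[OF iw, symmetric]) simp
  finally have mean: "cell_mean w (cube l p) * c = (LINT x|lebesgue_on (open_cube l p). w x)"
    using c by (simp add: cell_mean_def c_def)
  have ic: "integrable (lebesgue_on (open_cube l p)) (\<lambda>x. k)" for k :: real
    by (intro continuous_integrable_open_cube continuous_intros)
  have const: "(LINT x|lebesgue_on (open_cube l p). k) = k * c" for k :: real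
  proof -
    have "(LINT x|lebesgue_on (open_cube l p). k) = integral (open_cube l p) (\<lambda>x. k)"
      by (rule lebesgue_integral_eq_integral[OF ic]) simp
    also have "\<dots> = integral (cbox p (\<chi> i. p $ i + l)) (\<lambda>x. k)"
      unfolding open_cube_def by (rule integral_open_interval)
    finally show ?thesis by (simp add: c_eq mult.commute)
  qed
  show ?thesis
    unfolding Bochner_Integration.integral_diff[OF iw ic] const mean by simp
qed

lemma rounding_cell:
  assumes "p \<in> P" "x \<in> open_cube l p"
  shows "rounding W (cube l ` P) w x = real_of_int (rounded_value W w (cube l p))"
proof -
  have "inj_on (cube l) P" using cube_inject[OF l_pos] by (auto simp: inj_on_def)
  then have "rounding W (cube l ` P) w x =
      (\<Sum>q\<in>P. indicator (open_cube l q) x * real_of_int (rounded_value W w (cube l q)))"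
    by (simp add: rounding_def sum.reindex interior_cube)
  then show ?thesis by (simp add: indicator_cells_eq[OF assms])
qed

lemma rounding_integrable: "integrable (lebesgue_on \<Omega>) (rounding W (cube l ` P) w)"
proof (rule integral_cells(1))
  have "(\<lambda>x. indicator (interior Q) x :: real) \<in> borel_measurable (lebesgue_on \<Omega>)" for Q
    by (intro measurable_restrict_space1 borel_measurable_indicator)
      (simp add: sets_completionI_sets borel_open)
  then show "rounding W (cube l ` P) w \<in> borel_measurable (lebesgue_on \<Omega>)"
    unfolding rounding_def[abs_def]
    by (intro borel_measurable_sum borel_measurable_times borel_measurable_const)
  show "integrable (lebesgue_on (open_cube l p)) (\<lambda>x. real_of_int (rounded_value W w (cube l p)))" for p
    by (intro continuous_integrable_open_cube continuous_intros)
  show "AE x in lebesgue_on (open_cube l p). rounding W (cube l ` P) w x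
      = real_of_int (rounded_value W w (cube l p))" if "p \<in> P" for p
    using AE_space by eventually_elim (simp add: rounding_cell[OF that])
qed

text \<open>There are finitely many values, so the points whose value is attained only on a null set
  of the cell form a null set. At every other point \<open>w x\<close> competes in the rounding,
  hence the rounded value is no farther from the mean than \<open>w x\<close>, and the triangle
  inequality through the mean gives the factor 2.\<close>

lemma AE_rounded_value_deviation:
  assumes W: "finite W" and w: "w \<in> borel_measurable (lebesgue_on \<Omega>)"
    and wW: "AE x in lebesgue_on \<Omega>. w x \<in> real_of_int ` W" and p: "p \<in> P"
  shows "AE x in lebesgue_on (open_cube l p).
    \<bar>real_of_int (rounded_value W w (cube l p)) - w x\<bar> \<le> 2 * \<bar>w x - cell_mean w (cube l p)\<bar>"
proof -
  have "AE x in lebesgue. \<forall>\<omega>\<in>W. x \<in> open_cube l p \<longrightarrow> w x = real_of_int \<omega> \<longrightarrow>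
      0 < emeasure lebesgue {x\<in>cube l p. w x = real_of_int \<omega>}"
  proof (rule AE_finite_allI[OF W])
    fix \<omega> assume "\<omega> \<in> W"
    \<comment> \<open>\<open>w\<close> is known to be measurable on \<open>\<Omega>\<close> only,
      and facets of the cell may lie outside. The level set is therefore measured in the open cell
      first and then enlarged by a subset of the negligible boundary.\<close>
    define N where "N = {x\<in>cube l p. w x = real_of_int \<omega>}"
    define N' where "N' = {x\<in>open_cube l p. w x = real_of_int \<omega>}"
    have "w -` {real_of_int \<omega>} \<inter> space (lebesgue_on \<Omega>) \<in> sets (lebesgue_on \<Omega>)"
      by (rule measurable_sets[OF w]) simp
    then have "w -` {real_of_int \<omega>} \<inter> \<Omega> \<in> sets lebesgue"
      by (simp add: sets_restrict_space_iff)
    then have "w -` {real_of_int \<omega>} \<inter> \<Omega> \<inter> open_cube l p \<in> sets lebesgue"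
      by (rule sets.Int) simp
    moreover have "w -` {real_of_int \<omega>} \<inter> \<Omega> \<inter> open_cube l p = N'"
      using open_cube_subset[OF p] by (auto simp: N'_def)
    ultimately have N': "N' \<in> sets lebesgue" by simp
    have "negligible (N - N')"
      by (rule negligible_subset[OF negligible_cube_boundary[of l p]]) (auto simp: N_def N'_def)
    then have "N' \<union> (N - N') \<in> sets lebesgue"
      using N' negligible_imp_sets by (intro sets.Un) auto
    moreover have "N' \<union> (N - N') = N" using open_cube_subset_cube by (auto simp: N_def N'_def)
    ultimately have N: "N \<in> sets lebesgue" by simp
    show "AE x in lebesgue. x \<in> open_cube l p \<longrightarrow> w x = real_of_int \<omega> \<longrightarrow> 0 < emeasure lebesgue {x\<in>cube l p. w x = real_of_int \<omega>}"
    proof (cases "emeasure lebesgue N = 0")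
      case True
      then have "AE x in lebesgue. x \<notin> N"
        using N by (intro AE_not_in) (simp add: null_sets_def)
      then show ?thesis
        by eventually_elim (use open_cube_subset_cube[of l p] in \<open>auto simp: N_def\<close>)
    next
      case False
      then have "0 < emeasure lebesgue N" by (simp add: zero_less_iff_neq_zero)
      then show ?thesis by (simp add: N_def)
    qed
  qed
  moreover have "AE x in lebesgue. x \<in> \<Omega> \<longrightarrow> w x \<in> real_of_int ` W"
    using wW by (simp add: AE_restrict_space_iff)
  ultimately have "AE x in lebesgue. x \<in> open_cube l p \<longrightarrow>
    \<bar>real_of_int (rounded_value W w (cube l p)) - w x\<bar> \<le> 2 * \<bar>w x - cell_mean w (cube l p)\<bar>"
  proof eventually_elim
    case (elim x)
    show ?case
    proof
      assume x: "x \<in> open_cube l p"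
      then obtain \<omega> where \<omega>: "\<omega> \<in> W" "w x = real_of_int \<omega>"
        using elim(2) open_cube_subset[OF p] by blast
      then have "0 < emeasure lebesgue {x\<in>cube l p. w x = real_of_int \<omega>}"
        using elim(1) x by blast
      from rounded_value_closest[OF W \<omega>(1) this]
      have "\<bar>cell_mean w (cube l p) - real_of_int (rounded_value W w (cube l p))\<bar> \<le> \<bar>cell_mean w (cube l p) - w x\<bar>"
        unfolding \<omega>(2) .
      moreover have "\<bar>r - v\<bar> \<le> 2 * \<bar>v - m\<bar>" if "\<bar>m - r\<bar> \<le> \<bar>m - v\<bar>" for r v m :: real
        using that abs_triangle_ineq4[of "r - m" "v - m"] by (simp add: abs_minus_commute)
      ultimately show "\<bar>real_of_int (rounded_value W w (cube l p)) - w x\<bar> \<le> 2 * \<bar>w x - cell_mean w (cube l p)\<bar>"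
        by blast
    qed
  qed
  then show ?thesis by (simp add: AE_restrict_space_iff)
qed

lemma rounding_deviation_le_TV:
  assumes W: "finite W" and w: "integrable (lebesgue_on \<Omega>) w"
    and wW: "AE x in lebesgue_on \<Omega>. w x \<in> real_of_int ` W"
  shows "ereal (LINT x|lebesgue_on \<Omega>. \<bar>rounding W (cube l ` P) w x - w x\<bar>)
    \<le> ereal (sqrt (real CARD('d)) * l) * TV \<Omega> w"
proof -
  define R where "R p = real_of_int (rounded_value W w (cube l p))" for p
  define m where "m p = cell_mean w (cube l p)" for p
  define k where "k p x = \<bar>R p - w x\<bar>" for p x
  have iw: "integrable (lebesgue_on (open_cube l p)) w" if "p \<in> P" for p
    by (rule integrable_lebesgue_on_subset[OF w open_cube_subset[OF that]]) auto
  have ic: "integrable (lebesgue_on (open_cube l p)) (\<lambda>x. b)" for b :: real and p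
    by (intro continuous_integrable_open_cube continuous_intros)
  have ik: "integrable (lebesgue_on (open_cube l p)) (k p)" if "p \<in> P" for p
    unfolding k_def[abs_def]
    by (intro Bochner_Integration.integrable_abs Bochner_Integration.integrable_diff ic iw that)
  have im: "integrable (lebesgue_on (open_cube l p)) (\<lambda>x. \<bar>w x - m p\<bar>)" if "p \<in> P" for p
    by (intro Bochner_Integration.integrable_abs Bochner_Integration.integrable_diff ic iw that)
  have "(LINT x|lebesgue_on \<Omega>. \<bar>rounding W (cube l ` P) w x - w x\<bar>)
      = (\<Sum>p\<in>P. LINT x|lebesgue_on (open_cube l p). k p x)"
  proof (rule integral_cells)
    show "(\<lambda>x. \<bar>rounding W (cube l ` P) w x - w x\<bar>) \<in> borel_measurable (lebesgue_on \<Omega>)"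
      using rounding_integrable w by (intro borel_measurable_abs borel_measurable_diff) auto
    show "AE x in lebesgue_on (open_cube l p). \<bar>rounding W (cube l ` P) w x - w x\<bar> = k p x" if "p \<in> P" for p
      using AE_space by eventually_elim (simp add: rounding_cell[OF that] k_def R_def)
  qed (rule ik)
  also have "\<dots> \<le> (\<Sum>p\<in>P. 2 * (LINT x|lebesgue_on (open_cube l p). \<bar>w x - m p\<bar>))"
  proof (rule sum_mono)
    fix p assume p: "p \<in> P"
    have "(LINT x|lebesgue_on (open_cube l p). k p x) \<le> (LINT x|lebesgue_on (open_cube l p). 2 * \<bar>w x - m p\<bar>)"
    proof (rule integral_mono_AE)
      show "AE x in lebesgue_on (open_cube l p). k p x \<le> 2 * \<bar>w x - m p\<bar>"
        using AE_rounded_value_deviation[OF W _ wW p] w by (simp add: k_def R_def m_def)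
    qed (use ik[OF p] im[OF p] in auto)
    then show "(LINT x|lebesgue_on (open_cube l p). k p x) \<le> 2 * (LINT x|lebesgue_on (open_cube l p). \<bar>w x - m p\<bar>)"
      by simp
  qed
  finally have "ereal (LINT x|lebesgue_on \<Omega>. \<bar>rounding W (cube l ` P) w x - w x\<bar>)
      \<le> ereal 2 * ereal (\<Sum>p\<in>P. LINT x|lebesgue_on (open_cube l p). \<bar>w x - m p\<bar>)"
    by (simp add: sum_distrib_left)
  \<comment> \<open>The factor 2 from the rounding meets the l / 2 of the mean deviation and leaves
    l.\<close>
  also have "\<dots> \<le> ereal 2 * (ereal (sqrt (real CARD('d)) * (l / 2)) * TV \<Omega> w)"
    using cell_mean_deviation_eq_0[OF w]
    by (intro ereal_mult_left_mono mean_deviation_le_TV w) (simp_all add: m_def)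
  also have "\<dots> = ereal (sqrt (real CARD('d)) * l) * TV \<Omega> w"
    by (simp add: mult.assoc[symmetric])
  finally show ?thesis .
qed

section \<open>Comparison of discretized total variations\<close>

lemma rt0_field_exists:
  assumes "\<phi> \<in> RT0_0 \<Omega> (cube l ` P)" "Linf_norm \<Omega> \<phi> \<le> 1" "weak_divergence \<Omega> \<phi> g"
  obtains a c where "rt0_field \<Omega> l P \<phi> g a c"
proof -
  have "\<exists>a c. AE x in lebesgue_on (cube l p). \<phi> x = rt0 a c x" if "p \<in> P" for p
    using assms(1) that by (auto simp: RT0_0_def RT0_def)
  then obtain a c where "\<And>p. p \<in> P \<Longrightarrow> AE x in lebesgue_on (cube l p). \<phi> x = rt0 (a p) (c p) x"
    by metis
  then have "rt0_field \<Omega> l P \<phi> g a c"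
    using assms by unfold_locales
  then show ?thesis by (rule that)
qed

lemma TVh_le_TV:
  assumes "integrable (lebesgue_on \<Omega>) w"
  shows "TVh \<Omega> (cube l ` P) w \<le> TV \<Omega> w"
  unfolding TVh_def
proof (rule SUP_least, clarify)
  fix \<phi> g assume "\<phi> \<in> RT0_0 \<Omega> (cube l ` P)" "Linf_norm \<Omega> \<phi> \<le> 1" "weak_divergence \<Omega> \<phi> g"
  then obtain a c where "rt0_field \<Omega> l P \<phi> g a c" by (rule rt0_field_exists)
  then show "ereal (LINT x|lebesgue_on \<Omega>. w x * g x) \<le> TV \<Omega> w"
    using assms by (rule rt0_field.integral_divergence_le_TV)
qed

text \<open>\<open>TVh\<close> is Lipschitz continuous with respect to the L1 distance: every
  competitor has divergence at most 2 * d / l almost everywhere, so exchanging \<open>u\<close> for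
  \<open>v\<close> costs at most this constant times the distance.\<close>

lemma TVh_le_TVh_add:
  assumes u: "integrable (lebesgue_on \<Omega>) u" and v: "integrable (lebesgue_on \<Omega>) v"
  shows "TVh \<Omega> (cube l ` P) u \<le> TVh \<Omega> (cube l ` P) v
    + ereal (2 * real CARD('d) / l * (LINT x|lebesgue_on \<Omega>. \<bar>u x - v x\<bar>))"
  unfolding TVh_def[of _ _ u]
proof (rule SUP_least, clarify)
  fix \<phi> g assume test: "\<phi> \<in> RT0_0 \<Omega> (cube l ` P)" "Linf_norm \<Omega> \<phi> \<le> 1" "weak_divergence \<Omega> \<phi> g"
  then obtain a c where "rt0_field \<Omega> l P \<phi> g a c" by (rule rt0_field_exists)
  then interpret rt0_field \<Omega> l P \<phi> g a c .
  let ?D = "2 * real CARD('d) / l"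
  have bounded_times_g: "integrable (lebesgue_on \<Omega>) (\<lambda>x. f x * g x)"
    if "integrable (lebesgue_on \<Omega>) f" for f
  proof (rule Bochner_Integration.integrable_bound[of _ "\<lambda>x. f x * ?D"])
    show "AE x in lebesgue_on \<Omega>. norm (f x * g x) \<le> norm (f x * ?D)"
      using abs_divergence_le
    proof eventually_elim
      case (elim x)
      then have "\<bar>g x\<bar> \<le> \<bar>?D\<bar>" by linarith
      then show ?case unfolding real_norm_def abs_mult by (rule mult_left_mono) simp
    qed
  qed (use that g_measurable in auto)
  have d: "integrable (lebesgue_on \<Omega>) (\<lambda>x. u x - v x)"
    using u v by (rule Bochner_Integration.integrable_diff)
  have "(LINT x|lebesgue_on \<Omega>. u x * g x) = (LINT x|lebesgue_on \<Omega>. v x * g x + (u x - v x) * g x)"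
    by (simp add: algebra_simps)
  also have "\<dots> = (LINT x|lebesgue_on \<Omega>. v x * g x) + (LINT x|lebesgue_on \<Omega>. (u x - v x) * g x)"
    by (intro Bochner_Integration.integral_add bounded_times_g v d)
  also have "(LINT x|lebesgue_on \<Omega>. (u x - v x) * g x) \<le> (LINT x|lebesgue_on \<Omega>. ?D * \<bar>u x - v x\<bar>)"
  proof (rule integral_mono_AE[OF bounded_times_g[OF d]])
    show "integrable (lebesgue_on \<Omega>) (\<lambda>x. ?D * \<bar>u x - v x\<bar>)" using d by simp
    show "AE x in lebesgue_on \<Omega>. (u x - v x) * g x \<le> ?D * \<bar>u x - v x\<bar>"
      using abs_divergence_le
    proof eventually_elim
      case (elim x)
      have "(u x - v x) * g x \<le> \<bar>u x - v x\<bar> * \<bar>g x\<bar>" by (metis abs_ge_self abs_mult)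
      also have "\<dots> \<le> \<bar>u x - v x\<bar> * ?D" using elim by (intro mult_left_mono) auto
      finally show ?case by (simp add: mult.commute)
    qed
  qed
  finally have "ereal (LINT x|lebesgue_on \<Omega>. u x * g x) \<le> ereal (LINT x|lebesgue_on \<Omega>. v x * g x)
      + ereal (?D * (LINT x|lebesgue_on \<Omega>. \<bar>u x - v x\<bar>))"
    by simp
  also have "\<dots> \<le> TVh \<Omega> (cube l ` P) v + ereal (?D * (LINT x|lebesgue_on \<Omega>. \<bar>u x - v x\<bar>))"
    using test unfolding TVh_def by (intro add_right_mono SUP_upper2[of "(\<phi>, g)"]) auto
  finally show "ereal (LINT x|lebesgue_on \<Omega>. u x * g x) \<le> TVh \<Omega> (cube l ` P) v
      + ereal (?D * (LINT x|lebesgue_on \<Omega>. \<bar>u x - v x\<bar>))" .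
qed

end

theorem proposition2p13:
  fixes \<Omega> :: "(real^'d) set" and W :: "int set" and w :: "real^'d \<Rightarrow> real"
    and h \<tau> :: real and Mh M\<tau> :: "(real^'d) set set"
  assumes "CARD('d) \<in> {1, 2, 3}"
    and "bounded \<Omega>" and "lipschitz_domain \<Omega>" and "finite_cube_union \<Omega>"
    and "finite W" and "W \<noteq> {}"
    and "w \<in> BV_W W \<Omega>"
    and "admissible_mesh_pair \<Omega> h \<tau> Mh M\<tau>"
  shows "TVh \<Omega> Mh (rounding W M\<tau> w) \<le> TVh \<Omega> Mh w + rounding_error \<Omega> \<tau> h w \<and>
         TVh \<Omega> Mh w + rounding_error \<Omega> \<tau> h w \<le> TV \<Omega> w + rounding_error \<Omega> \<tau> h w"
proof
  have w: "integrable (lebesgue_on \<Omega>) w" and wW: "AE x in lebesgue_on \<Omega>. w x \<in> real_of_int ` W"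
    using assms(7) by (auto simp: BV_W_def)
  have h: "0 < h" and Mh: "is_mesh \<Omega> h Mh" and M\<tau>: "is_mesh \<Omega> \<tau> M\<tau>"
    using assms(8) by (auto simp: admissible_mesh_pair_def)
  obtain Ph where Ph: "Mh = cube h ` Ph" "cube_mesh \<Omega> h Ph"
    using mesh_imp_cube_mesh[OF assms(3) Mh] by blast
  obtain P\<tau> where P\<tau>: "M\<tau> = cube \<tau> ` P\<tau>" "cube_mesh \<Omega> \<tau> P\<tau>"
    using mesh_imp_cube_mesh[OF assms(3) M\<tau>] by blast
  \<comment> \<open>The TV mesh supplies the bound on the divergence of the test fields, the input
    mesh the L1 distance between \<open>w\<close> and its rounding; both are stated over the same
    \<open>\<Omega>\<close>.\<close>
  interpret coarse: cube_mesh \<Omega> h Ph by (rule Ph)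
  interpret fine: cube_mesh \<Omega> \<tau> P\<tau> by (rule P\<tau>)
  define D where "D = 2 * real CARD('d) / h"
  define u where "u = rounding W M\<tau> w"
  have D: "0 \<le> D" using h by (simp add: D_def)
  have "TVh \<Omega> Mh u \<le> TVh \<Omega> Mh w + ereal (D * (LINT x|lebesgue_on \<Omega>. \<bar>u x - w x\<bar>))"
    unfolding D_def Ph(1) u_def P\<tau>(1)
    by (rule coarse.TVh_le_TVh_add[OF fine.rounding_integrable w])
  also have "\<dots> \<le> TVh \<Omega> Mh w + rounding_error \<Omega> \<tau> h w"
  proof (rule add_left_mono)
    have "ereal (D * (LINT x|lebesgue_on \<Omega>. \<bar>u x - w x\<bar>)) = ereal D * ereal (LINT x|lebesgue_on \<Omega>. \<bar>u x - w x\<bar>)"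
      by simp
    also have "\<dots> \<le> ereal D * (ereal (sqrt (real CARD('d)) * \<tau>) * TV \<Omega> w)"
      unfolding u_def P\<tau>(1) using D
      by (intro ereal_mult_left_mono fine.rounding_deviation_le_TV[OF assms(5) w wW]) simp
    also have "\<dots> = ereal (D * (sqrt (real CARD('d)) * \<tau>)) * TV \<Omega> w"
      by (simp add: mult.assoc[symmetric])
    also have "D * (sqrt (real CARD('d)) * \<tau>) = sqrt (real CARD('d)) * (2 * real CARD('d) * \<tau> / h)"
      by (simp add: D_def)
    also have "ereal \<dots> * TV \<Omega> w = rounding_error \<Omega> \<tau> h w"
      by (simp only: rounding_error_def times_ereal.simps(1)[symmetric] mult_ac)
    finally show "ereal (D * (LINT x|lebesgue_on \<Omega>. \<bar>u x - w x\<bar>)) \<le> rounding_error \<Omega> \<tau> h w" .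
  qed
  finally show "TVh \<Omega> Mh (rounding W M\<tau> w) \<le> TVh \<Omega> Mh w + rounding_error \<Omega> \<tau> h w"
    by (simp add: u_def)
  show "TVh \<Omega> Mh w + rounding_error \<Omega> \<tau> h w \<le> TV \<Omega> w + rounding_error \<Omega> \<tau> h w"
    unfolding Ph(1) by (intro add_right_mono coarse.TVh_le_TV w)
qed

end
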